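(* Let $R$ be a Krull domain acted on by a group $G$ by ring automorphisms. Let $\chi\in Z^1_R(G,\mathrm U(R))_{\rm e}\cap(-Z^1_R(G,\mathrm U(R))_{(2)})$ be a cocycle such that $n\chi\in Z^1(G,\mathrm U(R))_R$ for all $n\in\mathbf N$. Suppose that there exists $m\in\mathbf N$ such that $R_{m\chi}\cong R^G$ as $R^G$-modules. Then the divisor class $[D(\chi)]$ in $\mathrm{Cl}(R)$ is a torsion element. Suppose moreover that $$\mathrm{coh}(i\chi)-\mathrm{coh}(D(i\chi))\notin\mathrm{tor}(H^1(G,\mathrm U(R)))\setminus\{\mathrm{coh}(\theta)\}$$ for every $i\in\mathbf N$ such that $D(i\chi)$ is a principal divisor. Then the order of $[D(\chi)]$ in $\mathrm{Cl}(R)$ satisfies $$\mathrm{ord}([D(\chi)])=\min\{q\in\mathbf N: R_{q\chi}\cong R^G\text{ as }R^G\text{-modules}\}.$$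
   Context: $R^G$ is a Krull domain. $\mathcal Q(\cdot)$ is the fraction field, $\mathrm U(R)$ the unit group, $\mathrm{Ht}_1(A)$ the set of height one primes of $A$; $\mathrm{Ht}_1^{(i)}(R,R^G)=\{\mathfrak P\in \mathrm{Ht}_1(R): \mathrm{ht}(\mathfrak P\cap R^G)=i\}$, $\mathrm{Ht}_1^{[2]}(R,R^G)=\bigcup_{i\ge2}\mathrm{Ht}_1^{(i)}(R,R^G)$; for $\mathfrak q\in\mathrm{Ht}_1(R^G)$, $X_{\mathfrak q}(R)=\{\mathfrak P\in\mathrm{Ht}_1(R):\mathfrak P\cap R^G=\mathfrak q\}$. $\mathrm v_{R,\mathfrak P}$ is the normalized discrete valuation and $\mathrm e(\mathfrak P,\mathfrak q)$ the ramification index ($\mathrm v_{R,\mathfrak P}=\mathrm e(\mathfrak P,\mathfrak q)\,\mathrm v_{R^G,\mathfrak q}$ on $\mathcal Q(R^G)^\times$). $\mathrm{Div}(R)$ is the free abelian group on the prime divisors $\mathrm{div}_R(\mathfrak P)$, $\mathfrak P\in\mathrm{Ht}_1(R)$, and $\mathrm{div}_R(f)=\sum_{\mathfrak P} \mathrm v_{R,\mathfrak P}(f)\,\mathrm{div}_R(\mathfrak P)$. $Z^1(G,\mathrm U(R))$ is the group of 1-cocycles, written additively, with zero element the trivial cocycle $\theta$. For a cocycle $\chi$, $R_\chi=\{x\in R:\sigma(x)=\chi(\sigma)x\ \forall\sigma\in G\}$. Put $Z^1(G,\mathrm U(R))^R=\{\chi: R_\chi\ne0\}$; $Z^1(G,\mathrm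 U(R))_R=\{\chi\in Z^1(G,\mathrm U(R))^R:\dim_{\mathcal Q(R^G)}\mathcal Q(R^G)\otimes_{R^G}R_\chi=1\}$; $Z^1_R(G,\mathrm U(R))_{(2)}=\{\chi\in -Z^1(G,\mathrm U(R))^R: R_{-\chi}\not\subseteq\mathfrak P\ \forall\,\mathfrak P\in\mathrm{Ht}_1^{[2]}(R,R^G)\}$; $Z^1_R(G,\mathrm U(R))_{\rm e}$ is the set of $\chi\in Z^1(G,\mathrm U(R))^R$ such that for every $\mathfrak P\in\mathrm{Ht}_1^{(1)}(R,R^G)$ there is a nonzero $f_{\mathfrak P}\in R_\chi$ with $\mathrm v_{R,\mathfrak P}(f_{\mathfrak P})\equiv0 \bmod \mathrm e(\mathfrak P,\mathfrak P\cap R^G)$. Let $E^*(G,R)\subseteq\mathrm{Div}(R)$ be the subgroup generated by $\sum_{\mathfrak P\in X_{\mathfrak q}(R)}\mathrm e(\mathfrak P,\mathfrak q)\,\mathrm{div}_R(\mathfrak P)$ ($\mathfrak q\in\mathrm{Ht}_1(R^G)$) and by $\mathrm{div}_R(\mathfrak P)$ ($\mathfrak P\in\mathrm{Ht}_1^{[2]}(R,R^G)$). An effective divisor $D$ is minimal effective relative to $(R^G,R)$ if $D=D_1+D_2$ with $0\le D_1\in E^*(G,R)$, $0\le D_2\in \mathrm{Div}(R)$ forces $D_1=0$. For $\chi\in Z^1(G,\mathrm U(R))_R$, $D(\chi)$ is the unique minimal effective divisor relative to $(R^G,R)$ with $0\le\mathrm{div}_R(f)-D(\chi)\in E^*(G,R)$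 for a nonzero $f\in R_\chi$; it is independent of $f$ and $G$-invariant. $\mathrm{coh}(\chi)\in H^1(G,\mathrm U(R))$ is the cohomology class of $\chi$. For a $G$-invariant principal divisor $D=\mathrm{div}_R(h)$, $h\in\mathcal Q(R)^\times$, $\mathrm{coh}(D)$ is the class of the cocycle $\sigma\mapsto\sigma(h)/h\in\mathrm U(R)$ (independent of $h$). $\mathrm{tor}(A)$ is the torsion part of an abelian group $A$. *)

theory Defs
  imports
    "HOL-Algebra.Free_Abelian_Groups"
    "HOL-Algebra.Generated_Groups"
    "HOL-Algebra.Group_Action"
    "HOL-Algebra.Multiplicative_Group"
    "HOL-Algebra.Subrings"
    "HOL-Algebra.Ring_Divisibility"
    "HOL-Library.Extended_Nat"
    "HOL-Number_Theory.Cong"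
    "Jordan_Normal_Form.Missing_VectorSpace"
begin

text \<open>
  All domains live inside one ambient field \<open>K\<close>; a subring is given by its carrier set.  The ring
  \<open>R\<close> on which \<open>G\<close> acts satisfies \<open>carrier K = fractions K R\<close>, so that \<open>K\<close> is (a model of) the
  quotient field of \<open>R\<close>, while the quotient field of the ring of invariants is the subfield
  \<open>fractions K (fixed_ring R G \<phi>)\<close>, in general smaller than \<open>K\<close>.
  Cocycles, cohomology classes and divisor classes are written multiplicatively, as in the algebra
  library: \<open>\<chi> [^] n\<close> is \<open>n \<chi>\<close>, and \<open>inv \<chi>\<close> is \<open>- \<chi>\<close>.  Divisors are added with \<open>+\<close>, which is also the
  group operation of the free abelian group \<open>Div K R\<close>.
\<close>

abbreviation subring_of :: "('a, 'b) ring_scheme \<Rightarrow> 'a set \<Rightarrow> ('a, 'b) ring_scheme"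
  where "subring_of K A \<equiv> K\<lparr>carrier := A\<rparr>"

definition fractions :: "('a, 'b) ring_scheme \<Rightarrow> 'a set \<Rightarrow> 'a set"
  where "fractions K A = {a \<otimes>\<^bsub>K\<^esub> inv\<^bsub>K\<^esub> b | a b. a \<in> A \<and> b \<in> A - {\<zero>\<^bsub>K\<^esub>}}"

definition localization :: "('a, 'b) ring_scheme \<Rightarrow> 'a set \<Rightarrow> 'a set \<Rightarrow> 'a set"
  where "localization K A P = {a \<otimes>\<^bsub>K\<^esub> inv\<^bsub>K\<^esub> s | a s. a \<in> A \<and> s \<in> A - P}"

definition height :: "('a, 'b) ring_scheme \<Rightarrow> 'a set \<Rightarrow> enat"
  where "height A P = Sup {enat n | n. \<exists>Q :: nat \<Rightarrow> 'a set.
    (\<forall>i\<le>n. primeideal (Q i) A) \<and> (\<forall>i<n. Q i \<subset> Q (Suc i)) \<and> Q n = P}"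

definition Ht1 :: "('a, 'b) ring_scheme \<Rightarrow> 'a set \<Rightarrow> 'a set set"
  where "Ht1 K A = {P. primeideal P (subring_of K A) \<and> height (subring_of K A) P = 1}"

definition discrete_valuation_ring :: "('a, 'b) ring_scheme \<Rightarrow> bool"
  where "discrete_valuation_ring A \<longleftrightarrow>
    principal_domain A \<and> \<not> field A \<and> (\<exists>!M. maximalideal M A)"

definition krull_domain :: "('a, 'b) ring_scheme \<Rightarrow> 'a set \<Rightarrow> bool"
  where "krull_domain K A \<longleftrightarrow>
    subdomain A K
    \<and> (\<forall>P\<in>Ht1 K A. discrete_valuation_ring (subring_of K (localization K A P)))
    \<and> A = {x \<in> fractions K A. \<forall>P\<in>Ht1 K A. x \<in> localization K A P}
    \<and> (\<forall>x\<in>A - {\<zero>\<^bsub>K\<^esub>}. finite {P \<in> Ht1 K A. x \<in> P})"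

text \<open>
  The normalized valuation of the discrete valuation ring \<open>A\<^sub>P\<close>, for nonzero \<open>x\<close> in the quotient
  field of \<open>A\<close>: \<open>x = u t\<^sup>n\<close> with \<open>u\<close> a unit of \<open>A\<^sub>P\<close> and \<open>t\<close> a generator of its maximal ideal.
\<close>

definition valuation :: "('a, 'b) ring_scheme \<Rightarrow> 'a set \<Rightarrow> 'a set \<Rightarrow> 'a \<Rightarrow> int"
  where "valuation K A P x = (THE n. \<exists>t u.
    t \<in> localization K A P
    \<and> maximalideal (PIdl\<^bsub>subring_of K (localization K A P)\<^esub> t) (subring_of K (localization K A P))
    \<and> u \<in> Units (subring_of K (localization K A P))
    \<and> x = u \<otimes>\<^bsub>K\<^esub> t [^]\<^bsub>K\<^esub> n)"


subsection \<open>Invariants and ramification\<close>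

definition fixed_ring :: "'a set \<Rightarrow> ('g, 'c) monoid_scheme \<Rightarrow> ('g \<Rightarrow> 'a \<Rightarrow> 'a) \<Rightarrow> 'a set"
  where "fixed_ring R G \<phi> = {x \<in> R. \<forall>\<sigma>\<in>carrier G. \<phi> \<sigma> x = x}"

text \<open>For a subring \<open>A\<close> of \<open>R\<close>: height one primes \<open>P\<close> of \<open>R\<close> such that \<open>P \<inter> A\<close> has height \<open>i\<close>.\<close>

definition Ht1_over :: "('a, 'b) ring_scheme \<Rightarrow> 'a set \<Rightarrow> 'a set \<Rightarrow> enat \<Rightarrow> 'a set set"
  where "Ht1_over K R A i = {P \<in> Ht1 K R. height (subring_of K A) (P \<inter> A) = i}"

text \<open>The index ranges over \<open>enat\<close>, hence contractions of infinite height are included.\<close>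

definition Ht1_ge2 :: "('a, 'b) ring_scheme \<Rightarrow> 'a set \<Rightarrow> 'a set \<Rightarrow> 'a set set"
  where "Ht1_ge2 K R A = (\<Union>i\<in>{i. 2 \<le> i}. Ht1_over K R A i)"

definition primes_over :: "('a, 'b) ring_scheme \<Rightarrow> 'a set \<Rightarrow> 'a set \<Rightarrow> 'a set \<Rightarrow> 'a set set"
  where "primes_over K R A q = {P \<in> Ht1 K R. P \<inter> A = q}"

definition ramification_index ::
    "('a, 'b) ring_scheme \<Rightarrow> 'a set \<Rightarrow> 'a set \<Rightarrow> 'a set \<Rightarrow> 'a set \<Rightarrow> nat"
  where "ramification_index K R A P q = (THE e.
    \<forall>x\<in>fractions K A - {\<zero>\<^bsub>K\<^esub>}. valuation K R P x = int e * valuation K A q x)"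


subsection \<open>Divisors\<close>

text \<open>The prime divisor of \<open>P\<close> is the basis element \<open>frag_of P\<close> of \<open>Div K R\<close>.\<close>

definition Div :: "('a, 'b) ring_scheme \<Rightarrow> 'a set \<Rightarrow> ('a set \<Rightarrow>\<^sub>0 int) monoid"
  where "Div K R = free_Abelian_group (Ht1 K R)"

definition divisor_of :: "('a, 'b) ring_scheme \<Rightarrow> 'a set \<Rightarrow> 'a \<Rightarrow> ('a set \<Rightarrow>\<^sub>0 int)"
  where "divisor_of K R f =
    (\<Sum>P\<in>{P \<in> Ht1 K R. valuation K R P f \<noteq> 0}. frag_cmul (valuation K R P f) (frag_of P))"

definition principal_divisors :: "('a, 'b) ring_scheme \<Rightarrow> 'a set \<Rightarrow> ('a set \<Rightarrow>\<^sub>0 int) set"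
  where "principal_divisors K R = {divisor_of K R h | h. h \<in> carrier K - {\<zero>\<^bsub>K\<^esub>}}"

definition Cl :: "('a, 'b) ring_scheme \<Rightarrow> 'a set \<Rightarrow> ('a set \<Rightarrow>\<^sub>0 int) set monoid"
  where "Cl K R = Div K R Mod principal_divisors K R"

definition divisor_class ::
    "('a, 'b) ring_scheme \<Rightarrow> 'a set \<Rightarrow> ('a set \<Rightarrow>\<^sub>0 int) \<Rightarrow> ('a set \<Rightarrow>\<^sub>0 int) set"
  where "divisor_class K R D = principal_divisors K R #>\<^bsub>Div K R\<^esub> D"

text \<open>Coefficientwise; the library order on \<open>\<Rightarrow>\<^sub>0\<close> is a different, lexicographic one.\<close>

definition effective :: "('p \<Rightarrow>\<^sub>0 int) \<Rightarrow> bool"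
  where "effective D \<longleftrightarrow> (\<forall>P. 0 \<le> Poly_Mapping.lookup D P)"

definition Estar :: "('a, 'b) ring_scheme \<Rightarrow> 'a set \<Rightarrow> 'a set \<Rightarrow> ('a set \<Rightarrow>\<^sub>0 int) set"
  where "Estar K R A = generate (Div K R)
    ({\<Sum>P\<in>primes_over K R A q. frag_cmul (int (ramification_index K R A P q)) (frag_of P)
       | q. q \<in> Ht1 K A}
     \<union> {frag_of P | P. P \<in> Ht1_ge2 K R A})"

definition minimal_effective ::
    "('a, 'b) ring_scheme \<Rightarrow> 'a set \<Rightarrow> 'a set \<Rightarrow> ('a set \<Rightarrow>\<^sub>0 int) \<Rightarrow> bool"
  where "minimal_effective K R A D \<longleftrightarrow>
    D \<in> carrier (Div K R) \<and> effective D
    \<and> (\<forall>D1 D2. D1 \<in> Estar K R A \<and> effective D1 \<and> D2 \<in> carrier (Div K R) \<and> effective D2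
          \<and> D = D1 + D2 \<longrightarrow> D1 = 0)"


subsection \<open>Cocycles and cohomology\<close>

definition Z1 :: "('a, 'b) ring_scheme \<Rightarrow> 'a set \<Rightarrow> ('g, 'c) monoid_scheme
    \<Rightarrow> ('g \<Rightarrow> 'a \<Rightarrow> 'a) \<Rightarrow> ('g \<Rightarrow> 'a) monoid"
  where "Z1 K R G \<phi> =
    \<lparr>carrier = {\<chi> \<in> carrier G \<rightarrow>\<^sub>E Units (subring_of K R). \<forall>\<sigma>\<in>carrier G. \<forall>\<tau>\<in>carrier G.
        \<chi> (\<sigma> \<otimes>\<^bsub>G\<^esub> \<tau>) = \<chi> \<sigma> \<otimes>\<^bsub>K\<^esub> \<phi> \<sigma> (\<chi> \<tau>)},
     monoid.mult = (\<lambda>\<chi> \<psi>. \<lambda>\<sigma>\<in>carrier G. \<chi> \<sigma> \<otimes>\<^bsub>K\<^esub> \<psi> \<sigma>),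
     one = (\<lambda>\<sigma>\<in>carrier G. \<one>\<^bsub>K\<^esub>)\<rparr>"

definition B1 :: "('a, 'b) ring_scheme \<Rightarrow> 'a set \<Rightarrow> ('g, 'c) monoid_scheme
    \<Rightarrow> ('g \<Rightarrow> 'a \<Rightarrow> 'a) \<Rightarrow> ('g \<Rightarrow> 'a) set"
  where "B1 K R G \<phi> =
    {\<lambda>\<sigma>\<in>carrier G. \<phi> \<sigma> u \<otimes>\<^bsub>K\<^esub> inv\<^bsub>K\<^esub> u | u. u \<in> Units (subring_of K R)}"

definition H1 :: "('a, 'b) ring_scheme \<Rightarrow> 'a set \<Rightarrow> ('g, 'c) monoid_scheme
    \<Rightarrow> ('g \<Rightarrow> 'a \<Rightarrow> 'a) \<Rightarrow> ('g \<Rightarrow> 'a) set monoid"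
  where "H1 K R G \<phi> = Z1 K R G \<phi> Mod B1 K R G \<phi>"

definition coh :: "('a, 'b) ring_scheme \<Rightarrow> 'a set \<Rightarrow> ('g, 'c) monoid_scheme
    \<Rightarrow> ('g \<Rightarrow> 'a \<Rightarrow> 'a) \<Rightarrow> ('g \<Rightarrow> 'a) \<Rightarrow> ('g \<Rightarrow> 'a) set"
  where "coh K R G \<phi> \<chi> = B1 K R G \<phi> #>\<^bsub>Z1 K R G \<phi>\<^esub> \<chi>"

text \<open>The extension of an automorphism \<open>s\<close> of \<open>R\<close> to the quotient field \<open>K\<close>.\<close>

definition frac_ext :: "('a, 'b) ring_scheme \<Rightarrow> 'a set \<Rightarrow> ('a \<Rightarrow> 'a) \<Rightarrow> 'a \<Rightarrow> 'a"
  where "frac_ext K R s h = (THE y. \<exists>a\<in>R. \<exists>b\<in>R - {\<zero>\<^bsub>K\<^esub>}.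
    h = a \<otimes>\<^bsub>K\<^esub> inv\<^bsub>K\<^esub> b \<and> y = s a \<otimes>\<^bsub>K\<^esub> inv\<^bsub>K\<^esub> (s b))"

definition coh_div :: "('a, 'b) ring_scheme \<Rightarrow> 'a set \<Rightarrow> ('g, 'c) monoid_scheme
    \<Rightarrow> ('g \<Rightarrow> 'a \<Rightarrow> 'a) \<Rightarrow> ('a set \<Rightarrow>\<^sub>0 int) \<Rightarrow> ('g \<Rightarrow> 'a) set"
  where "coh_div K R G \<phi> D = (THE c. \<exists>h\<in>carrier K - {\<zero>\<^bsub>K\<^esub>}.
    D = divisor_of K R h
    \<and> c = coh K R G \<phi> (\<lambda>\<sigma>\<in>carrier G. frac_ext K R (\<phi> \<sigma>) h \<otimes>\<^bsub>K\<^esub> inv\<^bsub>K\<^esub> h))"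

definition torsion_part :: "('a, 'b) monoid_scheme \<Rightarrow> 'a set"
  where "torsion_part A = {x \<in> carrier A. \<exists>n::nat. 0 < n \<and> x [^]\<^bsub>A\<^esub> n = \<one>\<^bsub>A\<^esub>}"


subsection \<open>Modules of semi-invariants\<close>

definition semi_invariants :: "('a, 'b) ring_scheme \<Rightarrow> 'a set \<Rightarrow> ('g, 'c) monoid_scheme
    \<Rightarrow> ('g \<Rightarrow> 'a \<Rightarrow> 'a) \<Rightarrow> ('g \<Rightarrow> 'a) \<Rightarrow> 'a set"
  where "semi_invariants K R G \<phi> \<chi> = {x \<in> R. \<forall>\<sigma>\<in>carrier G. \<phi> \<sigma> x = \<chi> \<sigma> \<otimes>\<^bsub>K\<^esub> x}"

text \<open>An additive subgroup \<open>M\<close> of \<open>K\<close> as a module over any subring of \<open>K\<close> stabilizing it.\<close>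

definition module_in :: "('a, 'b) ring_scheme \<Rightarrow> 'a set \<Rightarrow> ('a, 'a) module"
  where "module_in K M =
    \<lparr>carrier = M, monoid.mult = (\<otimes>\<^bsub>K\<^esub>), one = \<one>\<^bsub>K\<^esub>, zero = \<zero>\<^bsub>K\<^esub>, add = (\<oplus>\<^bsub>K\<^esub>), smult = (\<otimes>\<^bsub>K\<^esub>)\<rparr>"

definition module_iso ::
    "('a, 'b) ring_scheme \<Rightarrow> ('a, 'm, 'c) module_scheme \<Rightarrow> ('a, 'n, 'd) module_scheme \<Rightarrow> bool"
  where "module_iso A M N \<longleftrightarrow> (\<exists>f\<in>module_hom A M N. bij_betw f (carrier M) (carrier N))"

text \<open>
  The tensor product \<open>B \<otimes>\<^sub>A M\<close> of an extension ring \<open>B\<close> of \<open>A\<close> and an \<open>A\<close>-module \<open>M\<close>: the free abelian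
  group on \<open>B \<times> M\<close> modulo the bilinearity relations, with \<open>B\<close> acting on the left factor.
\<close>

definition tensor_relations :: "('a, 'b) ring_scheme \<Rightarrow> ('a, 'b) ring_scheme
    \<Rightarrow> ('a, 'm, 'c) module_scheme \<Rightarrow> ('a \<times> 'm \<Rightarrow>\<^sub>0 int) set"
  where "tensor_relations A B M = generate (free_Abelian_group (carrier B \<times> carrier M))
    ({frag_of (b \<oplus>\<^bsub>B\<^esub> b', x) - frag_of (b, x) - frag_of (b', x)
       | b b' x. b \<in> carrier B \<and> b' \<in> carrier B \<and> x \<in> carrier M}
     \<union> {frag_of (b, x \<oplus>\<^bsub>M\<^esub> x') - frag_of (b, x) - frag_of (b, x')
       | b x x'. b \<in> carrier B \<and> x \<in> carrier M \<and> x' \<in> carrier M}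
     \<union> {frag_of (b \<otimes>\<^bsub>B\<^esub> a, x) - frag_of (b, a \<odot>\<^bsub>M\<^esub> x)
       | a b x. a \<in> carrier A \<and> b \<in> carrier B \<and> x \<in> carrier M})"

text \<open>The fields \<open>mult\<close> and \<open>one\<close> of the record play no role in the notion of a module.\<close>

definition base_change :: "('a, 'b) ring_scheme \<Rightarrow> ('a, 'b) ring_scheme
    \<Rightarrow> ('a, 'm, 'c) module_scheme \<Rightarrow> ('a, ('a \<times> 'm \<Rightarrow>\<^sub>0 int) set) module"
  where "base_change A B M =
    (let F = free_Abelian_group (carrier B \<times> carrier M); N = tensor_relations A B M in
     \<lparr>carrier = carrier (F Mod N),
      monoid.mult = (\<lambda>_ _. N),
      one = N,
      zero = \<one>\<^bsub>F Mod N\<^esub>,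
      add = (\<lambda>X Y. X \<otimes>\<^bsub>F Mod N\<^esub> Y),
      smult = (\<lambda>c X. \<Union>z\<in>X. N #>\<^bsub>F\<^esub> frag_extend (\<lambda>(b, x). frag_of (c \<otimes>\<^bsub>B\<^esub> b, x)) z)\<rparr>)"

definition has_dim :: "('a, 'b) ring_scheme \<Rightarrow> ('a, 'm, 'c) module_scheme \<Rightarrow> nat \<Rightarrow> bool"
  where "has_dim F V n \<longleftrightarrow> vectorspace F V \<and> vectorspace.fin_dim F V \<and> vectorspace.dim F V = n"


subsection \<open>Classes of cocycles and the divisor of a cocycle\<close>

definition Z1_nonzero :: "('a, 'b) ring_scheme \<Rightarrow> 'a set \<Rightarrow> ('g, 'c) monoid_scheme
    \<Rightarrow> ('g \<Rightarrow> 'a \<Rightarrow> 'a) \<Rightarrow> ('g \<Rightarrow> 'a) set"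
  where "Z1_nonzero K R G \<phi> =
    {\<chi> \<in> carrier (Z1 K R G \<phi>). semi_invariants K R G \<phi> \<chi> \<noteq> {\<zero>\<^bsub>K\<^esub>}}"

definition Z1_rank1 :: "('a, 'b) ring_scheme \<Rightarrow> 'a set \<Rightarrow> ('g, 'c) monoid_scheme
    \<Rightarrow> ('g \<Rightarrow> 'a \<Rightarrow> 'a) \<Rightarrow> ('g \<Rightarrow> 'a) set"
  where "Z1_rank1 K R G \<phi> = {\<chi> \<in> Z1_nonzero K R G \<phi>.
    let A = subring_of K (fixed_ring R G \<phi>);
        Q = subring_of K (fractions K (fixed_ring R G \<phi>))
    in has_dim Q (base_change A Q (module_in K (semi_invariants K R G \<phi> \<chi>))) 1}"

definition Z1_2 :: "('a, 'b) ring_scheme \<Rightarrow> 'a set \<Rightarrow> ('g, 'c) monoid_scheme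
    \<Rightarrow> ('g \<Rightarrow> 'a \<Rightarrow> 'a) \<Rightarrow> ('g \<Rightarrow> 'a) set"
  where "Z1_2 K R G \<phi> = {\<chi> \<in> m_inv (Z1 K R G \<phi>) ` Z1_nonzero K R G \<phi>.
    \<forall>P\<in>Ht1_ge2 K R (fixed_ring R G \<phi>).
      \<not> semi_invariants K R G \<phi> (inv\<^bsub>Z1 K R G \<phi>\<^esub> \<chi>) \<subseteq> P}"

definition Z1_e :: "('a, 'b) ring_scheme \<Rightarrow> 'a set \<Rightarrow> ('g, 'c) monoid_scheme
    \<Rightarrow> ('g \<Rightarrow> 'a \<Rightarrow> 'a) \<Rightarrow> ('g \<Rightarrow> 'a) set"
  where "Z1_e K R G \<phi> = {\<chi> \<in> Z1_nonzero K R G \<phi>.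
    \<forall>P\<in>Ht1_over K R (fixed_ring R G \<phi>) 1. \<exists>f\<in>semi_invariants K R G \<phi> \<chi> - {\<zero>\<^bsub>K\<^esub>}.
      [valuation K R P f = 0]
        (mod int (ramification_index K R (fixed_ring R G \<phi>) P (P \<inter> fixed_ring R G \<phi>)))}"

definition cocycle_divisor :: "('a, 'b) ring_scheme \<Rightarrow> 'a set \<Rightarrow> ('g, 'c) monoid_scheme
    \<Rightarrow> ('g \<Rightarrow> 'a \<Rightarrow> 'a) \<Rightarrow> ('g \<Rightarrow> 'a) \<Rightarrow> ('a set \<Rightarrow>\<^sub>0 int)"
  where "cocycle_divisor K R G \<phi> \<chi> = (THE D.
    minimal_effective K R (fixed_ring R G \<phi>) D
    \<and> (\<exists>f\<in>semi_invariants K R G \<phi> \<chi> - {\<zero>\<^bsub>K\<^esub>}.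
          effective (divisor_of K R f - D)
          \<and> divisor_of K R f - D \<in> Estar K R (fixed_ring R G \<phi>)))"

end

theory Submission
  imports Defs
begin

text \<open>
  Write \<open>A = R\<^sup>G\<close>, \<open>F\<close> for its quotient field and \<open>R\<^sub>\<psi>\<close> for the semi-invariants of weight \<open>\<psi>\<close>.
  Since \<open>R\<^sub>\<psi>\<close> has rank one, any two nonzero elements of it differ by a factor from \<open>F\<close>, so
  their divisors agree modulo \<open>E\<^sup>*\<close>; the ramification condition on \<open>\<chi>\<close> forces the coefficients of
  \<open>D(\<chi>)\<close> over a height one prime \<open>q\<close> of \<open>A\<close> to be multiples of the ramification indices, hence
  \<open>D(n\<chi>) = n D(\<chi>)\<close>.  If \<open>R\<^sub>\<psi> = h A\<close>, then \<open>D(\<psi>) = div(h)\<close>: otherwise some \<open>y \<in> F\<close> with a pole only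
  above \<open>q\<close> would give \<open>h y \<in> R\<^sub>\<psi> - h A\<close>.  So \<open>m D(\<chi>)\<close> is principal.  Conversely, if
  \<open>n D(\<chi>) = div(g)\<close> with \<open>n\<close> the order of the class, then a power of \<open>g\<close> is a semi-invariant up to
  a unit, so \<open>coh(n\<chi>) - coh(div(g))\<close> is torsion and therefore trivial; after multiplying \<open>g\<close> by a
  unit, \<open>R\<^sub>n\<^sub>\<chi> = g A\<close>.

  The localization of \<open>A\<close> at a height one prime \<open>q\<close> lying under a height one prime of \<open>R\<close> is
  a valuation ring: it is the intersection of the finitely many valuation rings above \<open>q\<close>,
  and since it is local these valuations are proportional on \<open>F\<close>.
\<close>

section \<open>Valuations on a subfield\<close>

abbreviation (in field) "nz \<equiv> carrier R - {\<zero>}"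

lemma (in field) nonzero_mult_closed:
  assumes "x \<in> nz" "y \<in> nz"
  shows "x \<otimes> y \<in> nz"
  using assms integral by auto

lemma (in field) nonzero_inv_closed:
  assumes "x \<in> nz"
  shows "inv x \<in> nz"
  using assms field_Units by (metis Units_inv_Units)

lemma (in field) nonzero_inv [simp]:
  assumes "x \<in> carrier R" "x \<noteq> \<zero>"
  shows "inv x \<in> carrier R" "inv x \<noteq> \<zero>" "x \<otimes> inv x = \<one>" "inv x \<otimes> x = \<one>" "inv (inv x) = x"
proof -
  have u: "x \<in> Units R" using assms field_Units by auto
  show "inv x \<in> carrier R" "inv x \<noteq> \<zero>" using nonzero_inv_closed assms by auto
  show "x \<otimes> inv x = \<one>" "inv x \<otimes> x = \<one>" "inv (inv x) = x" using u by auto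
qed

lemma (in field) inv_mult_distrib:
  assumes "x \<in> nz" "y \<in> nz"
  shows "inv (x \<otimes> y) = inv x \<otimes> inv y"
proof -
  have xy: "x \<in> carrier R" "x \<noteq> \<zero>" "y \<in> carrier R" "y \<noteq> \<zero>" using assms by auto
  have "(x \<otimes> y) \<otimes> (inv x \<otimes> inv y) = (x \<otimes> inv x) \<otimes> (y \<otimes> inv y)"
    using xy nonzero_inv(1)[OF xy(1,2)] nonzero_inv(1)[OF xy(3,4)] by (simp only: m_ac m_closed)
  then have "(x \<otimes> y) \<otimes> (inv x \<otimes> inv y) = \<one>" using xy by simp
  then show ?thesis using xy by (intro comm_inv_char) auto
qed

lemma (in field) mult_eq_iff_eq_mult_inv:
  assumes "x \<in> carrier R" "y \<in> carrier R" "z \<in> nz"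
  shows "x \<otimes> z = y \<longleftrightarrow> x = y \<otimes> inv z"
proof -
  have z: "z \<in> carrier R" "z \<noteq> \<zero>" using assms by auto
  note n = nonzero_inv[OF z]
  show ?thesis
  proof
    assume "x \<otimes> z = y"
    then have "y \<otimes> inv z = x \<otimes> (z \<otimes> inv z)" using assms n(1) z by (metis m_assoc)
    then show "x = y \<otimes> inv z" using assms n by auto
  next
    assume "x = y \<otimes> inv z"
    then have "x \<otimes> z = y \<otimes> (inv z \<otimes> z)" using assms n z by (simp add: m_assoc)
    then show "x \<otimes> z = y" using assms n by auto
  qed
qed

lemma (in field) int_pow_mult_of:
  assumes "x \<in> nz"
  shows "x [^] (n::int) = x [^]\<^bsub>Multiplicative_Group.mult_of R\<^esub> n"
proof -
  have "x [^] k \<in> nz" for k :: nat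
    using assms by (induction k) (auto simp: integral_iff)
  then have "inv\<^bsub>Multiplicative_Group.mult_of R\<^esub> (x [^] k) = inv (x [^] k)" for k :: nat
    by (intro m_inv_mult_of) auto
  then show ?thesis
    unfolding int_pow_def2 Multiplicative_Group.nat_pow_mult_of by (simp only:)
qed

lemma (in field) int_pow_neg_nat:
  assumes "x \<in> nz"
  shows "x [^] (- int k) = inv (x [^] k)"
proof (cases k)
  case (Suc j)
  then have "- int k < 0" "nat (- (- int k)) = k" by auto
  then show ?thesis unfolding int_pow_def2 by (simp only: if_True)
qed simp

lemma (in field) int_pow_nonzero:
  assumes "x \<in> nz"
  shows "x [^] (n::int) \<in> nz"
  using group.int_pow_closed[OF field_mult_group] assms by (simp add: int_pow_mult_of)

lemma (in field) int_pow_add: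
  assumes "x \<in> nz"
  shows "x [^] (m + n::int) = x [^] m \<otimes> x [^] n"
  using group.int_pow_mult[OF field_mult_group, of x m n] assms by (simp add: int_pow_mult_of)

lemma (in field) int_pow_one:
  assumes "x \<in> nz"
  shows "x [^] (1::int) = x"
  using group.int_pow_1[OF field_mult_group, of x] assms by (simp add: int_pow_mult_of)

locale valued_subfield = field K for K :: "('a, 'b) ring_scheme" (structure) +
  fixes F :: "'a set" and w :: "'a \<Rightarrow> int"
  assumes subfield: "subfield F K"
    and val_mult: "\<lbrakk>x \<in> F - {\<zero>}; y \<in> F - {\<zero>}\<rbrakk> \<Longrightarrow> w (x \<otimes> y) = w x + w y"
    and val_add: "\<lbrakk>x \<in> F - {\<zero>}; y \<in> F - {\<zero>}; x \<oplus> y \<noteq> \<zero>\<rbrakk> \<Longrightarrow> min (w x) (w y) \<le> w (x \<oplus> y)"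
begin

definition integers :: "'a set"
  where "integers = {x \<in> F. x = \<zero> \<or> 0 \<le> w x}"

abbreviation "Fx \<equiv> F - {\<zero>}"
abbreviation "\<M> \<equiv> {x \<in> F. x = \<zero> \<or> 1 \<le> w x}"
abbreviation "\<O> \<equiv> subring_of K integers"

lemma F_carrier: "x \<in> F \<Longrightarrow> x \<in> carrier K"
  using subfieldE(3)[OF subfield] by auto

lemma F_facts: "\<zero> \<in> F" "\<one> \<in> F"
  "\<And>x y. x \<in> F \<Longrightarrow> y \<in> F \<Longrightarrow> x \<oplus> y \<in> F"
  "\<And>x y. x \<in> F \<Longrightarrow> y \<in> F \<Longrightarrow> x \<otimes> y \<in> F"
  "\<And>x. x \<in> F \<Longrightarrow> \<ominus> x \<in> F"
  "\<And>x. x \<in> Fx \<Longrightarrow> inv x \<in> Fx"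
proof -
  note F = subfieldE(1)[OF subfield]
  show "\<zero> \<in> F" "\<one> \<in> F" by (fact subringE(2)[OF F], fact subringE(3)[OF F])
  show "x \<oplus> y \<in> F" "x \<otimes> y \<in> F" if "x \<in> F" "y \<in> F" for x y
    by (fact subringE(7)[OF F that], fact subringE(6)[OF F that])
  show "\<ominus> x \<in> F" if "x \<in> F" for x by (fact subringE(5)[OF F that])
  show "inv x \<in> Fx" if "x \<in> Fx" for x by (fact subfield_m_inv(1)[OF subfield that])
qed

lemma F_mult:
  assumes "x \<in> Fx" "y \<in> Fx" shows "x \<otimes> y \<in> Fx"
  using F_facts(4)[of x y] F_carrier[of x] F_carrier[of y] integral[of x y] assms by auto

lemma val_one [simp]: "w \<one> = 0"
  using val_mult[of \<one> \<one>] F_facts(2) by simp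

lemma val_inv:
  assumes "x \<in> Fx" shows "w (inv x) = - w x"
proof -
  have "w (x \<otimes> inv x) = w x + w (inv x)" by (rule val_mult[OF assms F_facts(6)[OF assms]])
  moreover have "x \<otimes> inv x = \<one>" using assms F_carrier by auto
  ultimately show ?thesis by simp
qed

lemma nat_pow_F: "x \<in> Fx \<Longrightarrow> x [^] (n::nat) \<in> Fx"
  by (induction n) (use F_facts F_mult in auto)

lemma val_nat_pow: "x \<in> Fx \<Longrightarrow> w (x [^] (n::nat)) = int n * w x"
proof (induction n)
  case (Suc n)
  then show ?case using val_mult[OF nat_pow_F[OF Suc.prems] Suc.prems]
    by (simp add: algebra_simps)
qed simp

lemma int_pow_F: "x \<in> Fx \<Longrightarrow> x [^] (n::int) \<in> Fx"
  using nat_pow_F F_facts(6) F_carrier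
  by (cases n rule: int_cases2) (auto simp: int_pow_int int_pow_neg_nat)

lemma val_int_pow: "x \<in> Fx \<Longrightarrow> w (x [^] (n::int)) = n * w x"
  using nat_pow_F F_carrier
  by (cases n rule: int_cases2) (auto simp: int_pow_int int_pow_neg_nat val_nat_pow val_inv)

lemma val_minus:
  assumes "x \<in> Fx" shows "w (\<ominus> x) = w x"
proof -
  have 1: "\<ominus> \<one> \<in> Fx" using F_facts by (auto simp: minus_equality)
  have "(\<ominus> \<one>) \<otimes> (\<ominus> \<one>) = \<one>" by (simp add: l_minus)
  then have "w (\<ominus> \<one>) = 0" using val_mult[OF 1 1] by simp
  moreover have "\<ominus> x = \<ominus> \<one> \<otimes> x" using assms F_carrier by (simp add: l_minus)
  ultimately show ?thesis using val_mult[OF 1 assms] by simp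
qed

lemma val_add_strict:
  assumes "x \<in> Fx" "y \<in> Fx" "w x < w y"
  shows "x \<oplus> y \<noteq> \<zero>" "w (x \<oplus> y) = w x"
proof -
  have c: "x \<in> carrier K" "y \<in> carrier K" using assms F_carrier by auto
  show n: "x \<oplus> y \<noteq> \<zero>"
  proof
    assume "x \<oplus> y = \<zero>"
    then have "x = \<ominus> y" using c by (simp add: minus_equality)
    then show False using assms val_minus by auto
  qed
  have "min (w x) (w y) \<le> w (x \<oplus> y)" using val_add assms n by blast
  moreover have "w (x \<oplus> y) \<le> w x"
  proof (rule ccontr)
    assume h: "\<not> ?thesis"
    have my: "\<ominus> y \<in> Fx" using assms F_facts c by auto
    have e: "(x \<oplus> y) \<oplus> \<ominus> y = x" using c by (simp add: a_assoc r_neg)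
    have "min (w (x \<oplus> y)) (w (\<ominus> y)) \<le> w x"
      using val_add[of "x \<oplus> y" "\<ominus> y"] n my assms F_facts e by auto
    then show False using h assms val_minus by auto
  qed
  ultimately show "w (x \<oplus> y) = w x" using assms by auto
qed

lemma integers_subring: "subring integers K"
proof (rule subringI)
  show "integers \<subseteq> carrier K" using F_carrier by (auto simp: integers_def)
  show "\<one> \<in> integers" using F_facts by (auto simp: integers_def)
  show "\<ominus> h \<in> integers" if "h \<in> integers" for h
    using that F_facts(5)[of h] val_minus[of h] by (cases "h = \<zero>") (auto simp: integers_def)
  show "h1 \<otimes> h2 \<in> integers" if "h1 \<in> integers" "h2 \<in> integers" for h1 h2
    using that F_facts(4)[of h1 h2] val_mult[of h1 h2] F_carrier[of h1] F_carrier[of h2]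
    by (cases "h1 = \<zero> \<or> h2 = \<zero>") (auto simp: integers_def)
  show "h1 \<oplus> h2 \<in> integers" if "h1 \<in> integers" "h2 \<in> integers" for h1 h2
    using that F_facts(3)[of h1 h2] val_add[of h1 h2] F_carrier[of h1] F_carrier[of h2]
    by (cases "h1 = \<zero> \<or> h2 = \<zero> \<or> h1 \<oplus> h2 = \<zero>") (auto simp: integers_def)
qed

lemma integers_domain: "domain (\<O>)"
  using subring_is_domain[OF integers_subring] .

lemma integers_Units: "Units (\<O>) = {x \<in> Fx. w x = 0}"
proof (intro Set.set_eqI iffI)
  fix x assume x: "x \<in> Units (\<O>)"
  then obtain y where y: "x \<in> integers" "y \<in> integers" "x \<otimes> y = \<one>" by (auto simp: Units_def)
  then have "x \<in> F" "y \<in> F" by (auto simp: integers_def)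
  moreover have xn: "x \<noteq> \<zero>" and yn: "y \<noteq> \<zero>" using y F_carrier by (auto simp: integers_def)
  ultimately have "w x + w y = 0" using val_mult[of x y] y by auto
  then have "w x = 0" using y xn yn by (auto simp: integers_def)
  then show "x \<in> {x \<in> Fx. w x = 0}" using \<open>x \<in> F\<close> xn by auto
next
  fix x assume x: "x \<in> {x \<in> Fx. w x = 0}"
  then have "inv x \<in> integers" "x \<in> integers"
    using F_facts(6)[of x] val_inv[of x] by (auto simp: integers_def)
  moreover have "x \<otimes> inv x = \<one>" "inv x \<otimes> x = \<one>" using x F_carrier by auto
  ultimately show "x \<in> Units (\<O>)" by (auto simp: Units_def)
qed

lemma integers_PIdl:
  assumes "t \<in> Fx" "0 \<le> w t"
  shows "PIdl\<^bsub>\<O>\<^esub> t = {x \<in> F. x = \<zero> \<or> w t \<le> w x}"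
proof safe
  fix x assume "x \<in> PIdl\<^bsub>\<O>\<^esub> t"
  then obtain y where y: "y \<in> integers" "x = y \<otimes> t" by (auto simp: cgenideal_def)
  then show "x \<in> F" using F_facts assms by (auto simp: integers_def)
  assume "\<not> w t \<le> w x"
  then show "x = \<zero>" using y val_mult[of y t] assms F_carrier by (cases "y = \<zero>") (auto simp: integers_def)
next
  have "\<zero> \<in> integers" using F_facts by (auto simp: integers_def)
  moreover have "\<zero> = \<zero> \<otimes> t" using assms F_carrier by auto
  ultimately show "\<zero> \<in> PIdl\<^bsub>\<O>\<^esub> t" by (auto simp: cgenideal_def)
next
  fix x assume x: "x \<in> F" "w t \<le> w x"
  show "x \<in> PIdl\<^bsub>\<O>\<^esub> t"
  proof (cases "x = \<zero>")
    case True
    have "\<zero> \<in> integers" using F_facts by (auto simp: integers_def)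
    moreover have "\<zero> = \<zero> \<otimes> t" using assms F_carrier by auto
    ultimately show ?thesis using True by (auto simp: cgenideal_def)
  next
    case False
    have "x \<otimes> inv t \<in> integers"
      using x False assms F_facts(4,6) val_mult[of x "inv t"] val_inv by (auto simp: integers_def)
    moreover have "x = (x \<otimes> inv t) \<otimes> t"
      using x assms F_carrier mult_eq_iff_eq_mult_inv[of "x \<otimes> inv t" x t] by auto
    ultimately show ?thesis by (auto simp: cgenideal_def)
  qed
qed

lemma integers_maximalideal_iff:
  assumes t0: "t0 \<in> Fx" "w t0 = 1" and t: "t \<in> integers"
  shows "maximalideal (PIdl\<^bsub>\<O>\<^esub> t) (\<O>) \<longleftrightarrow> t \<noteq> \<zero> \<and> w t = 1"
proof -
  interpret S: domain "\<O>" by (rule integers_domain)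
  have P0: "PIdl\<^bsub>\<O>\<^esub> t0 = \<M>"
    using integers_PIdl[of t0] t0 by auto
  have t0S: "t0 \<in> carrier (\<O>)" using t0 by (auto simp: integers_def)
  have one: "\<one> \<in> integers" "\<one> \<notin> \<M>" using F_facts by (auto simp: integers_def)
  have id: "ideal (PIdl\<^bsub>\<O>\<^esub> s) (\<O>)" if "s \<in> integers" for s
    using that by (intro S.cgenideal_ideal) auto
  have max0: "maximalideal \<M> (\<O>)"
  proof (rule maximalidealI)
    show "ideal \<M> (\<O>)"
      using id[of t0] t0S P0 by simp
    show "carrier (\<O>) \<noteq> \<M>"
      using one by auto
    fix J assume J: "ideal J (\<O>)" "\<M> \<subseteq> J"
      "J \<subseteq> carrier (\<O>)"
    interpret J: ideal J "\<O>" by (rule J)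
    show "J = \<M> \<or> J = carrier (\<O>)"
    proof (rule disjCI)
      assume "J \<noteq> carrier (\<O>)"
      have "w y \<noteq> 0" if y: "y \<in> J" "y \<noteq> \<zero>" for y
      proof
        assume "w y = 0"
        moreover have "y \<in> F" using y J(3) by (auto simp: integers_def)
        ultimately have "y \<in> Units (\<O>)" using y by (simp add: integers_Units)
        then have "\<one>\<^bsub>\<O>\<^esub> \<in> J"
          using J.I_l_closed[OF y(1)] S.Units_l_inv by (metis S.Units_inv_closed)
        then show False using J.one_imp_carrier \<open>J \<noteq> carrier _\<close> by blast
      qed
      then show "J = \<M>" using J(2,3) by (force simp: integers_def)
    qed
  qed
  show ?thesis
  proof
    assume "t \<noteq> \<zero> \<and> w t = 1"
    then show "maximalideal (PIdl\<^bsub>\<O>\<^esub> t) (\<O>)"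
      using integers_PIdl[of t] t max0 by (auto simp: integers_def)
  next
    assume m: "maximalideal (PIdl\<^bsub>\<O>\<^esub> t) (\<O>)"
    interpret m: maximalideal "PIdl\<^bsub>\<O>\<^esub> t" "\<O>" by (rule m)
    have ne: "PIdl\<^bsub>\<O>\<^esub> t \<noteq> integers" using m.I_notcarr by auto
    have "PIdl\<^bsub>\<O>\<^esub> t \<subseteq> \<M>"
    proof
      fix y assume y: "y \<in> PIdl\<^bsub>\<O>\<^esub> t"
      have yS: "y \<in> integers" using y m.a_subset by auto
      have "w y \<noteq> 0" if "y \<noteq> \<zero>"
      proof
        assume "w y = 0"
        then have "y \<in> Units (\<O>)"
          using yS that unfolding integers_Units by (simp add: integers_def)
        then have "\<one>\<^bsub>\<O>\<^esub> \<in> PIdl\<^bsub>\<O>\<^esub> t"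
          using m.I_l_closed[OF y] S.Units_l_inv by (metis S.Units_inv_closed)
        then show False using m.one_imp_carrier m.I_notcarr by metis
      qed
      then show "y \<in> \<M>" using yS by (force simp: integers_def)
    qed
    moreover have "\<M> \<subseteq> carrier (\<O>)"
      by (auto simp: integers_def)
    ultimately have "\<M> = PIdl\<^bsub>\<O>\<^esub> t
        \<or> \<M> = carrier (\<O>)"
      by (rule m.I_maximal[OF maximalideal.axioms(1)[OF max0]])
    moreover have "\<M> \<noteq> carrier (\<O>)"
      by (rule not_sym, rule maximalideal.I_notcarr[OF max0])
    ultimately have eq: "\<M> = PIdl\<^bsub>\<O>\<^esub> t"
      by blast
    have t0P: "t0 \<in> PIdl\<^bsub>\<O>\<^esub> t" unfolding eq[symmetric] using t0 by simp
    have tP: "t \<in> PIdl\<^bsub>\<O>\<^esub> t" using t S.cgenideal_self by auto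
    have tn: "t \<noteq> \<zero>" using t0P t0 F_carrier by (auto simp: cgenideal_def integers_def)
    then have "w t \<le> w t0" using t0P integers_PIdl[of t] t t0 by (auto simp: integers_def)
    moreover have "1 \<le> w t" using tP tn unfolding eq[symmetric] by simp
    ultimately show "t \<noteq> \<zero> \<and> w t = 1" using t0 tn by auto
  qed
qed

lemma valuation_eq:
  assumes loc: "localization K A P = integers"
    and t0: "t0 \<in> Fx" "w t0 = 1" and x: "x \<in> Fx"
  shows "valuation K A P x = w x"
  unfolding valuation_def loc
proof (rule the_equality)
  define u where "u = x \<otimes> t0 [^] (- w x)"
  have p: "t0 [^] n \<in> Fx" for n :: int using int_pow_F t0 by auto
  have u: "u \<in> Fx" "w u = 0"
    using F_mult[OF x p] val_mult[OF x p] val_int_pow t0 by (auto simp: u_def)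
  have "t0 [^] (- w x + w x) = t0 [^] (- w x) \<otimes> t0 [^] (w x)"
    using t0 F_carrier by (intro int_pow_add) auto
  then have "t0 [^] (- w x) \<otimes> t0 [^] (w x) = \<one>" by simp
  moreover have "u \<otimes> t0 [^] (w x) = x \<otimes> (t0 [^] (- w x) \<otimes> t0 [^] (w x))"
    unfolding u_def using x p F_carrier by (intro m_assoc) auto
  ultimately have "x = u \<otimes> t0 [^] (w x)" using x F_carrier by simp
  moreover have "t0 \<in> integers" using t0 by (auto simp: integers_def)
  ultimately show "\<exists>t u. t \<in> integers \<and>
      maximalideal (PIdl\<^bsub>\<O>\<^esub> t) (\<O>) \<and>
      u \<in> Units (\<O>) \<and> x = u \<otimes> t [^] w x"
    using integers_maximalideal_iff[OF t0 \<open>t0 \<in> integers\<close>] t0 u integers_Units by blast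
next
  fix n :: int assume "\<exists>t u. t \<in> integers \<and>
      maximalideal (PIdl\<^bsub>\<O>\<^esub> t) (\<O>) \<and>
      u \<in> Units (\<O>) \<and> x = u \<otimes> t [^] n"
  then obtain t u where t: "t \<in> integers" "maximalideal (PIdl\<^bsub>\<O>\<^esub> t) (\<O>)"
    and u: "u \<in> Fx" "w u = 0" and xu: "x = u \<otimes> t [^] n"
    using integers_Units by auto
  have t': "t \<in> Fx" "w t = 1" using integers_maximalideal_iff[OF t0 t(1)] t by (auto simp: integers_def)
  show "n = w x" using xu val_mult[OF u(1) int_pow_F[OF t'(1)]] val_int_pow t' u by simp
qed

end

section \<open>Discrete valuation rings\<close>

context field
begin

lemma mult_nonzero:
  "\<lbrakk>x \<in> carrier R; y \<in> carrier R; x \<noteq> \<zero>; y \<noteq> \<zero>\<rbrakk> \<Longrightarrow> x \<otimes> y \<noteq> \<zero>"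
  using integral by auto

lemma mult_swap:
  "\<lbrakk>a \<in> carrier R; b \<in> carrier R; c \<in> carrier R; d \<in> carrier R\<rbrakk>
    \<Longrightarrow> (a \<otimes> b) \<otimes> (c \<otimes> d) = (a \<otimes> c) \<otimes> (b \<otimes> d)"
  by (simp add: m_ac)

lemma subring_carrier: "subring S R \<Longrightarrow> x \<in> S \<Longrightarrow> x \<in> carrier R"
  using subringE(1) by blast

lemma localization_iff:
  assumes S: "subring S R" and P: "\<zero> \<in> P"
  shows "x \<in> localization R S P \<longleftrightarrow> x \<in> carrier R \<and> (\<exists>s\<in>S - P. x \<otimes> s \<in> S)"
proof
  assume "x \<in> localization R S P"
  then obtain a b where ab: "a \<in> S" "b \<in> S - P" "x = a \<otimes> inv b" by (auto simp: localization_def)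
  moreover have "b \<in> nz" using ab subring_carrier[OF S] P by auto
  ultimately have "x \<in> carrier R" "x \<otimes> b = a"
    using subring_carrier[OF S] mult_eq_iff_eq_mult_inv[of x a b] by auto
  then show "x \<in> carrier R \<and> (\<exists>b\<in>S - P. x \<otimes> b \<in> S)"
    using ab(1,2) by (intro conjI bexI[of _ b]) auto
next
  assume "x \<in> carrier R \<and> (\<exists>b\<in>S - P. x \<otimes> b \<in> S)"
  then obtain b where b: "x \<in> carrier R" "b \<in> S - P" "x \<otimes> b \<in> S" by auto
  moreover have "b \<in> nz" using b subring_carrier[OF S] P by auto
  ultimately have "x = (x \<otimes> b) \<otimes> inv b"
    using subring_carrier[OF S] mult_eq_iff_eq_mult_inv[of x "x \<otimes> b" b] by auto
  then show "x \<in> localization R S P" using b by (auto simp: localization_def)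
qed

lemma primeideal_subring_facts:
  assumes S: "subring S R" and P: "primeideal P (subring_of R S)"
  shows "\<zero> \<in> P" "P \<subseteq> S" "\<one> \<notin> P"
    "\<And>a b. a \<in> S \<Longrightarrow> b \<in> P \<Longrightarrow> a \<otimes> b \<in> P"
    "\<And>a b. a \<in> P \<Longrightarrow> b \<in> P \<Longrightarrow> a \<oplus> b \<in> P"
    "\<And>a b. a \<in> S \<Longrightarrow> b \<in> S \<Longrightarrow> a \<otimes> b \<in> P \<Longrightarrow> a \<in> P \<or> b \<in> P"
proof -
  interpret P: primeideal P "subring_of R S" by (rule P)
  show "\<zero> \<in> P" using additive_subgroup.zero_closed[OF ideal.axioms(1)[OF P.is_ideal]] by simp
  show "P \<subseteq> S" using P.a_subset by simp
  show "\<one> \<notin> P" using P.one_imp_carrier P.I_notcarr by auto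
  show "a \<otimes> b \<in> P" if "a \<in> S" "b \<in> P" for a b using P.I_l_closed[of b a] that by simp
  show "a \<oplus> b \<in> P" if "a \<in> P" "b \<in> P" for a b using additive_subgroup.a_closed[OF ideal.axioms(1)[OF P.is_ideal], of a b] that by simp
  show "a \<in> P \<or> b \<in> P" if "a \<in> S" "b \<in> S" "a \<otimes> b \<in> P" for a b using P.I_prime[of a b] that by simp
qed

lemma localization_subring:
  assumes S: "subring S R" and P: "primeideal P (subring_of R S)"
  shows "subring (localization R S P) R" "S \<subseteq> localization R S P"
proof -
  note pf = primeideal_subring_facts[OF S P]
  note c = subring_carrier[OF S]
  note I = localization_iff[OF S pf(1)]
  note m = subringE(6)[OF S]
  have prod: "b \<otimes> d \<in> S - P" if "b \<in> S - P" "d \<in> S - P" for b d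
    using that m pf(6) by blast
  have one: "\<one> \<in> S - P" using subringE(3)[OF S] pf(3) by auto
  show sub: "S \<subseteq> localization R S P"
  proof
    fix x assume "x \<in> S"
    then show "x \<in> localization R S P" unfolding I using one c by (intro conjI bexI[of _ \<one>]) auto
  qed
  show "subring (localization R S P) R"
  proof (rule subringI)
    show "localization R S P \<subseteq> carrier R" using I by auto
    show "\<one> \<in> localization R S P" using sub subringE(3)[OF S] by auto
  next
    fix x assume "x \<in> localization R S P"
    then obtain b where b: "x \<in> carrier R" "b \<in> S - P" "x \<otimes> b \<in> S" using I by auto
    then have "\<ominus> x \<otimes> b = \<ominus> (x \<otimes> b)" using c by (simp add: l_minus)
    then show "\<ominus> x \<in> localization R S P"
      unfolding I using b subringE(5)[OF S b(3)] by (intro conjI bexI[of _ b]) auto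
  next
    fix x y assume "x \<in> localization R S P" "y \<in> localization R S P"
    then obtain b d where b: "x \<in> carrier R" "b \<in> S - P" "x \<otimes> b \<in> S"
      and d: "y \<in> carrier R" "d \<in> S - P" "y \<otimes> d \<in> S" using I by auto
    have bc: "b \<in> carrier R" "d \<in> carrier R" using b d c by auto
    have "(x \<otimes> y) \<otimes> (b \<otimes> d) = (x \<otimes> b) \<otimes> (y \<otimes> d)" using b(1) d(1) bc by (simp add: m_ac)
    then have "(x \<otimes> y) \<otimes> (b \<otimes> d) \<in> S" using m[OF b(3) d(3)] by simp
    then show "x \<otimes> y \<in> localization R S P"
      unfolding I using prod[OF b(2) d(2)] b(1) d(1) by (intro conjI bexI[of _ "b \<otimes> d"]) auto
    have "(x \<oplus> y) \<otimes> (b \<otimes> d) = (x \<otimes> b) \<otimes> d \<oplus> (y \<otimes> d) \<otimes> b"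
      using b(1) d(1) bc by (simp add: m_ac l_distr r_distr)
    then have "(x \<oplus> y) \<otimes> (b \<otimes> d) \<in> S"
      using m[OF b(3), of d] m[OF d(3), of b] subringE(7)[OF S] b d by auto
    then show "x \<oplus> y \<in> localization R S P"
      unfolding I using prod[OF b(2) d(2)] b(1) d(1) by (intro conjI bexI[of _ "b \<otimes> d"]) auto
  qed
qed

lemma fractions_eq_localization: "fractions R S = localization R S {\<zero>}"
  by (auto simp: fractions_def localization_def)

lemma fractions_iff:
  assumes S: "subring S R"
  shows "x \<in> fractions R S \<longleftrightarrow> x \<in> carrier R \<and> (\<exists>b\<in>S - {\<zero>}. x \<otimes> b \<in> S)"
  unfolding fractions_eq_localization by (rule localization_iff[OF S]) simp

lemma zero_primeideal_subring:
  assumes "subring S R" shows "primeideal {\<zero>} (subring_of R S)"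
  using domain.zeroprimeideal[OF subring_is_domain[OF assms]] by simp

lemma subset_fractions: "subring S R \<Longrightarrow> S \<subseteq> fractions R S"
  unfolding fractions_eq_localization by (rule localization_subring(2)[OF _ zero_primeideal_subring])

lemma fractions_subfield:
  assumes S: "subring S R"
  shows "subfield (fractions R S) R"
proof (rule subfieldI')
  note c = subring_carrier[OF S] and I = fractions_iff[OF S]
  show "subring (fractions R S) R"
    unfolding fractions_eq_localization by (rule localization_subring(1)[OF S zero_primeideal_subring[OF S]])
  fix x assume x: "x \<in> fractions R S - {\<zero>}"
  then obtain b where b: "x \<in> carrier R" "x \<noteq> \<zero>" "b \<in> S - {\<zero>}" "x \<otimes> b \<in> S" using I by auto
  have "inv x \<otimes> (x \<otimes> b) = (inv x \<otimes> x) \<otimes> b"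
    using b c nonzero_inv(1)[OF b(1,2)] by (intro m_assoc[symmetric]) auto
  then have "inv x \<otimes> (x \<otimes> b) = b" using b c by auto
  moreover have "x \<otimes> b \<noteq> \<zero>" using b c mult_nonzero[of x b] by auto
  ultimately show "inv x \<in> fractions R S"
    unfolding I using b nonzero_inv(1)[OF b(1,2)] by (intro conjI bexI[of _ "x \<otimes> b"]) auto
qed

lemma subring_Units:
  assumes S: "subring S R"
  shows "Units (subring_of R S) = {x \<in> S - {\<zero>}. inv x \<in> S}"
proof (intro Set.set_eqI iffI)
  note c = subring_carrier[OF S]
  fix x assume "x \<in> Units (subring_of R S)"
  then obtain y where y: "x \<in> S" "y \<in> S" "x \<otimes> y = \<one>" by (auto simp: Units_def)
  then have "x \<noteq> \<zero>" "inv x = y" using c comm_inv_char[of x y] by auto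
  then show "x \<in> {x \<in> S - {\<zero>}. inv x \<in> S}" using y by auto
next
  note c = subring_carrier[OF S]
  fix x assume "x \<in> {x \<in> S - {\<zero>}. inv x \<in> S}"
  then show "x \<in> Units (subring_of R S)" using c by (auto simp: Units_def intro!: bexI[of _ "inv x"])
qed

lemma discrete_valuation_ring_uniformizer:
  assumes S: "subring S R" and dvr: "discrete_valuation_ring (subring_of R S)"
  obtains t where "t \<in> S - {\<zero>}" "inv t \<notin> S"
    "\<And>x. x \<in> S - {\<zero>} \<Longrightarrow> \<exists>u\<in>Units (subring_of R S). \<exists>n::nat. x = u \<otimes> t [^] n"
proof -
  let ?U = "Units (subring_of R S)"
  interpret S: principal_domain "subring_of R S"
    using dvr by (simp add: discrete_valuation_ring_def)
  obtain M where M: "maximalideal M (subring_of R S)"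
    and uniq: "\<And>N. maximalideal N (subring_of R S) \<Longrightarrow> N = M"
    using dvr unfolding discrete_valuation_ring_def by blast
  interpret M: maximalideal M "subring_of R S" by (rule M)
  obtain t where t: "t \<in> S" "M = PIdl\<^bsub>subring_of R S\<^esub> t"
    using S.exists_gen[OF M.is_ideal] by auto
  have tn: "t \<noteq> \<zero>"
  proof
    assume "t = \<zero>"
    then have "M = {\<zero>}"
      using t subring_carrier[OF S] subringE(2)[OF S] by (auto simp: cgenideal_def)
    then have "field (subring_of R S)" using S.zeromaximalideal_fieldI M by simp
    then show False using dvr by (simp add: discrete_valuation_ring_def)
  qed
  have tM: "t \<in> M" using t S.cgenideal_self by auto
  have it: "inv t \<notin> S"
  proof
    assume "inv t \<in> S"
    then have "t \<in> ?U" using t tn subring_Units[OF S] by auto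
    then have "M = carrier (subring_of R S)" using S.ideal_eq_carrier_iff[of t] t by auto
    then show False using M.I_notcarr by auto
  qed
  have U1: "\<one> \<in> ?U" using S.Units_one_closed by simp
  have Um: "u \<otimes> v \<in> ?U"
    if "u \<in> ?U" "v \<in> ?U" for u v
    using S.Units_m_closed[OF that] by simp
  have Uc: "u \<in> S" if "u \<in> ?U" for u using S.Units_closed[OF that] by simp
  have irr: "\<exists>u\<in>?U. f = u \<otimes> t"
    if f: "f \<in> S - {\<zero>}" "Divisibility.irreducible (Ring_Divisibility.mult_of (subring_of R S)) f" for f
  proof -
    have "ring_irreducible\<^bsub>subring_of R S\<^esub> f" using S.ring_irreducibleI'[of f] f by auto
    then have "maximalideal (PIdl\<^bsub>subring_of R S\<^esub> f) (subring_of R S)"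
      using S.irreducible_imp_maximalideal[of f] f by auto
    then have "PIdl\<^bsub>subring_of R S\<^esub> f = PIdl\<^bsub>subring_of R S\<^esub> t" using uniq t by auto
    then have "f \<sim>\<^bsub>subring_of R S\<^esub> t" using S.associated_iff_same_ideal[of f t] f t by auto
    then show ?thesis using S.ring_associated_iff[of f t] f t by auto
  qed
  have prod: "\<exists>u\<in>?U. foldr (\<otimes>) fs \<one> = u \<otimes> t [^] length fs"
    if "set fs \<subseteq> S - {\<zero>}" "\<forall>f\<in>set fs. Divisibility.irreducible (Ring_Divisibility.mult_of (subring_of R S)) f" for fs
    using that
  proof (induction fs)
    case Nil
    then show ?case using U1 by (intro bexI[of _ \<one>]) auto
  next
    case (Cons f fs)
    then obtain u where u: "u \<in> ?U" "foldr (\<otimes>) fs \<one> = u \<otimes> t [^] length fs" by auto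
    obtain v where v: "v \<in> ?U" "f = v \<otimes> t" using irr[of f] Cons by auto
    have "v \<in> carrier R" "u \<in> carrier R" "t \<in> carrier R" using u v Uc t subring_carrier[OF S] by auto
    then have "foldr (\<otimes>) (f # fs) \<one> = (v \<otimes> u) \<otimes> t [^] length (f # fs)"
      using u(2) v(2) by (simp add: m_ac)
    then show ?case using Um[OF v(1) u(1)] by blast
  qed
  have "\<exists>u\<in>?U. \<exists>n::nat. x = u \<otimes> t [^] n" if x: "x \<in> S - {\<zero>}" for x
  proof (cases "x \<in> ?U")
    case True
    then show ?thesis using x subring_carrier[OF S] by (intro bexI[of _ x] exI[of _ 0]) auto
  next
    case False
    obtain fs where fs: "set fs \<subseteq> S - {\<zero>}" "wfactors (Ring_Divisibility.mult_of (subring_of R S)) fs x"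
      using S.factorization_property[of x] x False by auto
    have irrs: "\<forall>f\<in>set fs. Divisibility.irreducible (Ring_Divisibility.mult_of (subring_of R S)) f"
      and as: "foldr (\<otimes>) fs \<one> \<sim>\<^bsub>Ring_Divisibility.mult_of (subring_of R S)\<^esub> x"
      using fs(2) by (auto simp: wfactors_def)
    obtain u where u: "u \<in> ?U" "foldr (\<otimes>) fs \<one> = u \<otimes> t [^] length fs"
      using prod[OF fs(1) irrs] by auto
    have uS: "u \<otimes> t [^] length fs \<in> S"
    proof -
      have "t [^] k \<in> S" for k :: nat using t subringE(3,6)[OF S] by (induction k) auto
      then show ?thesis using Uc[OF u(1)] subringE(6)[OF S] by auto
    qed
    have "x \<sim>\<^bsub>subring_of R S\<^esub> u \<otimes> t [^] length fs"
    proof -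
      have "u \<otimes> t [^] length fs \<noteq> \<zero>"
      proof (rule mult_nonzero)
        have "t [^] length fs \<in> nz"
          using int_pow_nonzero[of t "int (length fs)"] t tn subring_carrier[OF S] by (auto simp: int_pow_int)
        then show "t [^] length fs \<in> carrier R" "t [^] length fs \<noteq> \<zero>" by auto
        show "u \<in> carrier R" "u \<noteq> \<zero>" using u(1) subring_Units[OF S] subring_carrier[OF S] by auto
      qed
      then have "u \<otimes> t [^] length fs \<sim>\<^bsub>subring_of R S\<^esub> x"
        using as u(2) S.assoc_iff_assoc_mult[of "u \<otimes> t [^] length fs" x] uS x by auto
      then show ?thesis using S.associated_sym by auto
    qed
    then obtain v where v: "v \<in> ?U" "x = v \<otimes> (u \<otimes> t [^] length fs)"
      using S.ring_associated_iff[of x "u \<otimes> t [^] length fs"] uS x by auto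
    have "v \<in> carrier R" "u \<in> carrier R" "t \<in> carrier R" using u v Uc t subring_carrier[OF S] by auto
    then have "x = (v \<otimes> u) \<otimes> t [^] length fs" using v(2) by (simp add: m_assoc)
    then show ?thesis using Um[OF v(1) u(1)] by blast
  qed
  then show thesis using that t tn it by blast
qed

lemma discrete_valuation_ring_valuation:
  assumes S: "subring S R" and dvr: "discrete_valuation_ring (subring_of R S)"
  obtains w t where "valued_subfield R (fractions R S) w"
    "valued_subfield.integers R (fractions R S) w = S" "t \<in> S - {\<zero>}" "w t = 1"
proof -
  obtain t where t: "t \<in> S - {\<zero>}" "inv t \<notin> S"
    and fac: "\<And>x. x \<in> S - {\<zero>} \<Longrightarrow> \<exists>u\<in>Units (subring_of R S). \<exists>n::nat. x = u \<otimes> t [^] n"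
    using discrete_valuation_ring_uniformizer[OF S dvr] by blast
  define U where "U = Units (subring_of R S)"
  note c = subring_carrier[OF S]
  note m = subringE(6)[OF S]
  have tc: "t \<in> nz" using t c by auto
  have tp: "t [^] (n::nat) \<in> S" for n using t subringE(3)[OF S] m by (induction n) auto
  have U: "u \<in> S" "u \<in> nz" "inv u \<in> S" "inv u \<in> U" if "u \<in> U" for u
    using that c by (auto simp: U_def subring_Units[OF S])
  have Um: "u \<otimes> v \<in> U" if "u \<in> U" "v \<in> U" for u v
    using U[OF that(1)] U[OF that(2)] m mult_nonzero[of u v]
    by (auto simp: U_def subring_Units[OF S] inv_mult_distrib)
  have tk: "t [^] (int k) \<in> U \<Longrightarrow> k = 0" for k :: nat
  proof (cases k)
    case (Suc j)
    assume "t [^] (int k) \<in> U"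
    then have "inv (t [^] k) \<in> S" using U by (auto simp: int_pow_int)
    moreover have tj: "t [^] j \<in> nz" using int_pow_nonzero[OF tc, of "int j"] by (simp add: int_pow_int)
    have "t [^] k = t [^] j \<otimes> t" using Suc tc by simp
    then have "inv (t [^] k) = inv (t [^] j) \<otimes> inv t" using inv_mult_distrib[OF tj tc] by simp
    then have "t [^] j \<otimes> inv (t [^] k) = (t [^] j \<otimes> inv (t [^] j)) \<otimes> inv t"
      using tj tc nonzero_inv(1)[of t] nonzero_inv(1)[of "t [^] j"] by (subst m_assoc) auto
    then have "t [^] j \<otimes> inv (t [^] k) = inv t" using tj tc nonzero_inv(1,3)[of "t [^] j"] nonzero_inv(1)[of t] by simp
    ultimately have "inv t \<in> S" using m[OF tp[of j], of "inv (t [^] k)"] by simp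
    then show "k = 0" using t by simp
  qed simp
  have uniq0: "n = m'" if "u \<in> U" "v \<in> U" "u \<otimes> t [^] (n::int) = v \<otimes> t [^] m'" "m' \<le> n" for u v n m'
  proof -
    define k where "k = nat (n - m')"
    have p: "t [^] i \<in> nz" for i :: int by (rule int_pow_nonzero[OF tc])
    have "n = int k + m'" using that(4) by (simp add: k_def)
    then have tn: "t [^] n = t [^] (int k) \<otimes> t [^] m'" using int_pow_add[OF tc] by simp
    have "(u \<otimes> t [^] (int k)) \<otimes> t [^] m' = v \<otimes> t [^] m'"
      using that(3) tn p U[OF that(1)] by (simp add: m_assoc)
    then have "u \<otimes> t [^] (int k) = v"
      using p[of m'] p[of "int k"] U[OF that(1)] U[OF that(2)]
      by (subst (asm) m_rcancel) auto
    then have "t [^] (int k) \<otimes> u = v" using p[of "int k"] U[OF that(1)] m_comm by auto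
    then have "t [^] (int k) = v \<otimes> inv u"
      using mult_eq_iff_eq_mult_inv[of "t [^] (int k)" v u] p[of "int k"] U[OF that(1)] U[OF that(2)] by auto
    then have "t [^] (int k) \<in> U" using Um that U(4) by auto
    then have "k = 0" using tk by blast
    then show ?thesis using that(4) by (simp add: k_def)
  qed
  have uniq: "n = m'" if "u \<in> U" "v \<in> U" "u \<otimes> t [^] (n::int) = v \<otimes> t [^] m'" for u v n m'
    using uniq0[OF that] uniq0[OF that(2,1) that(3)[symmetric]] by linarith
  define w where "w x = (THE n::int. \<exists>u\<in>U. x = u \<otimes> t [^] n)" for x
  have w: "w (u \<otimes> t [^] n) = n" if "u \<in> U" for u n
    unfolding w_def using that uniq by (intro the_equality) blast+
  have p: "t [^] i \<in> nz" for i :: int by (rule int_pow_nonzero[OF tc])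
  have rep: "\<exists>u\<in>U. \<exists>n::nat. x = u \<otimes> t [^] int n" if "x \<in> S - {\<zero>}" for x
    using fac[OF that] by (simp add: U_def int_pow_int)
  have repF: "\<exists>u\<in>U. \<exists>n::int. x = u \<otimes> t [^] n" if x: "x \<in> fractions R S - {\<zero>}" for x
  proof -
    obtain b where b: "b \<in> S - {\<zero>}" "x \<otimes> b \<in> S" "x \<in> carrier R" using x fractions_iff[OF S] by auto
    then have "x \<otimes> b \<noteq> \<zero>" using x c[of b] mult_nonzero[of x b] by auto
    then obtain u n where u: "u \<in> U" "x \<otimes> b = u \<otimes> t [^] int n" using rep[of "x \<otimes> b"] b by auto
    obtain v k where v: "v \<in> U" "b = v \<otimes> t [^] int k" using rep[OF b(1)] by auto
    have uc: "u \<in> carrier R" "v \<in> nz" "inv v \<in> carrier R" using U[OF u(1)] U[OF v(1)] by auto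
    have "((u \<otimes> inv v) \<otimes> t [^] (int n - int k)) \<otimes> b = (u \<otimes> inv v \<otimes> v) \<otimes> (t [^] (int n - int k) \<otimes> t [^] int k)"
      unfolding v(2) using uc p[of "int n - int k"] p[of "int k"] by (intro mult_swap) auto
    also have "\<dots> = u \<otimes> t [^] int n"
      using int_pow_add[OF tc, of "int n - int k" "int k"] uc by (simp add: m_assoc)
    also have "\<dots> = x \<otimes> b" using u by simp
    finally have "(u \<otimes> inv v) \<otimes> t [^] (int n - int k) = x"
      using uc p[of "int n - int k"] b c by (subst (asm) m_rcancel) auto
    then show ?thesis using Um[OF u(1) U(4)[OF v(1)]] by blast
  qed
  have le: "w x \<le> w (x \<oplus> y)"
    if xy: "x \<in> fractions R S - {\<zero>}" "y \<in> fractions R S - {\<zero>}" "x \<oplus> y \<noteq> \<zero>" "w x \<le> w y" for x y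
  proof -
    obtain u and n :: int where u: "u \<in> U" "x = u \<otimes> t [^] n" using repF[OF xy(1)] by blast
    obtain v and k :: int where v: "v \<in> U" "y = v \<otimes> t [^] k" using repF[OF xy(2)] by blast
    have nk: "n \<le> k" using xy(4) u v w by auto
    define j where "j = nat (k - n)"
    have k: "k = int j + n" using nk by (simp add: j_def)
    define z where "z = u \<oplus> v \<otimes> t [^] int j"
    have uc: "u \<in> carrier R" "v \<in> carrier R" using U[OF u(1)] U[OF v(1)] by auto
    have "t [^] k = t [^] int j \<otimes> t [^] n" using int_pow_add[OF tc] k by simp
    then have xyz: "x \<oplus> y = z \<otimes> t [^] n"
      unfolding z_def u(2) v(2) using uc p[of "int j"] p[of n] by (simp add: l_distr m_assoc)
    have "z \<in> S" using U(1)[OF u(1)] U(1)[OF v(1)] tp[of j] m subringE(7)[OF S]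
      by (simp add: z_def int_pow_int)
    moreover have "z \<noteq> \<zero>" using xy(3) xyz p[of n] by auto
    ultimately obtain u' i where u': "u' \<in> U" "z = u' \<otimes> t [^] int i" using rep by blast
    have "x \<oplus> y = u' \<otimes> t [^] (int i + n)"
      using xyz u' U[OF u'(1)] int_pow_add[OF tc, of "int i" n] p[of "int i"] p[of n] by (simp add: m_assoc)
    then have "w (x \<oplus> y) = int i + n" using w u' by simp
    moreover have "w x = n" using w u by simp
    ultimately show ?thesis by simp
  qed
  have V: "valued_subfield R (fractions R S) w"
  proof (intro valued_subfield.intro valued_subfield_axioms.intro field_axioms)
    show "subfield (fractions R S) R" by (rule fractions_subfield[OF S])
    fix x y assume xy: "x \<in> fractions R S - {\<zero>}" "y \<in> fractions R S - {\<zero>}"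
    obtain u and n :: int where u: "u \<in> U" "x = u \<otimes> t [^] n" using repF[OF xy(1)] by blast
    obtain v and k :: int where v: "v \<in> U" "y = v \<otimes> t [^] k" using repF[OF xy(2)] by blast
    have "x \<otimes> y = (u \<otimes> v) \<otimes> (t [^] n \<otimes> t [^] k)"
      unfolding u(2) v(2) using U[OF u(1)] U[OF v(1)] p[of n] p[of k] by (simp add: m_ac)
    then have "x \<otimes> y = (u \<otimes> v) \<otimes> t [^] (n + k)" using int_pow_add[OF tc] by simp
    then show "w (x \<otimes> y) = w x + w y" using w u v Um by simp
  next
    fix x y assume xy: "x \<in> fractions R S - {\<zero>}" "y \<in> fractions R S - {\<zero>}"
      and n: "x \<oplus> y \<noteq> \<zero>"
    have c: "x \<in> carrier R" "y \<in> carrier R" using xy fractions_iff[OF S] by auto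
    show "min (w x) (w y) \<le> w (x \<oplus> y)"
      using le[OF xy n] le[OF xy(2,1)] n a_comm[OF c] by (auto simp: min_def)
  qed
  interpret V: valued_subfield R "fractions R S" w by (rule V)
  have "V.integers = S"
  proof (intro Set.set_eqI iffI)
    fix x assume x: "x \<in> V.integers"
    show "x \<in> S"
    proof (cases "x = \<zero>")
      case True
      then show ?thesis using subringE(2)[OF S] by simp
    next
      case False
      then obtain u and n :: int where u: "u \<in> U" "x = u \<otimes> t [^] n" using repF[of x] x by (auto simp: V.integers_def)
      have "0 \<le> w x" using False x by (auto simp: V.integers_def)
      then have "0 \<le> n" using u w by simp
      then obtain k where "n = int k" using zero_le_imp_eq_int by blast
      then show ?thesis using u U(1)[OF u(1)] m[OF _ tp[of k]] by (simp add: int_pow_int)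
    qed
  next
    fix x assume x: "x \<in> S"
    show "x \<in> V.integers"
    proof (cases "x = \<zero>")
      case True
      then show ?thesis using V.F_facts by (auto simp: V.integers_def)
    next
      case False
      then obtain u n where u: "u \<in> U" "x = u \<otimes> t [^] int n" using rep x by blast
      then have "w x = int n" using w by simp
      then show ?thesis using subset_fractions[OF S] x by (auto simp: V.integers_def)
    qed
  qed
  moreover have "w t = 1"
  proof -
    have "\<one> \<in> U" using subringE(3)[OF S] by (auto simp: U_def subring_Units[OF S])
    then have "w (\<one> \<otimes> t [^] (1::int)) = 1" using w by blast
    then show ?thesis using tc int_pow_one[OF tc] by simp
  qed
  ultimately show thesis using that[of w t] V t by blast
qed

end

section \<open>Valuations and divisors of a Krull domain\<close>

lemma valued_subfield_cong:
  assumes "valued_subfield K F w" "\<And>x. x \<in> F - {\<zero>\<^bsub>K\<^esub>} \<Longrightarrow> v x = w x"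
  shows "valued_subfield K F v" "valued_subfield.integers K F v = valued_subfield.integers K F w"
proof -
  interpret W: valued_subfield K F w by (rule assms)
  show V: "valued_subfield K F v"
  proof (intro valued_subfield.intro valued_subfield_axioms.intro W.field_axioms W.subfield)
    fix x y assume xy: "x \<in> F - {\<zero>\<^bsub>K\<^esub>}" "y \<in> F - {\<zero>\<^bsub>K\<^esub>}"
    then show "v (x \<otimes>\<^bsub>K\<^esub> y) = v x + v y"
      using W.val_mult[OF xy] W.F_mult[OF xy] assms(2) by simp
  next
    fix x y assume xy: "x \<in> F - {\<zero>\<^bsub>K\<^esub>}" "y \<in> F - {\<zero>\<^bsub>K\<^esub>}" "x \<oplus>\<^bsub>K\<^esub> y \<noteq> \<zero>\<^bsub>K\<^esub>"
    then show "min (v x) (v y) \<le> v (x \<oplus>\<^bsub>K\<^esub> y)"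
      using W.val_add[OF xy] W.F_facts(3)[of x y] assms(2) by simp
  qed
  interpret V: valued_subfield K F v by (rule V)
  show "V.integers = W.integers"
    unfolding V.integers_def W.integers_def using assms(2) by force
qed

abbreviation coeff :: "('p \<Rightarrow>\<^sub>0 int) \<Rightarrow> 'p \<Rightarrow> int" where "coeff \<equiv> Poly_Mapping.lookup"

locale krull_field = field K for K :: "('a, 'b) ring_scheme" (structure) +
  fixes R :: "'a set"
  assumes krull: "krull_domain K R" and fractions_R: "carrier K = fractions K R"
begin

abbreviation "val \<equiv> valuation K R"
abbreviation "Rx \<equiv> R - {\<zero>}"
abbreviation "divisor \<equiv> divisor_of K R"

lemma R_subring: "subring R K"
  using krull unfolding krull_domain_def by (blast dest: subdomainE subdomain.axioms(1) subcring.axioms(1))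

lemma R_carrier: "x \<in> R \<Longrightarrow> x \<in> carrier K"
  by (rule subring_carrier[OF R_subring])

lemma denominator:
  assumes "x \<in> carrier K"
  obtains b where "b \<in> Rx" "x \<otimes> b \<in> R"
proof -
  have "x \<in> fractions K R" using assms fractions_R by (rule subst[rotated])
  then show thesis using that unfolding fractions_iff[OF R_subring] by blast
qed

lemma Ht1_prime: "P \<in> Ht1 K R \<Longrightarrow> primeideal P (subring_of K R)"
  by (simp add: Ht1_def)

lemmas Ht1_facts = primeideal_subring_facts[OF R_subring Ht1_prime]

lemma val_valued:
  assumes P: "P \<in> Ht1 K R"
  shows "valued_subfield K (carrier K) (val P)"
    "valued_subfield.integers K (carrier K) (val P) = localization K R P"
proof -
  define L where "L = localization K R P"
  note pf = Ht1_facts[OF P]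
  have L: "subring L K" "R \<subseteq> L" using localization_subring[OF R_subring Ht1_prime[OF P]] by (auto simp: L_def)
  have dvr: "discrete_valuation_ring (subring_of K L)"
    using krull P by (auto simp: krull_domain_def L_def)
  have "x \<in> fractions K L" if "x \<in> carrier K" for x
  proof -
    obtain b where "b \<in> Rx" "x \<otimes> b \<in> R" by (rule denominator[OF \<open>x \<in> carrier K\<close>])
    then show ?thesis unfolding fractions_iff[OF L(1)] using that L(2) by (intro conjI bexI[of _ b]) auto
  qed
  then have fr: "fractions K L = carrier K" using fractions_iff[OF L(1)] by auto
  obtain w t where w: "valued_subfield K (fractions K L) w"
    "valued_subfield.integers K (fractions K L) w = L" "t \<in> L - {\<zero>}" "w t = 1"
    using discrete_valuation_ring_valuation[OF L(1) dvr] by blast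
  interpret W: valued_subfield K "carrier K" w using w(1) fr by simp
  have int: "W.integers = L" using w(2) fr by simp
  have t: "t \<in> nz" using w(3) subring_carrier[OF L(1)] by auto
  have eq: "val P x = w x" if "x \<in> nz" for x
    using W.valuation_eq[OF _ t w(4) that] int by (simp add: L_def)
  show "valued_subfield K (carrier K) (val P)"
    using valued_subfield_cong(1)[OF W.valued_subfield_axioms] eq by blast
  show "valued_subfield.integers K (carrier K) (val P) = localization K R P"
    using valued_subfield_cong(2)[OF W.valued_subfield_axioms] eq int L_def by blast
qed

lemma val_nonneg:
  assumes "P \<in> Ht1 K R" "x \<in> Rx" shows "0 \<le> val P x"
proof -
  interpret V: valued_subfield K "carrier K" "val P" by (rule val_valued(1)[OF assms(1)])
  have "x \<in> V.integers" unfolding val_valued(2)[OF assms(1)]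
    using localization_subring(2)[OF R_subring Ht1_prime[OF assms(1)]] assms(2) by auto
  then show ?thesis using assms(2) by (auto simp: V.integers_def)
qed

lemma val_pos_iff:
  assumes P: "P \<in> Ht1 K R" and x: "x \<in> Rx" shows "0 < val P x \<longleftrightarrow> x \<in> P"
proof -
  interpret V: valued_subfield K "carrier K" "val P" by (rule val_valued(1)[OF P])
  note pf = Ht1_facts[OF P]
  note I = localization_iff[OF R_subring pf(1)]
  have xc: "x \<in> carrier K" "x \<noteq> \<zero>" "x \<in> nz" using x R_carrier by auto
  have "0 < val P x \<longleftrightarrow> \<not> 0 \<le> val P (inv x)" using V.val_inv[OF xc(3)] by auto
  also have "\<dots> \<longleftrightarrow> inv x \<notin> V.integers" using xc by (auto simp: V.integers_def)
  also have "\<dots> \<longleftrightarrow> inv x \<notin> localization K R P" by (simp only: val_valued(2)[OF P])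
  also have "\<dots> \<longleftrightarrow> x \<in> P"
  proof
    assume h: "inv x \<notin> localization K R P"
    show "x \<in> P"
    proof (rule ccontr)
      assume "x \<notin> P"
      then have "inv x \<in> localization K R P"
        unfolding I using xc x subringE(3)[OF R_subring] by (intro conjI bexI[of _ x]) auto
      then show False using h by simp
    qed
  next
    assume xP: "x \<in> P"
    show "inv x \<notin> localization K R P"
    proof
      assume "inv x \<in> localization K R P"
      then obtain s where s: "s \<in> R - P" "inv x \<otimes> s \<in> R" unfolding I by auto
      have sc: "s \<in> carrier K" using s R_carrier[of s] by auto
      have "(inv x \<otimes> s) \<otimes> x = s \<otimes> (inv x \<otimes> x)"
        using xc sc nonzero_inv(1)[OF xc(1,2)] m_comm[of "inv x" s] by (simp add: m_assoc)
      then have "(inv x \<otimes> s) \<otimes> x = s" using xc sc by auto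
      then show False using pf(4)[OF s(2) xP] s by auto
    qed
  qed
  finally show ?thesis .
qed

lemma val_eq_0_iff:
  assumes "P \<in> Ht1 K R" "x \<in> Rx" shows "val P x = 0 \<longleftrightarrow> x \<notin> P"
  using val_nonneg[OF assms] val_pos_iff[OF assms] by auto

lemma val_mult:
  "\<lbrakk>P \<in> Ht1 K R; x \<in> nz; y \<in> nz\<rbrakk> \<Longrightarrow> val P (x \<otimes> y) = val P x + val P y"
  by (rule valued_subfield.val_mult[OF val_valued(1)])

lemma val_inv:
  "\<lbrakk>P \<in> Ht1 K R; x \<in> nz\<rbrakk> \<Longrightarrow> val P (inv x) = - val P x"
  by (rule valued_subfield.val_inv[OF val_valued(1)])

lemma val_nat_pow:
  "\<lbrakk>P \<in> Ht1 K R; x \<in> nz\<rbrakk> \<Longrightarrow> val P (x [^] (n::nat)) = int n * val P x"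
  by (rule valued_subfield.val_nat_pow[OF val_valued(1)])

lemma R_iff:
  assumes x: "x \<in> nz"
  shows "x \<in> R \<longleftrightarrow> (\<forall>P\<in>Ht1 K R. 0 \<le> val P x)"
proof -
  have "x \<in> localization K R P \<longleftrightarrow> 0 \<le> val P x" if P: "P \<in> Ht1 K R" for P
  proof -
    interpret V: valued_subfield K "carrier K" "val P" by (rule val_valued(1)[OF P])
    have "x \<in> V.integers \<longleftrightarrow> 0 \<le> val P x" using x by (auto simp: V.integers_def)
    then show ?thesis by (simp only: val_valued(2)[OF P])
  qed
  moreover have "x \<in> R \<longleftrightarrow> x \<in> {x \<in> fractions K R. \<forall>P\<in>Ht1 K R. x \<in> localization K R P}"
    using krull unfolding krull_domain_def by blast
  moreover have "x \<in> fractions K R" using x fractions_R by (metis Diff_iff)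
  ultimately show ?thesis by blast
qed

lemma finite_val:
  assumes x: "x \<in> nz"
  shows "finite {P \<in> Ht1 K R. val P x \<noteq> 0}"
proof -
  have xc: "x \<in> carrier K" using x by auto
  obtain b where b: "b \<in> Rx" "x \<otimes> b \<in> R" by (rule denominator[OF xc])
  have bc: "b \<in> nz" using b R_carrier by auto
  have xb: "x \<otimes> b \<in> Rx" using b x R_carrier[of b] mult_nonzero[of x b] by auto
  have fin: "finite {P \<in> Ht1 K R. y \<in> P}" if "y \<in> Rx" for y
    using krull that unfolding krull_domain_def by blast
  have "{P \<in> Ht1 K R. val P x \<noteq> 0} \<subseteq> {P \<in> Ht1 K R. x \<otimes> b \<in> P} \<union> {P \<in> Ht1 K R. b \<in> P}"
  proof safe
    fix P assume P: "P \<in> Ht1 K R" "val P x \<noteq> 0" "b \<notin> P"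
    have "val P (x \<otimes> b) = val P x + val P b" by (rule val_mult[OF P(1) x bc])
    moreover have "val P b = 0" using val_eq_0_iff[OF P(1) b(1)] P by simp
    ultimately have "val P (x \<otimes> b) \<noteq> 0" using P by simp
    then show "x \<otimes> b \<in> P" using val_eq_0_iff[OF P(1) xb] by simp
  qed
  then show ?thesis using fin[OF xb] fin[OF b(1)] finite_subset by blast
qed

lemma lookup_divisor_of:
  assumes x: "x \<in> nz"
  shows "coeff (divisor x) P = (if P \<in> Ht1 K R then val P x else 0)"
proof -
  let ?S = "{P \<in> Ht1 K R. val P x \<noteq> 0}"
  have "coeff (divisor x) P = (\<Sum>Q\<in>?S. val Q x * (if Q = P then 1 else 0))"
    unfolding divisor_of_def lookup_sum
    by (intro sum.cong) (auto simp: lookup_single when_def)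
  also have "\<dots> = (\<Sum>Q\<in>?S. if Q = P then val Q x else 0)" by (intro sum.cong) auto
  also have "\<dots> = (if P \<in> ?S then val P x else 0)"
    using finite_val[OF x] by (simp add: sum.delta)
  finally show ?thesis by auto
qed

lemma divisor_of_Div:
  assumes x: "x \<in> nz"
  shows "divisor x \<in> carrier (Div K R)"
proof -
  have "Poly_Mapping.keys (divisor x) \<subseteq> Ht1 K R"
    using lookup_divisor_of[OF x] by (auto simp: in_keys_iff split: if_splits)
  then show ?thesis by (simp add: Div_def)
qed

lemma divisor_of_mult:
  assumes "x \<in> nz" "y \<in> nz"
  shows "divisor (x \<otimes> y) = divisor x + divisor y"
  using assms lookup_divisor_of nonzero_mult_closed[OF assms]
  by (intro poly_mapping_eqI) (auto simp: lookup_add val_mult)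

lemma divisor_of_inv:
  assumes "x \<in> nz"
  shows "divisor (inv x) = - divisor x"
  using assms lookup_divisor_of nonzero_inv_closed[OF assms]
  by (intro poly_mapping_eqI) (auto simp: val_inv)

lemma nat_pow_nonzero: "x \<in> nz \<Longrightarrow> x [^] (n::nat) \<in> nz"
  using int_pow_nonzero[of x "int n"] by (simp add: int_pow_int)

lemma divisor_of_nat_pow:
  assumes "x \<in> nz"
  shows "divisor (x [^] (n::nat)) = frag_cmul (int n) (divisor x)"
  using assms lookup_divisor_of nat_pow_nonzero[OF assms]
  by (intro poly_mapping_eqI) (auto simp: val_nat_pow)

lemma effective_divisor_of_iff:
  assumes x: "x \<in> nz"
  shows "effective (divisor x) \<longleftrightarrow> x \<in> R"
  unfolding effective_def R_iff[OF x] lookup_divisor_of[OF x] by auto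

lemma divisor_of_eq_0_iff:
  assumes x: "x \<in> nz"
  shows "divisor x = 0 \<longleftrightarrow> x \<in> Units (subring_of K R)"
proof -
  have "divisor x = 0 \<longleftrightarrow> (\<forall>P. coeff (divisor x) P = 0)"
    by (auto intro!: poly_mapping_eqI)
  also have "\<dots> \<longleftrightarrow> (\<forall>P\<in>Ht1 K R. val P x = 0)" using lookup_divisor_of[OF x] by auto
  also have "\<dots> \<longleftrightarrow> x \<in> R \<and> inv x \<in> R"
    using R_iff[OF x] R_iff[OF nonzero_inv_closed[OF x]] val_inv[OF _ x] by force
  finally show ?thesis using x subring_Units[OF R_subring] by auto
qed

lemma principal_divisors_subgroup: "subgroup (principal_divisors K R) (Div K R)"
proof (rule group.subgroupI)
  show "group (Div K R)" by (simp add: Div_def)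
  show "principal_divisors K R \<subseteq> carrier (Div K R)"
    using divisor_of_Div by (auto simp: principal_divisors_def)
  show "principal_divisors K R \<noteq> {}" using one_not_zero by (auto simp: principal_divisors_def)
next
  fix D assume D: "D \<in> principal_divisors K R"
  then obtain x where x: "x \<in> nz" "D = divisor x" by (auto simp: principal_divisors_def)
  have "inv\<^bsub>Div K R\<^esub> D = - D" using divisor_of_Div[OF x(1)] x(2) by (simp add: Div_def)
  then have "inv\<^bsub>Div K R\<^esub> D = divisor (inv x)" using divisor_of_inv[OF x(1)] x(2) by simp
  then show "inv\<^bsub>Div K R\<^esub> D \<in> principal_divisors K R"
    using nonzero_inv_closed[OF x(1)] unfolding principal_divisors_def by blast
  fix E assume "E \<in> principal_divisors K R"
  then obtain y where y: "y \<in> nz" "E = divisor y" by (auto simp: principal_divisors_def)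
  have "D \<otimes>\<^bsub>Div K R\<^esub> E = divisor (x \<otimes> y)"
    using divisor_of_mult[OF x(1) y(1)] x(2) y(2) by (simp add: Div_def)
  then show "D \<otimes>\<^bsub>Div K R\<^esub> E \<in> principal_divisors K R"
    using nonzero_mult_closed[OF x(1) y(1)] unfolding principal_divisors_def by blast
qed

end

section \<open>Ramification over a saturated subring\<close>

lemma (in ring) height_ge:
  assumes "\<And>i. i \<le> n \<Longrightarrow> primeideal (Q i) R" "\<And>i. i < n \<Longrightarrow> Q i \<subset> Q (Suc i)" "Q n = P"
  shows "enat n \<le> height R P"
  unfolding height_def using assms by (intro Sup_upper) blast

lemma (in domain) height_ge_1:
  assumes P: "primeideal P R" "P \<noteq> {\<zero>}"
  shows "1 \<le> height R P"
proof -
  interpret P: primeideal P R by (rule P)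
  have "\<zero> \<in> P" using additive_subgroup.zero_closed[OF ideal.axioms(1)[OF P.is_ideal]] .
  then have "{\<zero>} \<subset> P" using P(2) by auto
  then have "enat 1 \<le> height R P"
    using zeroprimeideal P(1) by (intro height_ge[where Q = "\<lambda>i. if i = 0 then {\<zero>} else P"]) auto
  then show ?thesis by (simp add: one_enat_def)
qed

lemma (in domain) height_ge_2:
  assumes P: "primeideal P R" "P \<noteq> {\<zero>}" and Q: "primeideal Q R" "P \<subset> Q"
  shows "2 \<le> height R Q"
proof -
  interpret P: primeideal P R by (rule P)
  have "\<zero> \<in> P" using additive_subgroup.zero_closed[OF ideal.axioms(1)[OF P.is_ideal]] .
  then have z: "{\<zero>} \<subset> P" using P(2) by auto
  have "enat 2 \<le> height R Q"
    by (intro height_ge[where Q = "\<lambda>i. if i = 0 then {\<zero>} else if i = 1 then P else Q"])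
      (use zeroprimeideal P(1) Q z in auto)
  then show ?thesis by (simp add: numeral_eq_enat)
qed

lemma (in domain) height_zero: "height R {\<zero>} = 0"
proof -
  have "n = 0" if "\<forall>i\<le>n. primeideal (Q i) R" "\<forall>i<n. Q i \<subset> Q (Suc i)" "Q n = {\<zero>}" for n and Q :: "nat \<Rightarrow> 'a set"
  proof (rule ccontr)
    assume "n \<noteq> 0"
    then obtain m where m: "n = Suc m" using not0_implies_Suc by blast
    interpret P: primeideal "Q m" R using that(1) m by auto
    have "\<zero> \<in> Q m" using additive_subgroup.zero_closed[OF ideal.axioms(1)[OF P.is_ideal]] .
    moreover have "Q m \<subset> {\<zero>}" using that(2,3) m by auto
    ultimately show False by auto
  qed
  then have "height R {\<zero>} \<le> 0"
    unfolding height_def by (intro Sup_least) (auto simp: zero_enat_def)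
  then show ?thesis by simp
qed

locale krull_extension = krull_field +
  fixes A :: "'a set"
  assumes A_subring: "subring A K" and A_R: "A \<subseteq> R" and A_sat: "R \<inter> fractions K A \<subseteq> A"
begin

abbreviation "F \<equiv> fractions K A"
abbreviation "Fx \<equiv> F - {\<zero>}"

lemma A_carrier: "x \<in> A \<Longrightarrow> x \<in> carrier K"
  using A_R R_carrier by auto

lemma F_subfield: "subfield F K"
  by (rule fractions_subfield[OF A_subring])

lemma F_carrier: "x \<in> F \<Longrightarrow> x \<in> carrier K"
  using fractions_iff[OF A_subring] by auto

lemma A_F: "x \<in> A \<Longrightarrow> x \<in> F"
  using subset_fractions[OF A_subring] by auto

lemma A_domain: "domain (subring_of K A)"
  by (rule subring_is_domain[OF A_subring])

lemma val_valued_F: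
  assumes "P \<in> Ht1 K R" shows "valued_subfield K F (val P)"
proof -
  interpret V: valued_subfield K "carrier K" "val P" by (rule val_valued(1)[OF assms])
  show ?thesis
    using F_carrier V.val_mult V.val_add
    by (intro valued_subfield.intro valued_subfield_axioms.intro field_axioms F_subfield) auto
qed

lemma contraction_prime:
  assumes P: "P \<in> Ht1 K R"
  shows "primeideal (P \<inter> A) (subring_of K A)"
proof -
  interpret A: domain "subring_of K A" by (rule A_domain)
  note pf = Ht1_facts[OF P]
  have c: "cring (subring_of K A)" by (rule A.is_cring)
  note mA = subringE(6)[OF A_subring]
  have "ideal (P \<inter> A) (subring_of K A)"
  proof (rule idealI[OF A.ring_axioms])
    show "subgroup (P \<inter> A) (add_monoid (subring_of K A))"
    proof (rule group.subgroupI[OF abelian_group.a_group[OF A.abelian_group_axioms]])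
      show "P \<inter> A \<subseteq> carrier (add_monoid (subring_of K A))" by auto
      show "P \<inter> A \<noteq> {}" using pf(1) subringE(2)[OF A_subring] by auto
      fix a assume a: "a \<in> P \<inter> A"
      have "\<ominus>\<^bsub>subring_of K A\<^esub> a = \<ominus> a"
        using a subringE(5)[OF A_subring, of a] A_carrier[of a] A_carrier[of "\<ominus> a"]
        by (intro A.minus_equality) (auto simp: l_neg)
      moreover have "\<ominus> a = \<ominus> \<one> \<otimes> a" using a A_carrier[of a] by (simp add: l_minus)
      moreover have "\<ominus> \<one> \<in> R" using subringE(3,5)[OF R_subring] by auto
      ultimately have "\<ominus>\<^bsub>subring_of K A\<^esub> a \<in> P \<inter> A"
        using pf(4)[of "\<ominus> \<one>" a] a subringE(5)[OF A_subring, of a] by auto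
      then show "inv\<^bsub>add_monoid (subring_of K A)\<^esub> a \<in> P \<inter> A" by (simp add: a_inv_def)
      fix b assume b: "b \<in> P \<inter> A"
      then show "a \<otimes>\<^bsub>add_monoid (subring_of K A)\<^esub> b \<in> P \<inter> A"
        using a pf(5)[of a b] subringE(7)[OF A_subring, of a b] by auto
    qed
    show "x \<otimes>\<^bsub>subring_of K A\<^esub> a \<in> P \<inter> A" if "a \<in> P \<inter> A" "x \<in> carrier (subring_of K A)" for a x
      using that pf(4)[of x a] mA[of x a] A_R by auto
    show "a \<otimes>\<^bsub>subring_of K A\<^esub> x \<in> P \<inter> A" if "a \<in> P \<inter> A" "x \<in> carrier (subring_of K A)" for a x
      using that pf(4)[of x a] mA[of x a] A_R m_comm[of a x] A_carrier[of a] A_carrier[of x] by auto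
  qed
  then show ?thesis
    using pf(3,6) A_R subringE(3)[OF A_subring]
    by (intro primeidealI c) auto
qed

lemma Ht1_A_prime: "q \<in> Ht1 K A \<Longrightarrow> primeideal q (subring_of K A)"
  by (simp add: Ht1_def)

lemmas Ht1_A_facts = primeideal_subring_facts[OF A_subring Ht1_A_prime]

lemma Ht1_A_nonzero:
  assumes "q \<in> Ht1 K A" obtains a where "a \<in> q" "a \<noteq> \<zero>"
proof -
  interpret A: domain "subring_of K A" by (rule A_domain)
  have "q \<noteq> {\<zero>}" using assms A.height_zero by (auto simp: Ht1_def)
  then show thesis using that Ht1_A_facts(1)[OF assms] by auto
qed

lemma Ht1_A_minimal:
  assumes q: "q \<in> Ht1 K A" and p: "primeideal p (subring_of K A)" "p \<noteq> {\<zero>}" "p \<subseteq> q"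
  shows "p = q"
proof (rule ccontr)
  interpret A: domain "subring_of K A" by (rule A_domain)
  assume "p \<noteq> q"
  then have "2 \<le> height (subring_of K A) q" using A.height_ge_2[of p q] p Ht1_A_prime[OF q] by auto
  moreover have "height (subring_of K A) q = 1" using q by (simp add: Ht1_def)
  ultimately show False by (simp add: one_enat_def numeral_eq_enat)
qed

lemma Ht1_ge2_iff: "P \<in> Ht1_ge2 K R A \<longleftrightarrow> P \<in> Ht1 K R \<and> 2 \<le> height (subring_of K A) (P \<inter> A)"
  by (auto simp: Ht1_ge2_def Ht1_over_def)

lemma Ht1_cases:
  assumes P: "P \<in> Ht1 K R"
  obtains (zero) "P \<inter> A = {\<zero>}" "P \<inter> A \<notin> Ht1 K A" "P \<notin> Ht1_ge2 K R A"
  | (one) "P \<inter> A \<noteq> {\<zero>}" "P \<inter> A \<in> Ht1 K A" "P \<notin> Ht1_ge2 K R A"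
  | (ge2) "P \<inter> A \<noteq> {\<zero>}" "P \<inter> A \<notin> Ht1 K A" "P \<in> Ht1_ge2 K R A"
proof -
  interpret A: domain "subring_of K A" by (rule A_domain)
  let ?h = "height (subring_of K A) (P \<inter> A)"
  have h0: "P \<inter> A = {\<zero>} \<Longrightarrow> ?h = 0" using A.height_zero by simp
  have h1: "P \<inter> A \<noteq> {\<zero>} \<Longrightarrow> 1 \<le> ?h" using A.height_ge_1[OF contraction_prime[OF P]] by simp
  have d: "?h = 1 \<or> 2 \<le> ?h" if "1 \<le> ?h" using that
    by (cases ?h) (auto simp: one_enat_def numeral_eq_enat)
  have x: "\<not> (?h = 1 \<and> 2 \<le> ?h)" "\<not> (?h = 0 \<and> 2 \<le> ?h)" "\<not> (?h = 0 \<and> ?h = 1)"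
    by (auto simp: one_enat_def numeral_eq_enat zero_enat_def)
  have i1: "P \<inter> A \<in> Ht1 K A \<longleftrightarrow> ?h = 1" using contraction_prime[OF P] by (simp add: Ht1_def)
  have i2: "P \<in> Ht1_ge2 K R A \<longleftrightarrow> 2 \<le> ?h" using Ht1_ge2_iff P by simp
  show thesis
    using that h0 h1 d x i1 i2 by metis
qed

lemma contraction_not_subset:
  assumes P: "P \<in> Ht1 K R" "P \<inter> A \<noteq> {\<zero>}" and q: "q \<in> Ht1 K A" "P \<inter> A \<noteq> q"
  obtains s where "s \<in> A - q" "s \<in> P"
  using Ht1_A_minimal[OF q(1) contraction_prime[OF P(1)] P(2)] q(2) that by blast

lemma val_F_zero:
  assumes P: "P \<in> Ht1 K R" "P \<inter> A = {\<zero>}" and x: "x \<in> Fx"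
  shows "val P x = 0"
proof -
  obtain b where b: "x \<in> nz" "b \<in> A - {\<zero>}" "x \<otimes> b \<in> A"
    using x fractions_iff[OF A_subring] by auto
  have bc: "b \<in> nz" using b A_carrier by auto
  have xb: "x \<otimes> b \<in> A - {\<zero>}" using b bc mult_nonzero[of x b] by auto
  have "val P b = 0" "val P (x \<otimes> b) = 0"
    using val_eq_0_iff[OF P(1), of b] val_eq_0_iff[OF P(1), of "x \<otimes> b"] b xb A_R P(2) by auto
  then show ?thesis using val_mult[OF P(1) b(1) bc] by simp
qed

lemma clear_denominators:
  assumes q: "q \<in> Ht1 K A" and x: "x \<in> Fx"
  obtains s where "s \<in> A - q" "\<And>P. P \<in> Ht1 K R \<Longrightarrow> P \<inter> A \<noteq> q \<Longrightarrow> 0 \<le> val P (s \<otimes> x)"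
proof -
  note qf = Ht1_A_facts[OF q]
  have xc: "x \<in> nz" using x F_carrier by auto
  have Aq: "s \<in> Rx" "s \<in> nz" if "s \<in> A - q" for s
    using that qf(1) A_R A_carrier by auto
  define B where "B = {P \<in> Ht1 K R. val P x < 0 \<and> P \<inter> A \<noteq> q}"
  have "finite B" using finite_val[OF xc] by (rule rev_finite_subset) (auto simp: B_def)
  have "\<exists>s\<in>A - q. \<forall>P\<in>T. 0 \<le> val P (s \<otimes> x)" if "finite T" "T \<subseteq> B" for T
    using that
  proof (induction T rule: finite_induct)
    case empty
    then show ?case using subringE(3)[OF A_subring] qf(3) by auto
  next
    case (insert P T)
    then obtain s where s: "s \<in> A - q" "\<forall>P\<in>T. 0 \<le> val P (s \<otimes> x)" by auto
    have P: "P \<in> Ht1 K R" "val P x < 0" "P \<inter> A \<noteq> q" using insert.prems by (auto simp: B_def)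
    have "P \<inter> A \<noteq> {\<zero>}" using val_F_zero[OF P(1) _ x] P(2) by auto
    then obtain r where r: "r \<in> A - q" "r \<in> P" using contraction_not_subset[OF P(1) _ q P(3)] by blast
    have rp: "r [^] (n::nat) \<in> A - q" for n
    proof (induction n)
      case 0
      then show ?case using subringE(3)[OF A_subring] qf(3) by auto
    next
      case (Suc n)
      then show ?case using r(1) qf(6)[of "r [^] n" r] subringE(6)[OF A_subring, of "r [^] n" r] by auto
    qed
    define n where "n = nat (- val P x)"
    have sr: "s \<otimes> r [^] n \<in> A - q"
      using s(1) rp[of n] qf(6)[of s "r [^] n"] subringE(6)[OF A_subring, of s "r [^] n"] by auto
    have v: "val P' ((s \<otimes> r [^] n) \<otimes> x) = val P' s + int n * val P' r + val P' x" if "P' \<in> Ht1 K R" for P'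
      using val_mult[OF that Aq(2)[OF sr] xc] val_mult[OF that Aq(2)[OF s(1)] Aq(2)[OF rp[of n]]]
        val_nat_pow[OF that Aq(2)[OF r(1)], of n] by simp
    have "0 \<le> val P' ((s \<otimes> r [^] n) \<otimes> x)" if "P' \<in> insert P T" for P'
    proof -
      have P': "P' \<in> Ht1 K R" using that insert.prems by (auto simp: B_def)
      have n0: "0 \<le> val P' s" "0 \<le> val P' r" using val_nonneg[OF P'] Aq s(1) r(1) by auto
      show ?thesis
      proof (cases "P' = P")
        case True
        have "1 \<le> val P r" using val_pos_iff[OF P(1) Aq(1)[OF r(1)]] r(2) by simp
        then have "int n * 1 \<le> int n * val P r" by (intro mult_left_mono) auto
        moreover have "int n = - val P x" using P(2) by (simp add: n_def)
        ultimately have "0 \<le> int n * val P r + val P x" by simp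
        then show ?thesis using v[OF P'] True n0 by simp
      next
        case False
        then have "0 \<le> val P' (s \<otimes> x)" using that s(2) by auto
        then have "0 \<le> val P' s + val P' x" using val_mult[OF P' Aq(2)[OF s(1)] xc] by simp
        moreover have "0 \<le> int n * val P' r" using n0 by simp
        ultimately show ?thesis using v[OF P'] by linarith
      qed
    qed
    then show ?case using sr by blast
  qed
  then obtain s where s: "s \<in> A - q" "\<forall>P\<in>B. 0 \<le> val P (s \<otimes> x)" using \<open>finite B\<close> by blast
  have "0 \<le> val P (s \<otimes> x)" if P: "P \<in> Ht1 K R" "P \<inter> A \<noteq> q" for P
  proof (cases "P \<in> B")
    case False
    then have "0 \<le> val P x" using P by (auto simp: B_def)
    moreover have "0 \<le> val P s" using val_nonneg[OF P(1) Aq(1)[OF s(1)]] .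
    ultimately show ?thesis using val_mult[OF P(1) Aq(2)[OF s(1)] xc] by simp
  qed (use s in auto)
  then show thesis using that s(1) by blast
qed

lemma primes_over_iff: "P \<in> primes_over K R A q \<longleftrightarrow> P \<in> Ht1 K R \<and> P \<inter> A = q"
  by (auto simp: primes_over_def)

lemma finite_primes_over:
  assumes q: "q \<in> Ht1 K A"
  shows "finite (primes_over K R A q)"
proof -
  obtain a where a: "a \<in> q" "a \<noteq> \<zero>" using Ht1_A_nonzero[OF q] .
  have aA: "a \<in> A" using a Ht1_A_facts(2)[OF q] by auto
  have "primes_over K R A q \<subseteq> {P \<in> Ht1 K R. val P a \<noteq> 0}"
    using val_eq_0_iff[of _ a] a aA A_R by (auto simp: primes_over_iff)
  then show ?thesis using finite_val[of a] a A_carrier[OF aA] finite_subset by blast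
qed

lemma localization_dichotomy:
  assumes q: "q \<in> Ht1 K A" and z: "z \<in> Fx" and nn: "\<And>P. P \<in> primes_over K R A q \<Longrightarrow> 0 \<le> val P z"
  shows "z \<in> localization K A q"
    "(\<forall>P\<in>primes_over K R A q. val P z = 0) \<or> (\<forall>P\<in>primes_over K R A q. 0 < val P z)"
proof -
  note qf = Ht1_A_facts[OF q]
  obtain s where s: "s \<in> A - q" "\<And>P. P \<in> Ht1 K R \<Longrightarrow> P \<inter> A \<noteq> q \<Longrightarrow> 0 \<le> val P (s \<otimes> z)"
    using clear_denominators[OF q z] by blast
  have zc: "z \<in> nz" using z F_carrier by auto
  have sc: "s \<in> nz" "s \<in> Rx" using s(1) qf(1) A_carrier A_R by auto
  have v: "val P (s \<otimes> z) = val P s + val P z" if "P \<in> Ht1 K R" for P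
    using val_mult[OF that sc(1) zc] .
  have szc: "s \<otimes> z \<in> nz" using nonzero_mult_closed[OF sc(1) zc] .
  have "0 \<le> val P (s \<otimes> z)" if P: "P \<in> Ht1 K R" for P
  proof (cases "P \<inter> A = q")
    case True
    then show ?thesis using v[OF P] val_nonneg[OF P sc(2)] nn[of P] P by (simp add: primes_over_iff)
  qed (use s(2) P in auto)
  then have "s \<otimes> z \<in> R" using R_iff[OF szc] by auto
  moreover have "s \<otimes> z \<in> F" using subringE(6)[OF subfieldE(1)[OF F_subfield]] A_F s(1) z by auto
  ultimately have szA: "s \<otimes> z \<in> A" using A_sat by auto
  then have zs: "z \<otimes> s \<in> A" using m_comm[of s z] sc zc by auto
  show "z \<in> localization K A q"
    unfolding localization_iff[OF A_subring qf(1)] using zc s(1) zs by (intro conjI bexI[of _ s]) auto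
  have vs: "val P s = 0" if "P \<in> primes_over K R A q" for P
    using that s(1) val_eq_0_iff[of P s] sc by (auto simp: primes_over_iff)
  have vz: "val P z = 0 \<longleftrightarrow> s \<otimes> z \<notin> q" if P: "P \<in> primes_over K R A q" for P
    using vs[OF P] v[of P] P val_eq_0_iff[of P "s \<otimes> z"] szA szc A_R by (auto simp: primes_over_iff)
  show "(\<forall>P\<in>primes_over K R A q. val P z = 0) \<or> (\<forall>P\<in>primes_over K R A q. 0 < val P z)"
    using vz nn by force
qed

text \<open>
  Otherwise some \<open>y\<close> has nonzero valuation at all primes over \<open>q\<close>, negative at \<open>P1\<close> and positive
  at \<open>P2\<close>; then \<open>y / (1 + y)\<close> lies in the local ring at \<open>q\<close> and is a unit at \<open>P1\<close> but not at \<open>P2\<close>.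
\<close>

lemma proportional_less:
  assumes q: "q \<in> Ht1 K A" and P1: "P1 \<in> primes_over K R A q" and P2: "P2 \<in> primes_over K R A q"
    and c: "c \<in> q" "c \<noteq> \<zero>" and z: "z \<in> Fx"
  shows "val P2 z * val P1 c \<le> val P1 z * val P2 c"
proof (rule ccontr)
  assume h: "\<not> ?thesis"
  let ?X = "primes_over K R A q"
  have XR: "P \<in> Ht1 K R" if "P \<in> ?X" for P using that by (auto simp: primes_over_iff)
  note V = val_valued_F[OF XR]
  have cA: "c \<in> A" using c Ht1_A_facts(2)[OF q] by auto
  have cF: "c \<in> Fx" using cA A_F c by auto
  have cpos: "0 < val P c" if "P \<in> ?X" for P
    using val_pos_iff[OF XR[OF that], of c] that c cA A_R by (auto simp: primes_over_iff)
  have oneF: "\<one> \<in> Fx" using subringE(3)[OF subfieldE(1)[OF F_subfield]] by auto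
  note p = valued_subfield.int_pow_F[OF V[OF P1]]
  note mF = valued_subfield.F_mult[OF V[OF P1]]
  define y0 where "y0 = z [^] val P1 c \<otimes> c [^] (- val P1 z)"
  have y0: "y0 \<in> Fx" unfolding y0_def using mF p z cF by blast
  have vy0: "val P y0 = val P1 c * val P z - val P1 z * val P c" if "P \<in> ?X" for P
    unfolding y0_def using valued_subfield.val_mult[OF V[OF that] p[OF z] p[OF cF]]
      valued_subfield.val_int_pow[OF V[OF that] z] valued_subfield.val_int_pow[OF V[OF that] cF] by simp
  define N where "N = (\<Sum>P\<in>?X. val P c)"
  have N: "val P c \<le> N" if "P \<in> ?X" for P
    unfolding N_def using finite_primes_over[OF q] that cpos by (intro member_le_sum) (auto intro: less_imp_le)
  define y where "y = y0 [^] (N + 1) \<otimes> c [^] (- 1 :: int)"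
  have y: "y \<in> Fx" unfolding y_def using mF p y0 cF by blast
  have vy: "val P y = (N + 1) * val P y0 - val P c" if "P \<in> ?X" for P
    unfolding y_def using valued_subfield.val_mult[OF V[OF that] p[OF y0] p[OF cF]]
      valued_subfield.val_int_pow[OF V[OF that] y0] valued_subfield.val_int_pow[OF V[OF that] cF] by simp
  have vy_cases: "0 < val P y" if P: "P \<in> ?X" "0 < val P y0" for P
  proof -
    have "(N + 1) * 1 \<le> (N + 1) * val P y0"
      using P(2) N[OF P(1)] cpos[OF P(1)] by (intro mult_left_mono) auto
    moreover have "val P y + val P c = (N + 1) * val P y0" using vy[OF P(1)] by simp
    ultimately have "N + 1 \<le> val P y + val P c" by (metis mult.right_neutral)
    then show ?thesis using N[OF P(1)] by linarith
  qed
  have vy_cases': "val P y < 0" if P: "P \<in> ?X" "val P y0 \<le> 0" for P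
  proof -
    have "(N + 1) * val P y0 \<le> 0"
      using P(2) N[OF P(1)] cpos[OF P(1)] by (intro mult_nonneg_nonpos) auto
    then show ?thesis using vy[OF P(1)] cpos[OF P(1)] by linarith
  qed
  have y1: "val P1 y < 0" using vy_cases'[OF P1] vy0[OF P1] by (simp add: mult.commute)
  have y2: "0 < val P2 y" using vy_cases[OF P2] vy0[OF P2] h by (simp add: mult.commute)
  have yc: "y \<in> carrier K" using y F_carrier by auto
  interpret V1: valued_subfield K F "val P1" by (rule V[OF P1])
  have oy: "y \<oplus> \<one> \<in> Fx" "val P1 (y \<oplus> \<one>) = val P1 y"
    using V1.val_add_strict[OF y oneF] y1 V1.F_facts(3)[of y \<one>] y oneF by auto
  have voy: "val P (y \<oplus> \<one>) = min 0 (val P y)" if P: "P \<in> ?X" for P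
  proof -
    interpret VP: valued_subfield K F "val P" by (rule V[OF P])
    have "val P y \<noteq> 0" using vy_cases[OF P] vy_cases'[OF P] by (cases "0 < val P y0") auto
    then consider "val P y < 0" | "0 < val P y" by linarith
    then show ?thesis
    proof cases
      case 1
      then show ?thesis using VP.val_add_strict(2)[OF y oneF] by auto
    next
      case 2
      then show ?thesis using VP.val_add_strict(2)[OF oneF y] a_comm[of y \<one>] yc by auto
    qed
  qed
  define w where "w = y \<otimes> inv (y \<oplus> \<one>)"
  have wF: "w \<in> Fx" unfolding w_def by (rule mF[OF y V1.F_facts(6)[OF oy(1)]])
  have vw: "val P w = val P y - min 0 (val P y)" if P: "P \<in> ?X" for P
    unfolding w_def using valued_subfield.val_mult[OF V[OF P] y V1.F_facts(6)[OF oy(1)]]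
      valued_subfield.val_inv[OF V[OF P] oy(1)] voy[OF P] by simp
  have "(\<forall>P\<in>?X. val P w = 0) \<or> (\<forall>P\<in>?X. 0 < val P w)"
    using localization_dichotomy(2)[OF q wF] vw by simp
  moreover have "val P1 w = 0" "0 < val P2 w" using vw[OF P1] vw[OF P2] y1 y2 by auto
  ultimately show False using P1 P2 by force
qed

lemma proportional:
  assumes q: "q \<in> Ht1 K A" and P1: "P1 \<in> primes_over K R A q" and P2: "P2 \<in> primes_over K R A q"
    and c: "c \<in> q" "c \<noteq> \<zero>" and z: "z \<in> Fx"
  shows "val P2 z * val P1 c = val P1 z * val P2 c"
  using proportional_less[OF q P1 P2 c z] proportional_less[OF q P2 P1 c z] by linarith

lemma ramification:
  assumes q: "q \<in> Ht1 K A" and P: "P \<in> primes_over K R A q"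
  shows "0 < ramification_index K R A P q"
    "\<And>x. x \<in> Fx \<Longrightarrow> val P x = int (ramification_index K R A P q) * valuation K A q x"
    "\<exists>t\<in>Fx. valuation K A q t = 1"
proof -
  let ?X = "primes_over K R A q"
  note qf = Ht1_A_facts[OF q]
  have XR: "P \<in> Ht1 K R" if "P \<in> ?X" for P using that by (auto simp: primes_over_iff)
  interpret V: valued_subfield K F "val P" by (rule val_valued_F[OF XR[OF P]])
  obtain c where c: "c \<in> q" "c \<noteq> \<zero>" using Ht1_A_nonzero[OF q] .
  have cA: "c \<in> A" using c Ht1_A_facts(2)[OF q] by auto
  have cF: "c \<in> Fx" using cA A_F c by auto
  have cpos: "0 < val P c" if "P \<in> ?X" for P
    using val_pos_iff[OF XR[OF that], of c] that c cA A_R by (auto simp: primes_over_iff)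
  have loc: "localization K A q = V.integers"
  proof (intro Set.set_eqI iffI)
    fix x assume "x \<in> localization K A q"
    then obtain s where s: "x \<in> carrier K" "s \<in> A - q" "x \<otimes> s \<in> A"
      using localization_iff[OF A_subring qf(1)] by auto
    have sc: "s \<in> nz" "s \<in> Rx" using s(2) qf(1) A_carrier A_R by auto
    have xF: "x \<in> F" unfolding fractions_iff[OF A_subring] using s qf(1) by (intro conjI bexI[of _ s]) auto
    have "0 \<le> val P x" if x: "x \<noteq> \<zero>"
    proof -
      have xs: "x \<otimes> s \<in> Rx" using s sc x mult_nonzero[of x s] A_R by auto
      have "val P s = 0" using val_eq_0_iff[OF XR[OF P] sc(2)] s(2) P by (auto simp: primes_over_iff)
      then show ?thesis using val_mult[OF XR[OF P] _ sc(1), of x] val_nonneg[OF XR[OF P] xs] s x by auto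
    qed
    then show "x \<in> V.integers" using xF by (auto simp: V.integers_def)
  next
    fix x assume x: "x \<in> V.integers"
    show "x \<in> localization K A q"
    proof (cases "x = \<zero>")
      case True
      then show ?thesis using localization_subring(2)[OF A_subring Ht1_A_prime[OF q]] subringE(2)[OF A_subring] by auto
    next
      case False
      then have xF: "x \<in> Fx" and v: "0 \<le> val P x" using x by (auto simp: V.integers_def)
      have "0 \<le> val P' x" if P': "P' \<in> ?X" for P'
      proof -
        have "val P' x * val P c = val P x * val P' c" using proportional[OF q P P' c xF] .
        then have "0 \<le> val P' x * val P c" using v cpos[OF P'] by simp
        then show ?thesis using cpos[OF P] by (simp add: zero_le_mult_iff)
      qed
      then show ?thesis using localization_dichotomy(1)[OF q xF] by blast
    qed
  qed
  define e where "e = (LEAST n::nat. 0 < n \<and> (\<exists>t\<in>Fx. val P t = int n))"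
  have "0 < nat (val P c) \<and> (\<exists>t\<in>Fx. val P t = int (nat (val P c)))"
    using cpos[OF P] cF by (intro conjI bexI[of _ c]) auto
  then have e: "0 < e \<and> (\<exists>t\<in>Fx. val P t = int e)" unfolding e_def by (rule LeastI)
  then obtain t where t: "t \<in> Fx" "val P t = int e" by auto
  have min: "e \<le> n" if "0 < n" "x \<in> Fx" "val P x = int n" for n x
    unfolding e_def using that by (intro Least_le) auto
  have dvd: "int e * (val P x div int e) = val P x" if x: "x \<in> Fx" for x
  proof -
    define y where "y = x \<otimes> t [^] (- (val P x div int e))"
    have y: "y \<in> Fx" unfolding y_def using V.F_mult[OF x V.int_pow_F[OF t(1)]] .
    have "val P y = val P x - int e * (val P x div int e)"
      unfolding y_def using V.val_mult[OF x V.int_pow_F[OF t(1)]] V.val_int_pow[OF t(1)] t(2) by simp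
    then have vy: "val P y = val P x mod int e" by (simp add: minus_mult_div_eq_mod)
    have lt: "0 \<le> val P y" "val P y < int e" using vy e by auto
    have "val P y = 0"
    proof (rule ccontr)
      assume "val P y \<noteq> 0"
      then have "e \<le> nat (val P y)" using lt y by (intro min[of _ y]) auto
      then show False using lt by linarith
    qed
    then show ?thesis using vy by (simp add: mult_div_mod_eq[symmetric]) (metis add.right_neutral mult_div_mod_eq)
  qed
  define w where "w x = val P x div int e" for x
  have vw: "val P x = int e * w x" if "x \<in> Fx" for x using dvd[OF that] by (simp add: w_def)
  have e0: "0 < int e" using e by simp
  have W: "valued_subfield K F w"
  proof (intro valued_subfield.intro valued_subfield_axioms.intro field_axioms F_subfield)
    fix x y assume xy: "x \<in> Fx" "y \<in> Fx"
    have "int e * w (x \<otimes> y) = int e * (w x + w y)"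
      using V.val_mult[OF xy] vw[OF xy(1)] vw[OF xy(2)] vw[OF V.F_mult[OF xy]] by (simp add: distrib_left)
    then show "w (x \<otimes> y) = w x + w y" using e0 by simp
  next
    fix x y assume xy: "x \<in> Fx" "y \<in> Fx" and n: "x \<oplus> y \<noteq> \<zero>"
    have s: "x \<oplus> y \<in> Fx" using V.F_facts(3)[of x y] xy n by auto
    have "min (int e * w x) (int e * w y) \<le> int e * w (x \<oplus> y)"
      using V.val_add[OF xy n] vw[OF xy(1)] vw[OF xy(2)] vw[OF s] by simp
    then have "int e * min (w x) (w y) \<le> int e * w (x \<oplus> y)" using e0 by (simp add: min_def split: if_splits)
    then show "min (w x) (w y) \<le> w (x \<oplus> y)" using e0 by simp
  qed
  interpret W: valued_subfield K F w by (rule W)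
  have "W.integers = V.integers"
    unfolding W.integers_def V.integers_def using vw e0 by (force simp: zero_le_mult_iff)
  then have loc': "localization K A q = W.integers" using loc by simp
  have wt: "w t = 1" using t e by (simp add: w_def)
  have val: "valuation K A q x = w x" if "x \<in> Fx" for x
    using W.valuation_eq[OF loc' t(1) wt that] .
  have ram: "ramification_index K R A P q = e"
    unfolding ramification_index_def
  proof (rule the_equality)
    show "\<forall>x\<in>Fx. val P x = int e * valuation K A q x" using vw val by simp
    fix e' assume "\<forall>x\<in>Fx. val P x = int e' * valuation K A q x"
    then have "val P t = int e' * valuation K A q t" using t by blast
    then show "e' = e" using val[OF t(1)] wt t by simp
  qed
  show "0 < ramification_index K R A P q" using ram e by simp
  show "val P x = int (ramification_index K R A P q) * valuation K A q x" if "x \<in> Fx" for x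
    using ram vw[OF that] val[OF that] by simp
  show "\<exists>t\<in>Fx. valuation K A q t = 1" using t val[OF t(1)] wt by auto
qed

end

section \<open>Minimal effective divisors\<close>

lemma lookup_frag_sum:
  assumes "finite S"
  shows "coeff (\<Sum>P\<in>S. frag_cmul (d P) (frag_of P)) Q = (if Q \<in> S then d Q else 0)"
proof -
  have "coeff (\<Sum>P\<in>S. frag_cmul (d P) (frag_of P)) Q = (\<Sum>P\<in>S. if P = Q then d P else 0)"
    unfolding lookup_sum by (intro sum.cong) (auto simp: lookup_single when_def)
  also have "\<dots> = (if Q \<in> S then d Q else 0)" using assms by (simp add: sum.delta)
  finally show ?thesis .
qed

context krull_extension
begin

abbreviation "over q \<equiv> primes_over K R A q"
abbreviation "min_eff \<equiv> minimal_effective K R A"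
abbreviation "E_star \<equiv> Estar K R A"
abbreviation "ram P q \<equiv> ramification_index K R A P q"
abbreviation "e P \<equiv> ram P (P \<inter> A)"

lemma Div_iff: "D \<in> carrier (Div K R) \<longleftrightarrow> (\<forall>P. P \<notin> Ht1 K R \<longrightarrow> coeff D P = 0)"
  by (auto simp: Div_def in_keys_iff)

lemma Div_diff: "D \<in> carrier (Div K R) \<Longrightarrow> E \<in> carrier (Div K R) \<Longrightarrow> D - E \<in> carrier (Div K R)"
  by (auto simp: Div_iff lookup_minus)

definition Egen :: "'a set \<Rightarrow> ('a set \<Rightarrow>\<^sub>0 int)"
  where "Egen q = (\<Sum>P\<in>over q. frag_cmul (int (ram P q)) (frag_of P))"

lemma lookup_Egen:
  "q \<in> Ht1 K A \<Longrightarrow> coeff (Egen q) P = (if P \<in> over q then int (ram P q) else 0)"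
  unfolding Egen_def by (rule lookup_frag_sum[OF finite_primes_over])

lemma Egen_Div: "q \<in> Ht1 K A \<Longrightarrow> Egen q \<in> carrier (Div K R)"
  by (auto simp: Div_iff lookup_Egen primes_over_iff)

lemma Estar_eq: "E_star = generate (Div K R) (Egen ` Ht1 K A \<union> frag_of ` Ht1_ge2 K R A)"
  unfolding Estar_def Egen_def by (rule arg_cong[of _ _ "generate (Div K R)"]) auto

lemma Div_group: "group (Div K R)"
  by (simp add: Div_def)

lemma Div_simps [simp]: "D \<otimes>\<^bsub>Div K R\<^esub> E = D + E" "\<one>\<^bsub>Div K R\<^esub> = 0"
  by (simp_all add: Div_def)

lemma Div_inv: "D \<in> carrier (Div K R) \<Longrightarrow> inv\<^bsub>Div K R\<^esub> D = - D"
  by (simp add: Div_def)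

lemma Estar_subgroup: "subgroup (E_star) (Div K R)"
proof -
  have "Egen ` Ht1 K A \<union> frag_of ` Ht1_ge2 K R A \<subseteq> carrier (Div K R)"
    using Egen_Div by (auto simp: Div_def Ht1_ge2_iff)
  then show ?thesis unfolding Estar_eq by (rule group.generate_is_subgroup[OF Div_group])
qed

lemma Estar_add: "D \<in> E_star \<Longrightarrow> E \<in> E_star \<Longrightarrow> D + E \<in> E_star"
  using subgroup.m_closed[OF Estar_subgroup] by simp

lemma Estar_sum:
  assumes "finite S" "\<And>i. i \<in> S \<Longrightarrow> D i \<in> E_star"
  shows "(\<Sum>i\<in>S. D i) \<in> E_star"
  using assms
proof (induction S rule: finite_induct)
  case empty
  then show ?case using subgroup.one_closed[OF Estar_subgroup] by simp
next
  case (insert i S)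
  then show ?case using subgroup.m_closed[OF Estar_subgroup, of "D i" "\<Sum>i\<in>S. D i"] by simp
qed

lemma Estar_cmul:
  assumes "D \<in> E_star" shows "frag_cmul n D \<in> E_star"
proof -
  have D: "Poly_Mapping.keys D \<subseteq> Ht1 K R"
    using subgroup.mem_carrier[OF Estar_subgroup assms] by (simp add: Div_def)
  have "D [^]\<^bsub>Div K R\<^esub> n \<in> E_star"
    using group.int_pow_closed[OF subgroup.subgroup_is_group[OF Estar_subgroup Div_group], of D n] assms
      group.int_pow_consistent[OF Div_group Estar_subgroup assms] by simp
  then show ?thesis using int_pow_free_Abelian_group[OF D, of n] by (simp add: Div_def)
qed

lemma Ht1_ge2_contraction:
  assumes "P \<in> Ht1_ge2 K R A" shows "P \<inter> A \<noteq> {\<zero>}" "P \<inter> A \<notin> Ht1 K A"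
proof -
  have "P \<in> Ht1 K R" using assms by (simp add: Ht1_ge2_iff)
  then have "P \<inter> A \<noteq> {\<zero>} \<and> P \<inter> A \<notin> Ht1 K A" by (cases rule: Ht1_cases) (use assms in auto)
  then show "P \<inter> A \<noteq> {\<zero>}" "P \<inter> A \<notin> Ht1 K A" by auto
qed

lemma Estar_iff:
  "D \<in> E_star \<longleftrightarrow> D \<in> carrier (Div K R) \<and>
    (\<exists>c. \<forall>P\<in>Ht1 K R. (P \<inter> A = {\<zero>} \<longrightarrow> coeff D P = 0) \<and>
      (P \<inter> A \<in> Ht1 K A \<longrightarrow> coeff D P = c (P \<inter> A) * int (e P)))"
proof safe
  assume D: "D \<in> E_star"
  show "D \<in> carrier (Div K R)" using subgroup.mem_carrier[OF Estar_subgroup D] .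
  define C where "C D c \<longleftrightarrow> (\<forall>P\<in>Ht1 K R. (P \<inter> A = {\<zero>} \<longrightarrow> coeff D P = 0) \<and>
      (P \<inter> A \<in> Ht1 K A \<longrightarrow> coeff D P = c (P \<inter> A) * int (e P)))"
    for D :: "'a set \<Rightarrow>\<^sub>0 int" and c :: "'a set \<Rightarrow> int"
  have gen: "\<exists>c. C h c" if "h \<in> Egen ` Ht1 K A \<union> frag_of ` Ht1_ge2 K R A" for h
    using that
  proof
    assume "h \<in> Egen ` Ht1 K A"
    then obtain q where q: "q \<in> Ht1 K A" "h = Egen q" by auto
    have "C h (\<lambda>q'. if q' = q then 1 else 0)"
      unfolding C_def
    proof (intro ballI conjI impI)
      fix P assume P: "P \<in> Ht1 K R" "P \<inter> A = {\<zero>}"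
      have "P \<inter> A \<noteq> q" using Ht1_A_nonzero[OF q(1)] P(2) by blast
      then show "coeff h P = 0" using q lookup_Egen by (simp add: primes_over_iff)
    next
      fix P assume P: "P \<in> Ht1 K R" "P \<inter> A \<in> Ht1 K A"
      then show "coeff h P = (if P \<inter> A = q then 1 else 0) * int (e P)"
        using q lookup_Egen by (auto simp: primes_over_iff)
    qed
    then show ?thesis by (intro exI)
  next
    assume "h \<in> frag_of ` Ht1_ge2 K R A"
    then obtain Q where Q: "Q \<in> Ht1_ge2 K R A" "h = frag_of Q" by auto
    have "coeff h P = 0" if "P \<inter> A = {\<zero>} \<or> P \<inter> A \<in> Ht1 K A" for P
      using Ht1_ge2_contraction[OF Q(1)] that unfolding Q(2) lookup_frag_of by metis
    then have "C h (\<lambda>q'. 0)" by (simp add: C_def)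
    then show ?thesis by (intro exI)
  qed
  have dv: "h \<in> carrier (Div K R)" if "h \<in> Egen ` Ht1 K A \<union> frag_of ` Ht1_ge2 K R A" for h
    using that Egen_Div by (auto simp: Div_def Ht1_ge2_iff)
  have "\<exists>c. C D c"
    using D[unfolded Estar_eq]
  proof (induction rule: generate.induct)
    case one
    have "C 0 (\<lambda>_. 0)" by (simp add: C_def)
    then show ?case by auto
  next
    case (incl h)
    then show ?case by (rule gen)
  next
    case (inv h)
    then obtain c where "C h c" using gen by blast
    then have "C (- h) (\<lambda>q. - c q)" by (simp add: C_def)
    then show ?case using Div_inv[OF dv[OF inv]] by auto
  next
    case (eng h1 h2)
    then obtain c1 c2 where "C h1 c1" "C h2 c2" by blast
    then have "C (h1 + h2) (\<lambda>q. c1 q + c2 q)" by (simp add: C_def lookup_add distrib_right)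
    then show ?case by auto
  qed
  then show "\<exists>c. \<forall>P\<in>Ht1 K R. (P \<inter> A = {\<zero>} \<longrightarrow> coeff D P = 0) \<and>
      (P \<inter> A \<in> Ht1 K A \<longrightarrow> coeff D P = c (P \<inter> A) * int (e P))"
    unfolding C_def .
next
  fix c assume D: "D \<in> carrier (Div K R)"
    and c: "\<forall>P\<in>Ht1 K R. (P \<inter> A = {\<zero>} \<longrightarrow> coeff D P = 0) \<and>
      (P \<inter> A \<in> Ht1 K A \<longrightarrow> coeff D P = c (P \<inter> A) * int (e P))"
  define Q0 where "Q0 = {P \<inter> A | P. P \<in> Poly_Mapping.keys D \<and> P \<inter> A \<in> Ht1 K A}"
  define H0 where "H0 = Poly_Mapping.keys D \<inter> Ht1_ge2 K R A"
  have fQ: "finite Q0" by (auto simp: Q0_def)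
  have fH: "finite H0" by (auto simp: H0_def)
  have Q0: "q \<in> Ht1 K A" if "q \<in> Q0" for q using that by (auto simp: Q0_def)
  have eq: "D = (\<Sum>q\<in>Q0. frag_cmul (c q) (Egen q)) + (\<Sum>P\<in>H0. frag_cmul (coeff D P) (frag_of P))"
  proof (rule poly_mapping_eqI)
    fix P
    have 1: "coeff (\<Sum>q\<in>Q0. frag_cmul (c q) (Egen q)) P
        = (\<Sum>q\<in>Q0. if P \<in> over q then c q * int (ram P q) else 0)"
      unfolding lookup_sum by (intro sum.cong) (auto simp: lookup_Egen Q0)
    also have "\<dots> = (\<Sum>q\<in>Q0. if q = P \<inter> A then (if P \<in> Ht1 K R then c q * int (ram P q) else 0) else 0)"
      by (intro sum.cong) (auto simp: primes_over_iff)
    also have "\<dots> = (if P \<inter> A \<in> Q0 \<and> P \<in> Ht1 K R then c (P \<inter> A) * int (e P) else 0)"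
      using fQ by (simp add: sum.delta)
    finally have l1: "coeff (\<Sum>q\<in>Q0. frag_cmul (c q) (Egen q)) P =
      (if P \<inter> A \<in> Q0 \<and> P \<in> Ht1 K R then c (P \<inter> A) * int (e P) else 0)" .
    have l2: "coeff (\<Sum>P\<in>H0. frag_cmul (coeff D P) (frag_of P)) P
      = (if P \<in> H0 then coeff D P else 0)" by (rule lookup_frag_sum[OF fH])
    show "coeff D P = coeff ((\<Sum>q\<in>Q0. frag_cmul (c q) (Egen q))
        + (\<Sum>P\<in>H0. frag_cmul (coeff D P) (frag_of P))) P"
      unfolding lookup_add l1 l2
    proof (cases "P \<in> Ht1 K R")
      case False
      then show "coeff D P = (if P \<inter> A \<in> Q0 \<and> P \<in> Ht1 K R then c (P \<inter> A) * int (e P) else 0)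
        + (if P \<in> H0 then coeff D P else 0)"
        using D by (auto simp: Div_iff)
    next
      case True
      then show "coeff D P = (if P \<inter> A \<in> Q0 \<and> P \<in> Ht1 K R then c (P \<inter> A) * int (e P) else 0)
        + (if P \<in> H0 then coeff D P else 0)"
      proof (cases rule: Ht1_cases)
        case zero
        have "coeff D P = 0" using c True zero(1) by blast
        moreover have "P \<inter> A \<notin> Q0" using zero(2) Q0 by blast
        ultimately show ?thesis by simp
      next
        case one
        then have l: "coeff D P = c (P \<inter> A) * int (e P)" using c True by auto
        have "P \<inter> A \<in> Q0" if "coeff D P \<noteq> 0"
          using that one by (auto simp: Q0_def in_keys_iff)
        moreover have "P \<notin> H0" using one by (simp add: H0_def)
        ultimately show ?thesis using True l by (cases "P \<inter> A \<in> Q0") auto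
      next
        case ge2
        have "P \<inter> A \<notin> Q0" using ge2(2) Q0 by blast
        then show ?thesis using ge2(3) by (simp add: H0_def in_keys_iff)
      qed
    qed
  qed
  have m1: "(\<Sum>q\<in>Q0. frag_cmul (c q) (Egen q)) \<in> E_star"
  proof (intro Estar_sum[OF fQ] Estar_cmul)
    fix q assume "q \<in> Q0"
    then show "Egen q \<in> E_star" unfolding Estar_eq using Q0 by (intro generate.incl) auto
  qed
  have m2: "(\<Sum>P\<in>H0. frag_cmul (coeff D P) (frag_of P)) \<in> E_star"
  proof (intro Estar_sum[OF fH] Estar_cmul)
    fix P assume "P \<in> H0"
    then show "frag_of P \<in> E_star" unfolding Estar_eq by (intro generate.incl) (auto simp: H0_def)
  qed
  show "D \<in> E_star"
    by (subst eq) (rule Estar_add[OF m1 m2])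
qed

lemma EstarD:
  assumes "D \<in> E_star"
  obtains c where "\<And>P. \<lbrakk>P \<in> Ht1 K R; P \<inter> A = {\<zero>}\<rbrakk> \<Longrightarrow> coeff D P = 0"
    "\<And>P q. \<lbrakk>P \<in> over q; q \<in> Ht1 K A\<rbrakk> \<Longrightarrow> coeff D P = c q * int (ram P q)"
proof -
  obtain c where c: "\<forall>P\<in>Ht1 K R. (P \<inter> A = {\<zero>} \<longrightarrow> coeff D P = 0) \<and>
      (P \<inter> A \<in> Ht1 K A \<longrightarrow> coeff D P = c (P \<inter> A) * int (e P))"
    using assms unfolding Estar_iff by blast
  show thesis by (rule that[of c]) (use c in \<open>auto simp: primes_over_iff\<close>)
qed

lemma Estar_diff:
  assumes "D \<in> E_star" "E \<in> E_star" shows "D - E \<in> E_star"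
  using Estar_add[OF assms(1) Estar_cmul[OF assms(2), of "-1"]] by simp

lemma divisor_of_Estar:
  assumes x: "x \<in> Fx"
  shows "divisor x \<in> E_star"
proof -
  have xc: "x \<in> nz" using x F_carrier by auto
  show ?thesis unfolding Estar_iff lookup_divisor_of[OF xc]
    using divisor_of_Div[OF xc] val_F_zero[OF _ _ x] ramification(2)[OF _ _ x]
    by (intro conjI exI[of _ "\<lambda>q. valuation K A q x"]) (auto simp: primes_over_iff mult.commute)
qed

lemma minimal_effective_iff:
  "min_eff D \<longleftrightarrow> D \<in> carrier (Div K R) \<and> effective D \<and>
    (\<forall>P\<in>Ht1_ge2 K R A. coeff D P = 0) \<and>
    (\<forall>q\<in>Ht1 K A. over q \<noteq> {} \<longrightarrow>
      (\<exists>P\<in>over q. coeff D P < int (ram P q)))" (is "_ \<longleftrightarrow> ?rhs")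
proof
  assume m: "min_eff D"
  have D: "D \<in> carrier (Div K R)" and eff: "effective D"
    and min: "\<And>D1 D2. \<lbrakk>D1 \<in> E_star; effective D1; D2 \<in> carrier (Div K R); effective D2; D = D1 + D2\<rbrakk> \<Longrightarrow> D1 = 0"
    using m unfolding minimal_effective_def by blast+
  have min': "D1 = 0" if "D1 \<in> E_star" "effective D1" "effective (D - D1)" for D1
    using min[OF that(1,2) Div_diff[OF D subgroup.mem_carrier[OF Estar_subgroup that(1)]] that(3)] by simp
  have "coeff D P = 0" if P: "P \<in> Ht1_ge2 K R A" for P
  proof (rule ccontr)
    assume n: "coeff D P \<noteq> 0"
    have pos: "1 \<le> coeff D P"
      using n eff[unfolded effective_def, rule_format, of P] by linarith
    have "frag_of P = (0 :: 'a set \<Rightarrow>\<^sub>0 int)"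
    proof (rule min')
      show "frag_of P \<in> E_star" unfolding Estar_eq using P by (intro generate.incl) auto
      show "effective (frag_of P)" by (auto simp: effective_def lookup_single when_def)
      show "effective (D - frag_of P)"
        using eff pos by (auto simp: effective_def lookup_minus lookup_single when_def)
    qed
    then show False by simp
  qed
  moreover have "\<exists>P\<in>over q. coeff D P < int (ram P q)"
    if q: "q \<in> Ht1 K A" "over q \<noteq> {}" for q
  proof (rule ccontr)
    assume n: "\<not> ?thesis"
    have "Egen q = 0"
    proof (rule min')
      show "Egen q \<in> E_star" unfolding Estar_eq using q by (intro generate.incl) auto
      show "effective (Egen q)" using q by (auto simp: effective_def lookup_Egen)
      show "effective (D - Egen q)"
        using eff n q by (auto simp: effective_def lookup_minus lookup_Egen not_less)
    qed
    moreover obtain P where P: "P \<in> over q" using q by auto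
    ultimately show False using lookup_Egen[OF q(1), of P] ramification(1)[OF q(1) P] by simp
  qed
  ultimately show ?rhs using D eff by blast
next
  assume r: ?rhs
  have "D1 = 0" if D1: "D1 \<in> E_star" "effective D1" "effective D2" "D = D1 + D2" for D1 D2
  proof (rule poly_mapping_eqI)
    obtain c where c: "\<And>P. \<lbrakk>P \<in> Ht1 K R; P \<inter> A = {\<zero>}\<rbrakk> \<Longrightarrow> coeff D1 P = 0"
      "\<And>P q. \<lbrakk>P \<in> over q; q \<in> Ht1 K A\<rbrakk> \<Longrightarrow> coeff D1 P = c q * int (ram P q)"
      using EstarD[OF D1(1)] by blast
    have le: "0 \<le> coeff D1 P" "coeff D1 P \<le> coeff D P" for P
      using D1(2-4) by (auto simp: effective_def lookup_add)
    fix P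
    have "coeff D1 P = 0"
    proof (cases "P \<in> Ht1 K R")
      case False
      then show ?thesis using subgroup.mem_carrier[OF Estar_subgroup D1(1)] by (auto simp: Div_iff)
    next
      case True
      then show ?thesis
      proof (cases rule: Ht1_cases)
        case zero
        then show ?thesis using c(1) True by blast
      next
        case one
        have PX: "P \<in> over (P \<inter> A)" using True by (simp add: primes_over_iff)
        then obtain P' where P': "P' \<in> over (P \<inter> A)" "coeff D P' < int (ram P' (P \<inter> A))"
          using r one by blast
        have rp: "0 < int (ram P' (P \<inter> A))" using ramification(1)[OF one(2) P'(1)] by simp
        have "c (P \<inter> A) * int (ram P' (P \<inter> A)) < 1 * int (ram P' (P \<inter> A))"
          using c(2)[OF P'(1) one(2)] le(2)[of P'] P'(2) by linarith
        then have "c (P \<inter> A) < 1" using rp by (simp only: mult_less_cancel_right_pos)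
        moreover have "0 \<le> c (P \<inter> A) * int (ram P' (P \<inter> A))" using c(2)[OF P'(1) one(2)] le(1)[of P'] by linarith
        then have "0 \<le> c (P \<inter> A)" using rp by (simp add: zero_le_mult_iff)
        ultimately have "c (P \<inter> A) = 0" by simp
        then show ?thesis using c(2)[OF PX one(2)] by simp
      next
        case ge2
        then show ?thesis using r le[of P] by auto
      qed
    qed
    then show "coeff D1 P = coeff 0 P" by simp
  qed
  then show "min_eff D" using r unfolding minimal_effective_def by blast
qed

lemma minimal_effective_unique:
  assumes "min_eff D" "min_eff D'" "D - D' \<in> E_star"
  shows "D = D'"
proof (rule poly_mapping_eqI)
  obtain c where c: "\<And>P. \<lbrakk>P \<in> Ht1 K R; P \<inter> A = {\<zero>}\<rbrakk> \<Longrightarrow> coeff (D - D') P = 0"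
    "\<And>P q. \<lbrakk>P \<in> over q; q \<in> Ht1 K A\<rbrakk> \<Longrightarrow> coeff (D - D') P = c q * int (ram P q)"
    using EstarD[OF assms(3)] by blast
  have c0: "c q \<le> 0" if m: "min_eff D" "min_eff D'"
    and c: "\<And>P. P \<in> over q \<Longrightarrow> coeff (D - D') P = c q * int (ram P q)"
    and q: "q \<in> Ht1 K A" "over q \<noteq> {}" for D D' c q
  proof -
    obtain P where P: "P \<in> over q" "coeff D P < int (ram P q)"
      using m(1) q unfolding minimal_effective_iff by blast
    have "0 \<le> coeff D' P" using m(2) unfolding minimal_effective_iff effective_def by blast
    then have "c q * int (ram P q) < 1 * int (ram P q)" using c[OF P(1)] P(2) by (simp add: lookup_minus)
    then have "c q < 1" using ramification(1)[OF q(1) P(1)] by (simp only: mult_less_cancel_right_pos of_nat_0_less_iff)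
    then show ?thesis by simp
  qed
  fix P
  show "coeff D P = coeff D' P"
  proof (cases "P \<in> Ht1 K R")
    case False
    then show ?thesis using assms(1,2) by (auto simp: minimal_effective_iff Div_iff)
  next
    case True
    then show ?thesis
    proof (cases rule: Ht1_cases)
      case zero
      then show ?thesis using c(1)[OF True] by (simp add: lookup_minus)
    next
      case one
      let ?q = "P \<inter> A"
      have P: "P \<in> over ?q" using True by (simp add: primes_over_iff)
      then have ne: "over ?q \<noteq> {}" by auto
      have "c ?q \<le> 0" using c0[of D D' ?q c] assms(1,2) c(2) one(2) ne by blast
      moreover have "- c ?q \<le> 0"
      proof (rule c0[of D' D ?q "\<lambda>q. - c q", OF assms(2,1) _ one(2) ne])
        fix P' assume "P' \<in> over ?q"
        from c(2)[OF this one(2)] show "coeff (D' - D) P' = - c ?q * int (ram P' ?q)"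
          by (simp add: lookup_minus)
      qed
      ultimately have "c ?q = 0" by simp
      then show ?thesis using c(2)[OF P one(2)] by (simp add: lookup_minus)
    next
      case ge2
      then show ?thesis using assms(1,2) by (simp add: minimal_effective_iff)
    qed
  qed
qed

lemma minimal_effective_exists:
  assumes f: "f \<in> Rx"
  obtains D where "min_eff D" "effective (divisor f - D)"
    "divisor f - D \<in> E_star"
proof -
  have fc: "f \<in> nz" using f R_carrier by auto
  have vn: "0 \<le> val P f" if "P \<in> Ht1 K R" for P using val_nonneg[OF that f] .
  define m where "m q = Min ((\<lambda>P. val P f div int (ram P q)) ` over q)" for q
  define d where "d P = (if P \<inter> A = {\<zero>} then val P f else if P \<inter> A \<in> Ht1 K A
      then val P f - m (P \<inter> A) * int (e P) else 0)" for P
  define D where "D = (\<Sum>P\<in>{P \<in> Ht1 K R. val P f \<noteq> 0}. frag_cmul (d P) (frag_of P))"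
  have m_le: "m q \<le> val P f div int (ram P q)" if "q \<in> Ht1 K A" "P \<in> over q" for P q
    unfolding m_def using that finite_primes_over by (intro Min_le) auto
  have m_nn: "0 \<le> m q" if q: "q \<in> Ht1 K A" "P \<in> over q" for P q
  proof -
    have "0 \<le> val P' f div int (ram P' q)" if P': "P' \<in> over q" for P'
      using vn[of P'] P' ramification(1)[OF q(1) P']
      by (auto simp: primes_over_iff pos_imp_zdiv_nonneg_iff)
    then show ?thesis unfolding m_def using q finite_primes_over by (intro Min.boundedI) auto
  qed
  have PX: "P \<in> over (P \<inter> A)" if "P \<in> Ht1 K R" for P using that by (simp add: primes_over_iff)
  have mv: "m (P \<inter> A) * int (e P) \<le> val P f" if P: "P \<in> Ht1 K R" "P \<inter> A \<in> Ht1 K A" for P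
  proof -
    have "m (P \<inter> A) * int (e P) \<le> (val P f div int (e P)) * int (e P)"
      using m_le[OF P(2) PX[OF P(1)]] by (intro mult_right_mono) auto
    also have "\<dots> \<le> val P f"
      using ramification(1)[OF P(2) PX[OF P(1)]]
      by (metis div_mult_mod_eq le_add_same_cancel1 of_nat_0_less_iff pos_mod_sign)
    finally show ?thesis .
  qed
  have mn: "0 \<le> m (P \<inter> A) * int (e P)" if P: "P \<in> Ht1 K R" "P \<inter> A \<in> Ht1 K A" for P
    using m_nn[OF P(2) PX[OF P(1)]] by simp
  have lD: "coeff D P = (if P \<in> Ht1 K R then d P else 0)" for P
  proof -
    have "d P = 0" if P: "P \<in> Ht1 K R" "val P f = 0"
      using P mv[of P] mn[of P] unfolding d_def by auto
    then show ?thesis unfolding D_def lookup_frag_sum[OF finite_val[OF fc]] by auto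
  qed
  have DD: "D \<in> carrier (Div K R)" by (auto simp: Div_iff lD)
  have "min_eff D"
    unfolding minimal_effective_iff
  proof (intro conjI ballI impI DD)
    show "effective D" unfolding effective_def lD d_def using vn mv by auto
    show "coeff D P = 0" if P: "P \<in> Ht1_ge2 K R A" for P
    proof -
      have "P \<in> Ht1 K R" using P by (simp add: Ht1_ge2_iff)
      then show ?thesis by (cases rule: Ht1_cases) (use P in \<open>auto simp: lD d_def\<close>)
    qed
    fix q assume q: "q \<in> Ht1 K A" "over q \<noteq> {}"
    have "m q \<in> (\<lambda>P. val P f div int (ram P q)) ` over q"
      unfolding m_def using q finite_primes_over by (intro Min_in) auto
    then obtain P where P: "P \<in> over q" "m q = val P f div int (ram P q)" by auto
    have PA: "P \<in> Ht1 K R" "P \<inter> A = q" using P(1) by (auto simp: primes_over_iff)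
    have "q \<noteq> {\<zero>}" using Ht1_A_nonzero[OF q(1)] by blast
    then have "coeff D P = val P f - (val P f div int (ram P q)) * int (ram P q)"
      using PA q P(2) by (simp add: lD d_def)
    also have "\<dots> = val P f mod int (ram P q)" by (simp add: minus_div_mult_eq_mod)
    also have "\<dots> < int (ram P q)" using ramification(1)[OF q(1) P(1)] by simp
    finally show "\<exists>P\<in>over q. coeff D P < int (ram P q)" using P(1) by blast
  qed
  moreover have "effective (divisor f - D)"
    unfolding effective_def lookup_minus lD lookup_divisor_of[OF fc] d_def using vn mn by auto
  moreover have "divisor f - D \<in> E_star"
    unfolding Estar_iff
  proof (intro conjI exI[of _ m] ballI impI)
    show "divisor f - D \<in> carrier (Div K R)" by (rule Div_diff[OF divisor_of_Div[OF fc] DD])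
  next
    fix P assume P: "P \<in> Ht1 K R" "P \<inter> A = {\<zero>}"
    then show "coeff (divisor f - D) P = 0"
      by (simp add: lookup_minus lD lookup_divisor_of[OF fc] d_def)
  next
    fix P assume P: "P \<in> Ht1 K R" "P \<inter> A \<in> Ht1 K A"
    have "P \<inter> A \<noteq> {\<zero>}" using Ht1_A_nonzero[OF P(2)] by blast
    then show "coeff (divisor f - D) P = m (P \<inter> A) * int (e P)"
      using P by (simp add: lookup_minus lD lookup_divisor_of[OF fc] d_def)
  qed
  ultimately show thesis using that by blast
qed

end

section \<open>Group actions, cocycles and cohomology\<close>

locale krull_action = krull_field +
  fixes G :: "('g, 'c) monoid_scheme" and \<phi> :: "'g \<Rightarrow> 'a \<Rightarrow> 'a"
  assumes action: "group_action G R \<phi>"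
    and automorphisms: "\<forall>\<sigma>\<in>carrier G. \<phi> \<sigma> \<in> ring_iso (subring_of K R) (subring_of K R)"
begin

lemma G_group: "group G"
  using group_hom.axioms(1)[OF group_action.group_hom[OF action]] .

context
  fixes \<sigma> assumes \<sigma>: "\<sigma> \<in> carrier G"
begin

lemma phi_hom: "\<phi> \<sigma> \<in> ring_hom (subring_of K R) (subring_of K R)" "bij_betw (\<phi> \<sigma>) R R"
  using automorphisms \<sigma> by (auto simp: ring_iso_def)

lemma phi_closed: "x \<in> R \<Longrightarrow> \<phi> \<sigma> x \<in> R"
  and phi_mult: "\<lbrakk>x \<in> R; y \<in> R\<rbrakk> \<Longrightarrow> \<phi> \<sigma> (x \<otimes> y) = \<phi> \<sigma> x \<otimes> \<phi> \<sigma> y"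
  and phi_add: "\<lbrakk>x \<in> R; y \<in> R\<rbrakk> \<Longrightarrow> \<phi> \<sigma> (x \<oplus> y) = \<phi> \<sigma> x \<oplus> \<phi> \<sigma> y"
  and phi_one: "\<phi> \<sigma> \<one> = \<one>"
  using phi_hom(1) by (auto simp: ring_hom_def Pi_def)

lemma phi_carrier: "x \<in> R \<Longrightarrow> \<phi> \<sigma> x \<in> carrier K"
  using phi_closed R_carrier by blast

lemma phi_zero: "\<phi> \<sigma> \<zero> = \<zero>"
proof -
  have z: "\<zero> \<in> R" by (rule subringE(2)[OF R_subring])
  have "\<phi> \<sigma> \<zero> \<oplus> \<phi> \<sigma> \<zero> = \<phi> \<sigma> \<zero>" using phi_add[OF z z] by simp
  then show ?thesis using phi_carrier[OF z] by (metis add.r_cancel_one')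
qed

lemma phi_nonzero: "x \<in> Rx \<Longrightarrow> \<phi> \<sigma> x \<in> Rx"
  using phi_closed[of x] phi_zero phi_hom(2) subringE(2)[OF R_subring]
    inj_onD[of "\<phi> \<sigma>" R x \<zero>]
  by (auto simp: bij_betw_def)

lemma phi_minus:
  assumes x: "x \<in> R" shows "\<phi> \<sigma> (\<ominus> x) = \<ominus> \<phi> \<sigma> x"
proof -
  have mx: "\<ominus> x \<in> R" by (rule subringE(5)[OF R_subring x])
  have "\<phi> \<sigma> (\<ominus> x) \<oplus> \<phi> \<sigma> x = \<phi> \<sigma> (\<ominus> x \<oplus> x)" using phi_add[OF mx x] by simp
  also have "\<dots> = \<zero>" using R_carrier[OF x] phi_zero by (simp add: l_neg)
  finally show ?thesis using minus_equality phi_carrier[OF mx] phi_carrier[OF x] by metis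
qed

lemma phi_Units:
  assumes u: "u \<in> Units (subring_of K R)"
  shows "\<phi> \<sigma> u \<in> Units (subring_of K R)" "\<phi> \<sigma> (inv u) = inv (\<phi> \<sigma> u)"
proof -
  have u': "u \<in> Rx" "inv u \<in> R" using u by (auto simp: subring_Units[OF R_subring])
  have uc: "u \<in> carrier K" "u \<noteq> \<zero>" using u' R_carrier by auto
  have "\<phi> \<sigma> u \<otimes> \<phi> \<sigma> (inv u) = \<phi> \<sigma> (u \<otimes> inv u)" using phi_mult[of u "inv u"] u' by simp
  then have 1: "\<phi> \<sigma> u \<otimes> \<phi> \<sigma> (inv u) = \<one>" using nonzero_inv(3)[OF uc] phi_one by simp
  show i: "\<phi> \<sigma> (inv u) = inv (\<phi> \<sigma> u)"
    using comm_inv_char[OF _ _ 1] phi_carrier u' by auto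
  show "\<phi> \<sigma> u \<in> Units (subring_of K R)"
    using phi_nonzero[OF u'(1)] phi_closed[OF u'(2)] i by (auto simp: subring_Units[OF R_subring])
qed

end

lemma phi_comp:
  "\<lbrakk>\<sigma> \<in> carrier G; \<tau> \<in> carrier G; x \<in> R\<rbrakk> \<Longrightarrow> \<phi> (\<sigma> \<otimes>\<^bsub>G\<^esub> \<tau>) x = \<phi> \<sigma> (\<phi> \<tau> x)"
  using group_action.composition_rule[OF action] by blast

abbreviation "A \<equiv> fixed_ring R G \<phi>"

lemma fixed_subring: "subring A K"
proof (rule subringI)
  show "A \<subseteq> carrier K" using R_carrier by (auto simp: fixed_ring_def)
  show "\<one> \<in> A" using subringE(3)[OF R_subring] phi_one by (auto simp: fixed_ring_def)
  show "\<ominus> x \<in> A" if "x \<in> A" for x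
    using that subringE(5)[OF R_subring, of x] phi_minus by (auto simp: fixed_ring_def)
  show "x \<otimes> y \<in> A" if "x \<in> A" "y \<in> A" for x y
    using that subringE(6)[OF R_subring, of x y] phi_mult by (auto simp: fixed_ring_def)
  show "x \<oplus> y \<in> A" if "x \<in> A" "y \<in> A" for x y
    using that subringE(7)[OF R_subring, of x y] phi_add by (auto simp: fixed_ring_def)
qed

sublocale krull_extension K R A
proof (intro krull_extension.intro krull_extension_axioms.intro krull_field_axioms)
  show "subring A K" by (rule fixed_subring)
  show "A \<subseteq> R" by (auto simp: fixed_ring_def)
  show "R \<inter> fractions K A \<subseteq> A"
  proof
    fix x assume "x \<in> R \<inter> fractions K A"
    then obtain b where b: "x \<in> R" "b \<in> A - {\<zero>}" "x \<otimes> b \<in> A"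
      using fractions_iff[OF fixed_subring] by auto
    have bR: "b \<in> R" "b \<in> carrier K" using b R_carrier by (auto simp: fixed_ring_def)
    have "\<phi> \<sigma> x = x" if s: "\<sigma> \<in> carrier G" for \<sigma>
    proof -
      have "\<phi> \<sigma> x \<otimes> b = \<phi> \<sigma> (x \<otimes> b)" using phi_mult[OF s b(1) bR(1)] b(2) s by (auto simp: fixed_ring_def)
      also have "\<dots> = x \<otimes> b" using b(3) s by (auto simp: fixed_ring_def)
      finally show ?thesis using phi_carrier[OF s b(1)] R_carrier[OF b(1)] bR b(2)
        by (subst (asm) m_rcancel) auto
    qed
    then show "x \<in> A" using b(1) by (auto simp: fixed_ring_def)
  qed
qed

lemma fraction_rep:
  assumes "h \<in> carrier K"
  obtains a b where "a \<in> R" "b \<in> Rx" "h = a \<otimes> inv b"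
  using assms fractions_R that unfolding fractions_def by blast

abbreviation ext :: "'g \<Rightarrow> 'a \<Rightarrow> 'a"
  where "ext \<sigma> \<equiv> frac_ext K R (\<phi> \<sigma>)"

context
  fixes \<sigma> assumes \<sigma>: "\<sigma> \<in> carrier G"
begin

lemma ext_fraction:
  assumes a: "a \<in> R" and b: "b \<in> Rx"
  shows "ext \<sigma> (a \<otimes> inv b) = \<phi> \<sigma> a \<otimes> inv (\<phi> \<sigma> b)"
  unfolding frac_ext_def
proof (rule the_equality)
  show "\<exists>a'\<in>R. \<exists>b'\<in>Rx. a \<otimes> inv b = a' \<otimes> inv b' \<and> \<phi> \<sigma> a \<otimes> inv (\<phi> \<sigma> b) = \<phi> \<sigma> a' \<otimes> inv (\<phi> \<sigma> b')"
    using a b by blast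
  fix y assume "\<exists>a'\<in>R. \<exists>b'\<in>Rx. a \<otimes> inv b = a' \<otimes> inv b' \<and> y = \<phi> \<sigma> a' \<otimes> inv (\<phi> \<sigma> b')"
  then obtain c d where c: "c \<in> R" and d: "d \<in> Rx" and e: "a \<otimes> inv b = c \<otimes> inv d"
    and y: "y = \<phi> \<sigma> c \<otimes> inv (\<phi> \<sigma> d)" by blast
  have eq_iff: "p \<otimes> inv q = r \<otimes> inv s \<longleftrightarrow> p \<otimes> s = r \<otimes> q"
    if "p \<in> R" "q \<in> Rx" "r \<in> R" "s \<in> Rx" for p q r s
  proof -
    have k: "p \<in> carrier K" "q \<in> nz" "r \<in> carrier K" "s \<in> nz"
      using that R_carrier by auto
    have i: "inv q \<in> carrier K" "inv s \<in> carrier K" using k by auto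
    have "p \<otimes> inv q = r \<otimes> inv s \<longleftrightarrow> p \<otimes> inv q \<otimes> s = r"
      using mult_eq_iff_eq_mult_inv[of "p \<otimes> inv q" r s] k i by simp
    also have "p \<otimes> inv q \<otimes> s = (p \<otimes> s) \<otimes> inv q" using k i by (simp add: m_ac)
    also have "(p \<otimes> s) \<otimes> inv q = r \<longleftrightarrow> p \<otimes> s = r \<otimes> q"
      using mult_eq_iff_eq_mult_inv[of r "p \<otimes> s" q] k by auto
    finally show ?thesis .
  qed
  have "a \<otimes> d = c \<otimes> b" using eq_iff[OF a b c d] e by simp
  then have "\<phi> \<sigma> a \<otimes> \<phi> \<sigma> d = \<phi> \<sigma> c \<otimes> \<phi> \<sigma> b"
    using phi_mult[OF \<sigma>] a b c d by (metis DiffD1)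
  then show "y = \<phi> \<sigma> a \<otimes> inv (\<phi> \<sigma> b)"
    unfolding y using eq_iff[OF phi_closed[OF \<sigma> a] phi_nonzero[OF \<sigma> b] phi_closed[OF \<sigma> c] phi_nonzero[OF \<sigma> d]] by simp
qed

lemma ext_R:
  assumes x: "x \<in> R" shows "ext \<sigma> x = \<phi> \<sigma> x"
proof -
  have "\<one> \<in> Rx" using subringE(3)[OF R_subring] by auto
  from ext_fraction[OF x this] show ?thesis using phi_one[OF \<sigma>] phi_carrier[OF \<sigma> x] R_carrier[OF x] by simp
qed

lemma ext_closed:
  assumes "x \<in> carrier K" shows "ext \<sigma> x \<in> carrier K"
proof -
  obtain a b where ab: "a \<in> R" "b \<in> Rx" "x = a \<otimes> inv b" using fraction_rep[OF assms] .
  have "\<phi> \<sigma> a \<in> carrier K" "\<phi> \<sigma> b \<in> nz"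
    using phi_closed[OF \<sigma> ab(1)] phi_nonzero[OF \<sigma> ab(2)] R_carrier by auto
  then show ?thesis using ext_fraction[OF ab(1,2)] ab(3) by simp
qed

lemma ext_mult:
  assumes x: "x \<in> carrier K" and y: "y \<in> carrier K"
  shows "ext \<sigma> (x \<otimes> y) = ext \<sigma> x \<otimes> ext \<sigma> y"
proof -
  obtain a b where ab: "a \<in> R" "b \<in> Rx" "x = a \<otimes> inv b" using fraction_rep[OF x] .
  obtain c d where cd: "c \<in> R" "d \<in> Rx" "y = c \<otimes> inv d" using fraction_rep[OF y] .
  have k: "a \<in> carrier K" "b \<in> nz" "c \<in> carrier K" "d \<in> nz"
    using ab cd R_carrier by auto
  have k': "\<phi> \<sigma> a \<in> carrier K" "\<phi> \<sigma> b \<in> nz" "\<phi> \<sigma> c \<in> carrier K" "\<phi> \<sigma> d \<in> nz"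
    using phi_closed[OF \<sigma> ab(1)] phi_nonzero[OF \<sigma> ab(2)] phi_closed[OF \<sigma> cd(1)] phi_nonzero[OF \<sigma> cd(2)] R_carrier by auto
  have ac: "a \<otimes> c \<in> R" using subringE(6)[OF R_subring ab(1) cd(1)] .
  have bd: "b \<otimes> d \<in> Rx" using subringE(6)[OF R_subring, of b d] ab cd nonzero_mult_closed[OF k(2,4)] by auto
  have "x \<otimes> y = (a \<otimes> c) \<otimes> inv (b \<otimes> d)"
    unfolding ab(3) cd(3) inv_mult_distrib[OF k(2,4)] using k by (intro mult_swap) auto
  then have "ext \<sigma> (x \<otimes> y) = \<phi> \<sigma> (a \<otimes> c) \<otimes> inv (\<phi> \<sigma> (b \<otimes> d))" using ext_fraction[OF ac bd] by simp
  also have "\<dots> = (\<phi> \<sigma> a \<otimes> \<phi> \<sigma> c) \<otimes> (inv (\<phi> \<sigma> b) \<otimes> inv (\<phi> \<sigma> d))"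
    using phi_mult[OF \<sigma> ab(1) cd(1)] phi_mult[OF \<sigma>, of b d] ab(2) cd(2) inv_mult_distrib[OF k'(2,4)] by simp
  also have "\<dots> = (\<phi> \<sigma> a \<otimes> inv (\<phi> \<sigma> b)) \<otimes> (\<phi> \<sigma> c \<otimes> inv (\<phi> \<sigma> d))"
    using k' by (intro mult_swap) auto
  finally show ?thesis using ext_fraction[OF ab(1,2)] ext_fraction[OF cd(1,2)] ab(3) cd(3) by simp
qed

lemma ext_one: "ext \<sigma> \<one> = \<one>"
  using ext_R[OF subringE(3)[OF R_subring]] phi_one[OF \<sigma>] by simp

lemma ext_nonzero:
  assumes x: "x \<in> nz"
  shows "ext \<sigma> x \<in> nz"
proof -
  have xc: "x \<in> carrier K" "inv x \<in> carrier K" "x \<otimes> inv x = \<one>" using x by auto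
  have "ext \<sigma> x \<otimes> ext \<sigma> (inv x) = \<one>" using ext_mult[OF xc(1,2)] xc(3) ext_one by simp
  then have "ext \<sigma> x \<noteq> \<zero>" using ext_closed[OF xc(2)] by auto
  then show ?thesis using ext_closed[OF xc(1)] by simp
qed

lemma ext_inv:
  assumes x: "x \<in> nz"
  shows "ext \<sigma> (inv x) = inv (ext \<sigma> x)"
proof -
  have xc: "x \<in> carrier K" "inv x \<in> carrier K" "x \<otimes> inv x = \<one>" using x by auto
  have "ext \<sigma> x \<otimes> ext \<sigma> (inv x) = \<one>" using ext_mult[OF xc(1,2)] xc(3) ext_one by simp
  then show ?thesis using comm_inv_char[OF ext_closed[OF xc(1)] ext_closed[OF xc(2)]] by simp
qed

end

lemma ext_comp:
  assumes s: "\<sigma> \<in> carrier G" and t: "\<tau> \<in> carrier G" and x: "x \<in> carrier K"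
  shows "ext (\<sigma> \<otimes>\<^bsub>G\<^esub> \<tau>) x = ext \<sigma> (ext \<tau> x)"
proof -
  obtain a b where ab: "a \<in> R" "b \<in> Rx" "x = a \<otimes> inv b" using fraction_rep[OF x] .
  have st: "\<sigma> \<otimes>\<^bsub>G\<^esub> \<tau> \<in> carrier G" using G_group s t by (simp add: group.is_monoid monoid.m_closed)
  show ?thesis
    unfolding ab(3) ext_fraction[OF st ab(1,2)] ext_fraction[OF t ab(1,2)]
      ext_fraction[OF s phi_closed[OF t ab(1)] phi_nonzero[OF t ab(2)]]
    using phi_comp[OF s t] ab by simp
qed

abbreviation "U \<equiv> Units (subring_of K R)"
abbreviation "B \<equiv> B1 K R G \<phi>"
abbreviation "H \<equiv> H1 K R G \<phi>"
abbreviation "Z_rk1 \<equiv> Z1_rank1 K R G \<phi>"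
abbreviation "Z \<equiv> Z1 K R G \<phi>"

lemma U_facts:
  shows "u \<in> U \<Longrightarrow> u \<in> carrier K" "u \<in> U \<Longrightarrow> u \<noteq> \<zero>" "u \<in> U \<Longrightarrow> inv u \<in> U" "u \<in> U \<Longrightarrow> u \<in> R"
    "\<one> \<in> U" "u \<in> U \<Longrightarrow> v \<in> U \<Longrightarrow> u \<otimes> v \<in> U"
proof -
  have I: "u \<in> U \<longleftrightarrow> u \<in> R \<and> u \<noteq> \<zero> \<and> inv u \<in> R" for u
    unfolding subring_Units[OF R_subring] by auto
  show 1: "u \<in> U \<Longrightarrow> u \<in> carrier K" "u \<in> U \<Longrightarrow> u \<noteq> \<zero>" "u \<in> U \<Longrightarrow> u \<in> R" for u
    using R_carrier unfolding I by auto
  show "inv u \<in> U" if "u \<in> U" for u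
    using 1[OF that] that unfolding I by simp
  show "\<one> \<in> U" unfolding I using subringE(3)[OF R_subring] by simp
  show "u \<otimes> v \<in> U" if "u \<in> U" "v \<in> U" for u v
    using that 1(1,2)[OF that(1)] 1(1,2)[OF that(2)] mult_nonzero[of u v] inv_mult_distrib[of u v]
      subringE(6)[OF R_subring] unfolding I by simp
qed

lemma Z1_carrier_iff:
  "\<chi> \<in> carrier Z \<longleftrightarrow> \<chi> \<in> carrier G \<rightarrow>\<^sub>E U \<and>
    (\<forall>\<sigma>\<in>carrier G. \<forall>\<tau>\<in>carrier G. \<chi> (\<sigma> \<otimes>\<^bsub>G\<^esub> \<tau>) = \<chi> \<sigma> \<otimes> \<phi> \<sigma> (\<chi> \<tau>))"
  by (auto simp: Z1_def)

lemma Z1_mult: "\<chi> \<otimes>\<^bsub>Z\<^esub> \<psi> = (\<lambda>\<sigma>\<in>carrier G. \<chi> \<sigma> \<otimes> \<psi> \<sigma>)"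
  and Z1_one: "\<one>\<^bsub>Z\<^esub> = (\<lambda>\<sigma>\<in>carrier G. \<one>)"
  by (simp_all add: Z1_def)

lemma Z1_val: "\<chi> \<in> carrier Z \<Longrightarrow> \<sigma> \<in> carrier G \<Longrightarrow> \<chi> \<sigma> \<in> U"
  by (auto simp: Z1_carrier_iff)

lemma G_mult_closed: "\<sigma> \<in> carrier G \<Longrightarrow> \<tau> \<in> carrier G \<Longrightarrow> \<sigma> \<otimes>\<^bsub>G\<^esub> \<tau> \<in> carrier G"
  using G_group by (simp add: group.is_monoid monoid.m_closed)

lemma Z1_group: "comm_group Z"
proof (rule comm_groupI)
  fix \<chi> \<psi> assume c: "\<chi> \<in> carrier Z" and p: "\<psi> \<in> carrier Z"
  show cl: "\<chi> \<otimes>\<^bsub>Z\<^esub> \<psi> \<in> carrier Z"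
    unfolding Z1_carrier_iff Z1_mult
  proof (intro conjI ballI)
    show "(\<lambda>\<sigma>\<in>carrier G. \<chi> \<sigma> \<otimes> \<psi> \<sigma>) \<in> carrier G \<rightarrow>\<^sub>E U" using Z1_val[OF c] Z1_val[OF p] U_facts(6) by auto
    fix \<sigma> \<tau> assume s: "\<sigma> \<in> carrier G" and t: "\<tau> \<in> carrier G"
    note u = Z1_val[OF c s] Z1_val[OF p s] phi_Units(1)[OF s Z1_val[OF c t]] phi_Units(1)[OF s Z1_val[OF p t]]
    have "\<chi> (\<sigma> \<otimes>\<^bsub>G\<^esub> \<tau>) \<otimes> \<psi> (\<sigma> \<otimes>\<^bsub>G\<^esub> \<tau>) = (\<chi> \<sigma> \<otimes> \<phi> \<sigma> (\<chi> \<tau>)) \<otimes> (\<psi> \<sigma> \<otimes> \<phi> \<sigma> (\<psi> \<tau>))"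
      using c p s t unfolding Z1_carrier_iff by metis
    also have "\<dots> = (\<chi> \<sigma> \<otimes> \<psi> \<sigma>) \<otimes> (\<phi> \<sigma> (\<chi> \<tau>) \<otimes> \<phi> \<sigma> (\<psi> \<tau>))"
      using u[THEN U_facts(1)] by (intro mult_swap) auto
    also have "\<phi> \<sigma> (\<chi> \<tau>) \<otimes> \<phi> \<sigma> (\<psi> \<tau>) = \<phi> \<sigma> (\<chi> \<tau> \<otimes> \<psi> \<tau>)"
      using phi_mult[OF s] Z1_val[OF c t] Z1_val[OF p t] U_facts(4) by simp
    finally show "(\<lambda>\<sigma>\<in>carrier G. \<chi> \<sigma> \<otimes> \<psi> \<sigma>) (\<sigma> \<otimes>\<^bsub>G\<^esub> \<tau>) = (\<lambda>\<sigma>\<in>carrier G. \<chi> \<sigma> \<otimes> \<psi> \<sigma>) \<sigma> \<otimes> \<phi> \<sigma> ((\<lambda>\<sigma>\<in>carrier G. \<chi> \<sigma> \<otimes> \<psi> \<sigma>) \<tau>)"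
      using s t G_mult_closed by simp
  qed
  show "\<chi> \<otimes>\<^bsub>Z\<^esub> \<psi> = \<psi> \<otimes>\<^bsub>Z\<^esub> \<chi>"
    unfolding Z1_mult using Z1_val[OF c] Z1_val[OF p] U_facts(1) m_comm by (intro restrict_ext) blast
  fix \<theta> assume t: "\<theta> \<in> carrier Z"
  show "\<chi> \<otimes>\<^bsub>Z\<^esub> \<psi> \<otimes>\<^bsub>Z\<^esub> \<theta> = \<chi> \<otimes>\<^bsub>Z\<^esub> (\<psi> \<otimes>\<^bsub>Z\<^esub> \<theta>)"
    unfolding Z1_mult using Z1_val[OF c] Z1_val[OF p] Z1_val[OF t] U_facts(1) m_assoc by (intro restrict_ext) simp
next
  show one: "\<one>\<^bsub>Z\<^esub> \<in> carrier Z"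
    unfolding Z1_carrier_iff Z1_one using U_facts(5) G_mult_closed phi_one by auto
  fix \<chi> assume c: "\<chi> \<in> carrier Z"
  have "(\<lambda>\<sigma>\<in>carrier G. \<one> \<otimes> \<chi> \<sigma>) = \<chi>"
    using Z1_val[OF c] U_facts(1) c unfolding Z1_carrier_iff by (intro ext) (auto simp: restrict_def PiE_def extensional_def)
  then show "\<one>\<^bsub>Z\<^esub> \<otimes>\<^bsub>Z\<^esub> \<chi> = \<chi>" unfolding Z1_mult Z1_one by (simp cong: restrict_cong)
  let ?i = "\<lambda>\<sigma>\<in>carrier G. inv (\<chi> \<sigma>)"
  have "?i \<in> carrier Z"
    unfolding Z1_carrier_iff
  proof (intro conjI ballI)
    show "?i \<in> carrier G \<rightarrow>\<^sub>E U" using Z1_val[OF c] U_facts(3) by auto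
    fix \<sigma> \<tau> assume s: "\<sigma> \<in> carrier G" and t: "\<tau> \<in> carrier G"
    note u = Z1_val[OF c s] phi_Units(1)[OF s Z1_val[OF c t]]
    have "\<chi> (\<sigma> \<otimes>\<^bsub>G\<^esub> \<tau>) = \<chi> \<sigma> \<otimes> \<phi> \<sigma> (\<chi> \<tau>)" using c s t unfolding Z1_carrier_iff by blast
    then have "inv (\<chi> (\<sigma> \<otimes>\<^bsub>G\<^esub> \<tau>)) = inv (\<chi> \<sigma>) \<otimes> inv (\<phi> \<sigma> (\<chi> \<tau>))"
      using inv_mult_distrib[of "\<chi> \<sigma>" "\<phi> \<sigma> (\<chi> \<tau>)"] U_facts(1,2)[OF u(1)] U_facts(1,2)[OF u(2)] by simp
    then show "?i (\<sigma> \<otimes>\<^bsub>G\<^esub> \<tau>) = ?i \<sigma> \<otimes> \<phi> \<sigma> (?i \<tau>)"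
      using s t G_mult_closed phi_Units(2)[OF s Z1_val[OF c t]] by simp
  qed
  moreover have "?i \<otimes>\<^bsub>Z\<^esub> \<chi> = \<one>\<^bsub>Z\<^esub>"
    unfolding Z1_mult Z1_one using Z1_val[OF c] U_facts(1,2) by (intro restrict_ext) simp
  ultimately show "\<exists>\<psi>\<in>carrier Z. \<psi> \<otimes>\<^bsub>Z\<^esub> \<chi> = \<one>\<^bsub>Z\<^esub>" by blast
qed

lemma Z1_is_group: "group Z"
  using Z1_group by (rule comm_group.axioms(2))

lemma Z1_pow_closed: "\<chi> \<in> carrier Z \<Longrightarrow> \<chi> [^]\<^bsub>Z\<^esub> (n::nat) \<in> carrier Z"
  using Z1_is_group by (simp add: group.is_monoid monoid.nat_pow_closed)

lemma Z1_pow: "\<sigma> \<in> carrier G \<Longrightarrow> (\<chi> [^]\<^bsub>Z\<^esub> (n::nat)) \<sigma> = \<chi> \<sigma> [^] n"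
proof (induction n)
  case 0
  then show ?case by (simp add: Z1_one)
next
  case (Suc n)
  then show ?case by (simp add: Z1_mult)
qed

definition cocycle :: "'a \<Rightarrow> 'g \<Rightarrow> 'a"
  where "cocycle h = (\<lambda>\<sigma>\<in>carrier G. ext \<sigma> h \<otimes> inv h)"

lemma cocycle_closed:
  assumes h: "h \<in> nz" and u: "\<And>\<sigma>. \<sigma> \<in> carrier G \<Longrightarrow> ext \<sigma> h \<otimes> inv h \<in> U"
  shows "cocycle h \<in> carrier Z"
  unfolding Z1_carrier_iff
proof (intro conjI ballI)
  show "cocycle h \<in> carrier G \<rightarrow>\<^sub>E U" using u by (auto simp: cocycle_def)
  fix \<sigma> \<tau> assume s: "\<sigma> \<in> carrier G" and t: "\<tau> \<in> carrier G"
  have hc: "h \<in> carrier K" "h \<noteq> \<zero>" "inv h \<in> carrier K" using h by auto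
  note es = ext_nonzero[OF s h] and et = ext_nonzero[OF t h]
  have ets: "ext \<sigma> (ext \<tau> h) \<in> nz" by (rule ext_nonzero[OF s et])
  have "\<phi> \<sigma> (ext \<tau> h \<otimes> inv h) = ext \<sigma> (ext \<tau> h \<otimes> inv h)" using ext_R[OF s U_facts(4)[OF u[OF t]]] by simp
  also have "\<dots> = ext \<sigma> (ext \<tau> h) \<otimes> inv (ext \<sigma> h)"
    using ext_mult[OF s, of "ext \<tau> h" "inv h"] et hc ext_inv[OF s h] by simp
  finally have "(ext \<sigma> h \<otimes> inv h) \<otimes> \<phi> \<sigma> (ext \<tau> h \<otimes> inv h) = (ext \<sigma> h \<otimes> inv h) \<otimes> (ext \<sigma> (ext \<tau> h) \<otimes> inv (ext \<sigma> h))" by simp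
  also have "\<dots> = (ext \<sigma> h \<otimes> inv h) \<otimes> (inv (ext \<sigma> h) \<otimes> ext \<sigma> (ext \<tau> h))"
    using es ets by (simp add: m_comm)
  also have "\<dots> = (ext \<sigma> h \<otimes> inv (ext \<sigma> h)) \<otimes> (inv h \<otimes> ext \<sigma> (ext \<tau> h))"
    using es ets hc by (intro mult_swap) auto
  also have "\<dots> = ext (\<sigma> \<otimes>\<^bsub>G\<^esub> \<tau>) h \<otimes> inv h"
    using es ets hc ext_comp[OF s t hc(1)] m_comm[of "inv h"] by simp
  finally show "cocycle h (\<sigma> \<otimes>\<^bsub>G\<^esub> \<tau>) = cocycle h \<sigma> \<otimes> \<phi> \<sigma> (cocycle h \<tau>)"
    unfolding cocycle_def using s t G_mult_closed by simp
qed

lemma cocycle_mult: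
  assumes h: "h \<in> nz" and k: "k \<in> nz"
  shows "cocycle (h \<otimes> k) = cocycle h \<otimes>\<^bsub>Z\<^esub> cocycle k"
  unfolding Z1_mult cocycle_def
proof (rule restrict_ext)
  fix \<sigma> assume s: "\<sigma> \<in> carrier G"
  have hc: "h \<in> carrier K" "inv h \<in> carrier K" "k \<in> carrier K" "inv k \<in> carrier K" using h k by auto
  have "ext \<sigma> (h \<otimes> k) \<otimes> inv (h \<otimes> k) = (ext \<sigma> h \<otimes> ext \<sigma> k) \<otimes> (inv h \<otimes> inv k)"
    using ext_mult[OF s hc(1,3)] inv_mult_distrib[OF h k] by simp
  also have "\<dots> = (ext \<sigma> h \<otimes> inv h) \<otimes> (ext \<sigma> k \<otimes> inv k)"
    using hc ext_closed[OF s] by (intro mult_swap) auto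
  finally show "ext \<sigma> (h \<otimes> k) \<otimes> inv (h \<otimes> k) =
      (\<lambda>\<sigma>\<in>carrier G. ext \<sigma> h \<otimes> inv h) \<sigma> \<otimes> (\<lambda>\<sigma>\<in>carrier G. ext \<sigma> k \<otimes> inv k) \<sigma>" using s by simp
qed

lemma cocycle_one: "cocycle \<one> = \<one>\<^bsub>Z\<^esub>"
  unfolding cocycle_def Z1_one by (intro restrict_ext) (simp add: ext_one)

lemma cocycle_nat_pow:
  assumes h: "h \<in> nz"
  shows "cocycle (h [^] (n::nat)) = cocycle h [^]\<^bsub>Z\<^esub> n"
proof (induction n)
  case 0
  then show ?case by (simp add: cocycle_one)
next
  case (Suc n)
  then show ?case using cocycle_mult[OF nat_pow_nonzero[OF h, of n] h] by simp
qed

lemma cocycle_unit: "u \<in> U \<Longrightarrow> cocycle u \<in> carrier Z"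
  using U_facts ext_R phi_Units(1) by (intro cocycle_closed) auto

lemma B1_eq: "B = cocycle ` U"
proof -
  have "(\<lambda>\<sigma>\<in>carrier G. \<phi> \<sigma> u \<otimes> inv u) = cocycle u" if "u \<in> U" for u
    unfolding cocycle_def using ext_R U_facts(4)[OF that] by (intro restrict_ext) simp
  then have "(\<lambda>u. \<lambda>\<sigma>\<in>carrier G. \<phi> \<sigma> u \<otimes> inv u) ` U = cocycle ` U" by (intro image_cong) auto
  then show ?thesis unfolding B1_def by (simp only: Setcompr_eq_image)
qed

lemma B1_subgroup: "subgroup (B) Z"
proof (rule group.subgroupI[OF Z1_is_group])
  show "B \<subseteq> carrier Z" unfolding B1_eq using cocycle_unit by auto
  show "B \<noteq> {}" unfolding B1_eq using U_facts(5) by auto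
next
  fix a assume "a \<in> B"
  then obtain u where u: "u \<in> U" "a = cocycle u" unfolding B1_eq by auto
  have uc: "u \<in> nz" "inv u \<in> nz" "inv u \<otimes> u = \<one>" using U_facts(1,2)[OF u(1)] by auto
  have "cocycle (inv u) \<otimes>\<^bsub>Z\<^esub> cocycle u = \<one>\<^bsub>Z\<^esub>"
    using cocycle_mult[OF uc(2,1)] uc(3) cocycle_one by simp
  then have "inv\<^bsub>Z\<^esub> a = cocycle (inv u)"
    using group.inv_equality[OF Z1_is_group] cocycle_unit u U_facts(3) by metis
  then show "inv\<^bsub>Z\<^esub> a \<in> B" unfolding B1_eq using U_facts(3)[OF u(1)] by blast
  fix b assume "b \<in> B"
  then obtain v where v: "v \<in> U" "b = cocycle v" unfolding B1_eq by auto
  have "a \<otimes>\<^bsub>Z\<^esub> b = cocycle (u \<otimes> v)"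
    using cocycle_mult[of u v] U_facts(1,2)[OF u(1)] U_facts(1,2)[OF v(1)] u v by simp
  then show "a \<otimes>\<^bsub>Z\<^esub> b \<in> B" unfolding B1_eq using U_facts(6)[OF u(1) v(1)] by blast
qed

lemma B1_normal: "B \<lhd> Z"
  by (rule comm_group.subgroup_imp_normal[OF Z1_group B1_subgroup])

abbreviation "coh_cl \<equiv> coh K R G \<phi>"

lemma H1_group: "group (H1 K R G \<phi>)"
  unfolding H1_def by (rule normal.factorgroup_is_group[OF B1_normal])

lemma coh_hom: "group_hom Z (H1 K R G \<phi>) coh_cl"
proof -
  have "(\<lambda>a. B #>\<^bsub>Z\<^esub> a) \<in> hom Z (Z Mod B)"
    by (rule normal.r_coset_hom_Mod[OF B1_normal])
  then show ?thesis
    unfolding group_hom_def group_hom_axioms_def using Z1_is_group H1_group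
    by (simp add: H1_def coh_def[abs_def])
qed

lemma coh_eq_one_iff:
  assumes "\<chi> \<in> carrier Z"
  shows "coh_cl \<chi> = \<one>\<^bsub>H\<^esub> \<longleftrightarrow> \<chi> \<in> B"
  unfolding coh_def H1_def FactGroup_def
  using group.coset_join1[OF Z1_is_group _ assms B1_subgroup] group.coset_join2[OF Z1_is_group assms B1_subgroup]
  subgroup.subset[OF B1_subgroup] by auto

lemma divisor_of_eq_imp_unit:
  assumes h: "h \<in> nz" and k: "k \<in> nz" and eq: "divisor h = divisor k"
  obtains u where "u \<in> U" "k = u \<otimes> h"
proof -
  have ki: "k \<otimes> inv h \<in> nz" using nonzero_mult_closed[OF k nonzero_inv_closed[OF h]] .
  have "divisor (k \<otimes> inv h) = 0"
    using divisor_of_mult[OF k nonzero_inv_closed[OF h]] divisor_of_inv[OF h] eq by simp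
  then have "k \<otimes> inv h \<in> U" using divisor_of_eq_0_iff[OF ki] by simp
  moreover have "k = (k \<otimes> inv h) \<otimes> h"
    using mult_eq_iff_eq_mult_inv[of "k \<otimes> inv h" k h] h k ki by auto
  ultimately show thesis using that by blast
qed

lemma coh_div_eq:
  assumes h: "h \<in> nz" and c: "cocycle h \<in> carrier Z"
  shows "coh_div K R G \<phi> (divisor h) = coh_cl (cocycle h)"
  unfolding coh_div_def cocycle_def[symmetric]
proof (rule the_equality)
  show "\<exists>h'\<in>nz. divisor h = divisor h' \<and> coh_cl (cocycle h) = coh_cl (cocycle h')"
    using h by blast
  fix c' assume "\<exists>h'\<in>nz. divisor h = divisor h' \<and> c' = coh_cl (cocycle h')"
  then obtain h' where h': "h' \<in> nz" "divisor h = divisor h'" "c' = coh_cl (cocycle h')"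
    by blast
  obtain u where u: "u \<in> U" "h' = u \<otimes> h" using divisor_of_eq_imp_unit[OF h h'(1,2)] .
  interpret c: group_hom Z "H1 K R G \<phi>" coh_cl by (rule coh_hom)
  have "cocycle h' = cocycle u \<otimes>\<^bsub>Z\<^esub> cocycle h"
    using cocycle_mult[of u h] U_facts(1,2)[OF u(1)] h u(2) by simp
  moreover have "coh_cl (cocycle u) = \<one>\<^bsub>H\<^esub>"
    using coh_eq_one_iff[OF cocycle_unit[OF u(1)]] u(1) by (auto simp: B1_eq)
  ultimately show "c' = coh_cl (cocycle h)"
    using h'(3) c.hom_mult[OF cocycle_unit[OF u(1)] c] c.hom_closed[OF c] by simp
qed

abbreviation "SI \<equiv> semi_invariants K R G \<phi>"

lemma SI_carrier: "x \<in> SI \<chi> \<Longrightarrow> x \<in> carrier K"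
  using R_carrier by (auto simp: semi_invariants_def)

lemma SI_zero: "\<chi> \<in> carrier Z \<Longrightarrow> \<zero> \<in> SI \<chi>"
  using subringE(2)[OF R_subring] phi_zero Z1_val U_facts(1) by (auto simp: semi_invariants_def)

lemma SI_mult:
  assumes x: "x \<in> SI \<chi>" and y: "y \<in> SI \<psi>" and c: "\<chi> \<in> carrier Z" and p: "\<psi> \<in> carrier Z"
  shows "x \<otimes> y \<in> SI (\<chi> \<otimes>\<^bsub>Z\<^esub> \<psi>)"
proof -
  have xy: "x \<in> R" "y \<in> R" "x \<in> carrier K" "y \<in> carrier K"
    using x y R_carrier by (auto simp: semi_invariants_def)
  have "\<phi> \<sigma> (x \<otimes> y) = (\<chi> \<otimes>\<^bsub>Z\<^esub> \<psi>) \<sigma> \<otimes> (x \<otimes> y)" if s: "\<sigma> \<in> carrier G" for \<sigma>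
  proof -
    have "\<phi> \<sigma> (x \<otimes> y) = (\<chi> \<sigma> \<otimes> x) \<otimes> (\<psi> \<sigma> \<otimes> y)"
      using phi_mult[OF s xy(1,2)] x y s by (simp add: semi_invariants_def)
    also have "\<dots> = (\<chi> \<sigma> \<otimes> \<psi> \<sigma>) \<otimes> (x \<otimes> y)"
      using U_facts(1)[OF Z1_val[OF c s]] U_facts(1)[OF Z1_val[OF p s]] xy by (intro mult_swap) auto
    finally show ?thesis using s by (simp add: Z1_mult)
  qed
  then show ?thesis using subringE(6)[OF R_subring xy(1,2)] by (auto simp: semi_invariants_def)
qed

lemma SI_pow:
  assumes x: "x \<in> SI \<chi>" and c: "\<chi> \<in> carrier Z"
  shows "x [^] (n::nat) \<in> SI (\<chi> [^]\<^bsub>Z\<^esub> n)"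
proof (induction n)
  case 0
  then show ?case using subringE(3)[OF R_subring] phi_one by (auto simp: semi_invariants_def Z1_one)
next
  case (Suc n)
  then show ?case using SI_mult[OF Suc x Z1_pow_closed[OF c] c] by simp
qed

lemma SI_iff_cocycle:
  assumes h: "h \<in> Rx" and c: "\<chi> \<in> carrier Z"
  shows "h \<in> SI \<chi> \<longleftrightarrow> cocycle h = \<chi>"
proof -
  have hc: "h \<in> nz" using h R_carrier by auto
  have "h \<in> SI \<chi> \<longleftrightarrow> (\<forall>\<sigma>\<in>carrier G. \<chi> \<sigma> \<otimes> h = ext \<sigma> h)"
    using h ext_R by (auto simp: semi_invariants_def)
  also have "\<dots> \<longleftrightarrow> (\<forall>\<sigma>\<in>carrier G. cocycle h \<sigma> = \<chi> \<sigma>)"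
    using mult_eq_iff_eq_mult_inv[OF _ _ hc] ext_closed hc U_facts(1)[OF Z1_val[OF c]]
    by (force simp: cocycle_def)
  also have "\<dots> \<longleftrightarrow> cocycle h = \<chi>"
  proof
    assume e: "\<forall>\<sigma>\<in>carrier G. cocycle h \<sigma> = \<chi> \<sigma>"
    show "cocycle h = \<chi>"
    proof (rule extensionalityI)
      show "cocycle h \<in> extensional (carrier G)" by (simp add: cocycle_def)
      show "\<chi> \<in> extensional (carrier G)" using c by (auto simp: Z1_carrier_iff PiE_def)
    qed (use e in auto)
  qed auto
  finally show ?thesis .
qed

lemma A_eq_SI: "A = SI \<one>\<^bsub>Z\<^esub>"
  using R_carrier by (auto simp: fixed_ring_def semi_invariants_def Z1_one)

lemma SI_A_mult:
  assumes a: "a \<in> A" and x: "x \<in> SI \<chi>" and c: "\<chi> \<in> carrier Z"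
  shows "a \<otimes> x \<in> SI \<chi>"
proof -
  interpret Z: comm_group Z by (rule Z1_group)
  show ?thesis using SI_mult[of a "\<one>\<^bsub>Z\<^esub>" x \<chi>] assms by (simp add: A_eq_SI)
qed

end

section \<open>Semi-invariants of rank one\<close>

lemma has_dim_1_generator:
  assumes "has_dim Q V 1"
  obtains z where "z \<in> carrier V" "\<And>x. x \<in> carrier V \<Longrightarrow> \<exists>c\<in>carrier Q. x = c \<odot>\<^bsub>V\<^esub> z"
proof -
  interpret V: vectorspace Q V using assms by (simp add: has_dim_def)
  have fd: "V.fin_dim" "V.dim = 1" using assms by (simp_all add: has_dim_def)
  obtain B where B: "finite B" "V.basis B" using V.finite_basis_exists[OF fd(1)] by blast
  have "card B = 1" using V.dim_basis[OF B] fd(2) by simp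
  then obtain z where z: "B = {z}" by (rule card_1_singletonE)
  have zc: "z \<in> carrier V" and sp: "V.span {z} = carrier V" using B(2) by (auto simp: V.basis_def z)
  have "\<exists>c\<in>carrier Q. x = c \<odot>\<^bsub>V\<^esub> z" if "x \<in> carrier V" for x
  proof -
    have "x \<in> V.span {z}" using that sp by simp
    then obtain a where a: "a \<in> {z} \<rightarrow> carrier Q" "x = V.lincomb a {z}"
      using V.finite_span[of "{z}"] zc by auto
    then have "x = a z \<odot>\<^bsub>V\<^esub> z" using zc by (simp add: V.lincomb_def Pi_def)
    then show ?thesis using a(1) by auto
  qed
  then show thesis using that zc by blast
qed

context krull_action
begin

lemma rank1_generator:
  assumes "\<psi> \<in> Z_rk1"
  obtains k where "k \<in> carrier K" "\<And>f. f \<in> SI \<psi> \<Longrightarrow> \<exists>c\<in>F. f = c \<otimes> k"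
proof -
  define M where "M = SI \<psi>"
  have psi: "\<psi> \<in> carrier Z" using assms by (simp add: Z1_rank1_def Z1_nonzero_def)
  have Mc: "x \<in> carrier K" if "x \<in> M" for x using that SI_carrier by (simp add: M_def)
  let ?Fr = "free_Abelian_group (F \<times> M)"
  let ?N = "tensor_relations (subring_of K A) (subring_of K F) (module_in K M)"
  let ?V = "base_change (subring_of K A) (subring_of K F) (module_in K M)"
  have Nd: "?N = generate ?Fr
    ({frag_of (b \<oplus> b', x) - frag_of (b, x) - frag_of (b', x)
       | b b' x. b \<in> F \<and> b' \<in> F \<and> x \<in> M}
     \<union> {frag_of (b, x \<oplus> x') - frag_of (b, x) - frag_of (b, x')
       | b x x'. b \<in> F \<and> x \<in> M \<and> x' \<in> M}
     \<union> {frag_of (b \<otimes> a, x) - frag_of (b, a \<otimes> x)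
       | a b x. a \<in> A \<and> b \<in> F \<and> x \<in> M})" (is "_ = generate _ ?Gen")
    by (simp add: tensor_relations_def module_in_def)
  have Madd: "x \<oplus> x' \<in> M" if "x \<in> M" "x' \<in> M" for x x'
  proof -
    have r: "x \<in> R" "x' \<in> R" "x \<in> carrier K" "x' \<in> carrier K"
      using that R_carrier by (auto simp: M_def semi_invariants_def)
    have "\<phi> \<sigma> (x \<oplus> x') = \<psi> \<sigma> \<otimes> (x \<oplus> x')" if s: "\<sigma> \<in> carrier G" for \<sigma>
      using phi_add[OF s r(1,2)] \<open>x \<in> M\<close> \<open>x' \<in> M\<close> s r_distr[OF r(3,4) U_facts(1)[OF Z1_val[OF psi s]]]
      by (simp add: M_def semi_invariants_def)
    then show ?thesis using subringE(7)[OF R_subring r(1,2)] by (auto simp: M_def semi_invariants_def)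
  qed
  have Msm: "a \<otimes> x \<in> M" if "a \<in> A" "x \<in> M" for a x
    using SI_A_mult[OF that(1) _ psi] that(2) by (simp add: M_def)
  note Fadd = subringE(7)[OF subfieldE(1)[OF F_subfield]]
  note Fmul = subringE(6)[OF subfieldE(1)[OF F_subfield]]
  have keys3: "Poly_Mapping.keys (frag_of p - frag_of q - frag_of r) \<subseteq> S" if "p \<in> S" "q \<in> S" "r \<in> S"
    for p q r and S :: "('a \<times> 'a) set"
    using that keys_diff[of "frag_of p - frag_of q" "frag_of r"] keys_diff[of "frag_of p" "frag_of q"]
    by (auto simp: keys_frag_of)
  have keys2: "Poly_Mapping.keys (frag_of p - frag_of q) \<subseteq> S" if "p \<in> S" "q \<in> S"
    for p q and S :: "('a \<times> 'a) set"
    using that keys_diff[of "frag_of p" "frag_of q"] by (auto simp: keys_frag_of)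
  have im: "(\<lambda>p. fst p \<otimes> snd p) ` (F \<times> M) \<subseteq> carrier (add_monoid K)" using F_carrier Mc by auto
  obtain \<mu> where mu: "\<mu> \<in> hom ?Fr (add_monoid K)" "\<And>p. p \<in> F \<times> M \<Longrightarrow> \<mu> (frag_of p) = fst p \<otimes> snd p"
    using comm_group.free_Abelian_group_universal[OF a_comm_group im] by blast
  interpret mu: group_hom ?Fr "add_monoid K" \<mu>
    unfolding group_hom_def group_hom_axioms_def using mu(1) a_group by simp
  have mu_closed: "\<mu> z \<in> carrier K" if "z \<in> carrier ?Fr" for z using mu.hom_closed[OF that] by simp
  have mu_add: "\<mu> (y + z) = \<mu> y \<oplus> \<mu> z" if "y \<in> carrier ?Fr" "z \<in> carrier ?Fr" for y z
    using mu.hom_mult[OF that] by simp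
  have mu_diff: "\<mu> (y - z) = \<mu> y \<oplus> \<ominus> \<mu> z" if "y \<in> carrier ?Fr" "z \<in> carrier ?Fr" for y z
  proof -
    have yz: "y - z \<in> carrier ?Fr" using that keys_diff[of y z] by auto
    have "\<mu> y = \<mu> (y - z) \<oplus> \<mu> z" using mu_add[OF yz that(2)] by simp
    then show ?thesis using mu_closed[OF yz] mu_closed[OF that(2)] by (simp add: a_assoc r_neg)
  qed
  have mu_p: "\<mu> (frag_of (b, x)) = b \<otimes> x" if "b \<in> F" "x \<in> M" for b x using mu(2)[of "(b, x)"] that by simp
  have fr: "frag_of (b, x) \<in> carrier ?Fr" if "b \<in> F" "x \<in> M" for b x using that by simp
  have frd: "frag_of (b, x) - frag_of (c, y) \<in> carrier ?Fr" if "b \<in> F" "x \<in> M" "c \<in> F" "y \<in> M" for b x c y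
    using keys2[of "(b,x)" "F \<times> M" "(c,y)"] that by simp
  have z3: "(p \<oplus> q) \<oplus> \<ominus> p \<oplus> \<ominus> q = \<zero>" if "p \<in> carrier K" "q \<in> carrier K" for p q
  proof -
    have "(p \<oplus> q) \<oplus> \<ominus> p \<oplus> \<ominus> q = (p \<oplus> \<ominus> p) \<oplus> (q \<oplus> \<ominus> q)" using that by (simp add: a_ac)
    then show ?thesis using that by (simp add: r_neg)
  qed
  have gen: "g \<in> carrier ?Fr \<and> \<mu> g = \<zero>" if "g \<in> ?Gen" for g
  proof -
    from that consider
      (1) b b' x where "g = frag_of (b \<oplus> b', x) - frag_of (b, x) - frag_of (b', x)" "b \<in> F" "b' \<in> F" "x \<in> M"
    | (2) b x x' where "g = frag_of (b, x \<oplus> x') - frag_of (b, x) - frag_of (b, x')" "b \<in> F" "x \<in> M" "x' \<in> M"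
    | (3) a b x where "g = frag_of (b \<otimes> a, x) - frag_of (b, a \<otimes> x)" "a \<in> A" "b \<in> F" "x \<in> M"
      by blast
    then have "Poly_Mapping.keys g \<subseteq> F \<times> M \<and> \<mu> g = \<zero>"
    proof cases
      case 1
      have k: "b \<in> carrier K" "b' \<in> carrier K" "x \<in> carrier K" using 1 F_carrier Mc by auto
      have "\<mu> g = (b \<oplus> b') \<otimes> x \<oplus> \<ominus> (b \<otimes> x) \<oplus> \<ominus> (b' \<otimes> x)"
        unfolding 1(1) using 1(2-4) Fadd by (simp add: mu_diff mu_p frd fr del: carrier_free_Abelian_group_iff)
      moreover have "Poly_Mapping.keys g \<subseteq> F \<times> M" unfolding 1(1) using 1 Fadd by (intro keys3) auto
      ultimately show ?thesis using k by (simp add: l_distr z3)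
    next
      case 2
      have k: "b \<in> carrier K" "x' \<in> carrier K" "x \<in> carrier K" using 2 F_carrier Mc by auto
      have "\<mu> g = b \<otimes> (x \<oplus> x') \<oplus> \<ominus> (b \<otimes> x) \<oplus> \<ominus> (b \<otimes> x')"
        unfolding 2(1) using 2(2-4) Madd by (simp add: mu_diff mu_p frd fr del: carrier_free_Abelian_group_iff)
      moreover have "Poly_Mapping.keys g \<subseteq> F \<times> M" unfolding 2(1) using 2 Madd by (intro keys3) auto
      ultimately show ?thesis using k by (simp add: r_distr z3)
    next
      case 3
      have k: "b \<in> carrier K" "a \<in> carrier K" "x \<in> carrier K" using 3 F_carrier A_carrier Mc by auto
      have "\<mu> g = (b \<otimes> a) \<otimes> x \<oplus> \<ominus> (b \<otimes> (a \<otimes> x))"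
        unfolding 3(1) using 3(2-4) Fmul A_F Msm by (simp add: mu_diff mu_p fr del: carrier_free_Abelian_group_iff)
      moreover have "Poly_Mapping.keys g \<subseteq> F \<times> M" unfolding 3(1) using 3 Fmul A_F Msm by (intro keys2) auto
      ultimately show ?thesis using k by (simp add: m_assoc r_neg)
    qed
    then show ?thesis by simp
  qed
  have Gen: "?Gen \<subseteq> carrier ?Fr" using gen by blast
  have Nsub: "subgroup ?N ?Fr" unfolding Nd by (rule group.generate_is_subgroup[OF _ Gen]) simp
  have "?Gen \<subseteq> kernel ?Fr (add_monoid K) \<mu>" using gen unfolding kernel_def by auto
  then have "?N \<subseteq> kernel ?Fr (add_monoid K) \<mu>"
    unfolding Nd using group.generate_subgroup_incl[OF _ _ mu.subgroup_kernel] by simp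
  then have muN: "\<mu> n = \<zero>" if "n \<in> ?N" for n using that by (auto simp: kernel_def)
  have Nc: "n \<in> carrier ?Fr" if "n \<in> ?N" for n using subgroup.mem_carrier[OF Nsub that] .
  let ?g = "\<lambda>c. frag_extend (\<lambda>(b, x). frag_of (c \<otimes> b, x))"
  have scal: "?g c z \<in> carrier ?Fr \<and> \<mu> (?g c z) = c \<otimes> \<mu> z" if c: "c \<in> F" and z: "z \<in> carrier ?Fr" for c z
  proof -
    have cK: "c \<in> carrier K" using c F_carrier by auto
    have "z \<in> carrier ?Fr \<and> ?g c z \<in> carrier ?Fr \<and> \<mu> (?g c z) = c \<otimes> \<mu> z"
    proof (rule free_Abelian_group_induct[of z "F \<times> M"])
      show "Poly_Mapping.keys z \<subseteq> F \<times> M" using z by simp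
      show "0 \<in> carrier ?Fr \<and> ?g c 0 \<in> carrier ?Fr \<and> \<mu> (?g c 0) = c \<otimes> \<mu> 0"
        using mu.hom_one cK by simp
    next
      fix x y assume "x \<in> carrier ?Fr \<and> ?g c x \<in> carrier ?Fr \<and> \<mu> (?g c x) = c \<otimes> \<mu> x"
        "y \<in> carrier ?Fr \<and> ?g c y \<in> carrier ?Fr \<and> \<mu> (?g c y) = c \<otimes> \<mu> y"
      then have h: "x \<in> carrier ?Fr" "?g c x \<in> carrier ?Fr" "\<mu> (?g c x) = c \<otimes> \<mu> x"
        "y \<in> carrier ?Fr" "?g c y \<in> carrier ?Fr" "\<mu> (?g c y) = c \<otimes> \<mu> y" by blast+
      have d: "?g c (x - y) = ?g c x - ?g c y" by (rule frag_extend_diff)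
      have "x - y \<in> carrier ?Fr" using h(1,4) keys_diff[of x y] by auto
      moreover have "?g c x - ?g c y \<in> carrier ?Fr" using h(2,5) keys_diff[of "?g c x" "?g c y"] by auto
      moreover have "\<mu> (?g c x - ?g c y) = c \<otimes> \<mu> (x - y)"
        using mu_diff[OF h(2,5)] mu_diff[OF h(1,4)] h(3,6) mu_closed[OF h(1)] mu_closed[OF h(4)] cK
        by (simp add: r_distr r_minus)
      ultimately show "x - y \<in> carrier ?Fr \<and> ?g c (x - y) \<in> carrier ?Fr \<and> \<mu> (?g c (x - y)) = c \<otimes> \<mu> (x - y)"
        unfolding d by blast
    next
      fix p assume p: "p \<in> F \<times> M"
      obtain b x where bx: "p = (b, x)" "b \<in> F" "x \<in> M" using p by auto
      have "\<mu> (frag_of (c \<otimes> b, x)) = c \<otimes> (b \<otimes> x)"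
        using mu_p[of "c \<otimes> b" x] Fmul[OF c bx(2)] bx m_assoc[OF cK F_carrier[OF bx(2)] Mc[OF bx(3)]] by simp
      then show "frag_of p \<in> carrier ?Fr \<and> ?g c (frag_of p) \<in> carrier ?Fr \<and> \<mu> (?g c (frag_of p)) = c \<otimes> \<mu> (frag_of p)"
        using bx mu_p[OF bx(2,3)] Fmul[OF c bx(2)] by simp
    qed
    then show ?thesis by blast
  qed
  have "has_dim (subring_of K F) ?V 1"
    using assms by (simp add: Z1_rank1_def Let_def M_def)
  then obtain W where W: "W \<in> carrier ?V"
    "\<And>X. X \<in> carrier ?V \<Longrightarrow> \<exists>c\<in>carrier (subring_of K F). X = c \<odot>\<^bsub>?V\<^esub> W"
    by (rule has_dim_1_generator) blast
  have Vc: "carrier ?V = rcosets\<^bsub>?Fr\<^esub> ?N"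
    by (simp add: base_change_def Let_def FactGroup_def module_in_def)
  have Vs: "c \<odot>\<^bsub>?V\<^esub> X = (\<Union>z\<in>X. ?N #>\<^bsub>?Fr\<^esub> ?g c z)" for c X
    by (simp add: base_change_def Let_def module_in_def)
  obtain w where w: "w \<in> carrier ?Fr" "W = ?N #>\<^bsub>?Fr\<^esub> w" using W(1) unfolding Vc by (auto simp: RCOSETS_def)
  have muW: "z \<in> carrier ?Fr \<and> \<mu> z = \<mu> w" if zW: "z \<in> W" for z
  proof -
    obtain n where n: "n \<in> ?N" "z = n + w" using zW unfolding w(2) by (auto simp: r_coset_def)
    have "z \<in> carrier ?Fr" using group.is_monoid[OF group_free_Abelian_group] monoid.m_closed[of ?Fr n w] Nc[OF n(1)] w(1) n(2)
      by (simp del: carrier_free_Abelian_group_iff)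
    then show ?thesis using mu_add[OF Nc[OF n(1)] w(1)] muN[OF n(1)] mu_closed[OF w(1)] n(2) by simp
  qed
  have "\<exists>c\<in>F. f = c \<otimes> \<mu> w" if f: "f \<in> SI \<psi>" for f
  proof -
    have fM: "f \<in> M" using f by (simp add: M_def)
    have oneF: "\<one> \<in> F" using subringE(3)[OF subfieldE(1)[OF F_subfield]] .
    define p where "p = frag_of (\<one>, f)"
    have pF: "p \<in> carrier ?Fr" using fr[OF oneF fM] by (simp add: p_def)
    have "?N #>\<^bsub>?Fr\<^esub> p \<in> carrier ?V" unfolding Vc using pF by (auto simp: RCOSETS_def)
    then obtain c where c: "c \<in> F" "?N #>\<^bsub>?Fr\<^esub> p = c \<odot>\<^bsub>?V\<^esub> W" using W(2)[of "?N #>\<^bsub>?Fr\<^esub> p"] by auto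
    have "p \<in> ?N #>\<^bsub>?Fr\<^esub> p"
      using subgroup.one_closed[OF Nsub] by (force simp: r_coset_def)
    then obtain z where z: "z \<in> W" "p \<in> ?N #>\<^bsub>?Fr\<^esub> ?g c z" using c(2) unfolding Vs by blast
    then obtain n where n: "n \<in> ?N" "p = n + ?g c z" by (auto simp: r_coset_def)
    have zz: "z \<in> carrier ?Fr" "\<mu> z = \<mu> w" using muW[OF z(1)] by auto
    have "\<mu> p = \<mu> n \<oplus> \<mu> (?g c z)" unfolding n(2) using mu_add[OF Nc[OF n(1)]] scal[OF c(1) zz(1)] by blast
    also have "\<dots> = c \<otimes> \<mu> w" using muN[OF n(1)] scal[OF c(1) zz(1)] zz(2) F_carrier[OF c(1)] mu_closed[OF w(1)] by simp
    finally have "f = c \<otimes> \<mu> w" using mu_p[OF oneF fM] Mc[OF fM] by (simp add: p_def)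
    then show ?thesis using c(1) by blast
  qed
  then show thesis using that mu_closed[OF w(1)] by blast
qed

lemma rank1_ratio:
  assumes psi: "\<psi> \<in> Z_rk1" and f: "f \<in> SI \<psi> - {\<zero>}" and g: "g \<in> SI \<psi> - {\<zero>}"
  shows "f \<otimes> inv g \<in> Fx"
proof -
  obtain k where k: "k \<in> carrier K" "\<And>f. f \<in> SI \<psi> \<Longrightarrow> \<exists>c\<in>F. f = c \<otimes> k"
    using rank1_generator[OF psi] by blast
  obtain c where c: "c \<in> F" "f = c \<otimes> k" using k(2) f by blast
  obtain d where d: "d \<in> F" "g = d \<otimes> k" using k(2) g by blast
  have K: "c \<in> carrier K" "d \<in> carrier K" using c d F_carrier by auto
  have n: "c \<noteq> \<zero>" "d \<noteq> \<zero>" "k \<noteq> \<zero>" using c d f g k(1) K by auto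
  have i: "inv d \<in> carrier K" "inv k \<in> carrier K" using n K k(1) by auto
  have "f \<otimes> inv g = (c \<otimes> k) \<otimes> (inv d \<otimes> inv k)"
    using c(2) d(2) inv_mult_distrib[of d k] K n k(1) by simp
  also have "\<dots> = (c \<otimes> inv d) \<otimes> (k \<otimes> inv k)" using K i k(1) by (intro mult_swap) auto
  also have "\<dots> = c \<otimes> inv d" using n K k(1) i by simp
  finally have e: "f \<otimes> inv g = c \<otimes> inv d" .
  have di: "inv d \<in> Fx" using subfield_m_inv(1)[OF F_subfield] d n by auto
  have "c \<otimes> inv d \<in> F" using subringE(6)[OF subfieldE(1)[OF F_subfield] c(1)] di by auto
  moreover have "c \<otimes> inv d \<noteq> \<zero>" using mult_nonzero[OF K(1) i(1) n(1)] di by auto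
  ultimately show ?thesis unfolding e by blast
qed

end

section \<open>Torsion of the class of the divisor of a cocycle\<close>

context krull_action
begin

abbreviation "D \<equiv> cocycle_divisor K R G \<phi>"

lemma SI_nonzero_R: "f \<in> SI \<psi> - {\<zero>} \<Longrightarrow> f \<in> Rx \<and> f \<in> nz"
  using R_carrier by (auto simp: semi_invariants_def)

lemma rank1_carrier: "\<psi> \<in> Z_rk1 \<Longrightarrow> \<psi> \<in> carrier Z"
  by (simp add: Z1_rank1_def Z1_nonzero_def)

lemma rank1_nonzero:
  assumes "\<psi> \<in> Z_rk1" obtains f where "f \<in> SI \<psi> - {\<zero>}"
proof -
  have "SI \<psi> \<noteq> {\<zero>}" using assms by (simp add: Z1_rank1_def Z1_nonzero_def)
  then show thesis using that SI_zero[OF rank1_carrier[OF assms]] by blast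
qed

lemma rank1_divisor_diff:
  assumes psi: "\<psi> \<in> Z_rk1" and f: "f \<in> SI \<psi> - {\<zero>}" and g: "g \<in> SI \<psi> - {\<zero>}"
  shows "divisor f - divisor g \<in> E_star"
proof -
  have fc: "f \<in> nz" and gc: "g \<in> nz" using SI_nonzero_R f g by blast+
  have "divisor (f \<otimes> inv g) = divisor f - divisor g"
    using divisor_of_mult[OF fc nonzero_inv_closed[OF gc]] divisor_of_inv[OF gc] by simp
  then show ?thesis using divisor_of_Estar[OF rank1_ratio[OF psi f g]] by simp
qed

lemma cocycle_divisor_eq:
  assumes psi: "\<psi> \<in> Z_rk1" and f: "f \<in> SI \<psi> - {\<zero>}"
    and E: "min_eff E" "effective (divisor f - E)" "divisor f - E \<in> E_star"
  shows "D \<psi> = E"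
  unfolding cocycle_divisor_def
proof (rule the_equality)
  show "min_eff E \<and> (\<exists>f\<in>SI \<psi> - {\<zero>}. effective (divisor f - E) \<and> divisor f - E \<in> E_star)"
    using E f by blast
  fix E' assume "min_eff E' \<and> (\<exists>f\<in>SI \<psi> - {\<zero>}. effective (divisor f - E') \<and> divisor f - E' \<in> E_star)"
  then obtain g where E': "min_eff E'" and g: "g \<in> SI \<psi> - {\<zero>}" "divisor g - E' \<in> E_star"
    by blast
  have "(divisor f - E) - (divisor g - E') - (divisor f - divisor g) \<in> E_star"
    by (intro Estar_diff E(3) g(2) rank1_divisor_diff[OF psi f g(1)])
  moreover have "(divisor f - E) - (divisor g - E') - (divisor f - divisor g) = E' - E"
    by simp
  ultimately show "E' = E" using minimal_effective_unique[OF E' E(1)] by simp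
qed

lemma cocycle_divisor_props:
  assumes psi: "\<psi> \<in> Z_rk1"
  shows "min_eff (D \<psi>)"
    "\<And>f. f \<in> SI \<psi> - {\<zero>} \<Longrightarrow> divisor f - D \<psi> \<in> E_star"
    "\<And>f. f \<in> SI \<psi> - {\<zero>} \<Longrightarrow> effective (divisor f - D \<psi>)"
proof -
  have ex: "min_eff (D \<psi>) \<and> divisor f - D \<psi> \<in> E_star \<and> effective (divisor f - D \<psi>)"
    if f: "f \<in> SI \<psi> - {\<zero>}" for f
  proof -
    have fR: "f \<in> Rx" using SI_nonzero_R[OF f] by blast
    obtain E where E: "min_eff E" "effective (divisor f - E)"
      "divisor f - E \<in> E_star" using minimal_effective_exists[OF fR] .
    then show ?thesis using cocycle_divisor_eq[OF psi f E] by simp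
  qed
  obtain f where "f \<in> SI \<psi> - {\<zero>}" using rank1_nonzero[OF psi] .
  then show "min_eff (D \<psi>)" using ex by blast
  show "divisor f - D \<psi> \<in> E_star" "effective (divisor f - D \<psi>)"
    if "f \<in> SI \<psi> - {\<zero>}" for f using ex[OF that] by blast+
qed

lemma SI_pow_nonzero:
  assumes f: "f \<in> SI \<chi> - {\<zero>}" and c: "\<chi> \<in> carrier Z"
  shows "f [^] (n::nat) \<in> SI (\<chi> [^]\<^bsub>Z\<^esub> n) - {\<zero>}"
proof -
  have "f \<in> nz" using SI_nonzero_R[OF f] by blast
  from nat_pow_nonzero[OF this, of n] show ?thesis using SI_pow[of f \<chi> n] f c by blast
qed

lemma cocycle_divisor_pow:
  assumes c: "\<chi> \<in> Z_rk1" and e: "\<chi> \<in> Z1_e K R G \<phi>"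
    and n: "\<chi> [^]\<^bsub>Z\<^esub> (n::nat) \<in> Z_rk1"
  shows "D (\<chi> [^]\<^bsub>Z\<^esub> n) = frag_cmul (int n) (D \<chi>)"
proof -
  obtain f where f: "f \<in> SI \<chi> - {\<zero>}" using rank1_nonzero[OF c] .
  note P = cocycle_divisor_props[OF c]
  note M = P(1)[unfolded minimal_effective_iff]
  have fc: "f \<in> nz" using SI_nonzero_R[OF f] by blast
  have dv: "divisor (f [^] n) - frag_cmul (int n) (D \<chi>) = frag_cmul (int n) (divisor f - D \<chi>)"
    using divisor_of_nat_pow[OF fc] by (intro poly_mapping_eqI) (simp add: lookup_minus right_diff_distrib)
  have z: "coeff (D \<chi>) P = 0"
    if q: "q \<in> Ht1 K A" and PX: "P \<in> over q" and lt: "coeff (D \<chi>) P < int (ram P q)" for P q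
  proof -
    have PR: "P \<in> Ht1 K R" "P \<inter> A = q" using PX by (auto simp: primes_over_iff)
    have "P \<in> Ht1_over K R A 1" using PR q by (simp add: Ht1_over_def Ht1_def)
    then obtain g where g: "g \<in> SI \<chi> - {\<zero>}" "[val P g = 0] (mod int (ram P q))"
      using e PR(2) unfolding Z1_e_def by blast
    have gc: "g \<in> nz" using SI_nonzero_R[OF g(1)] by blast
    obtain k where k: "coeff (divisor g - D \<chi>) P = k q * int (ram P q)"
      using EstarD[OF P(2)[OF g(1)]] PX q by metis
    have "int (ram P q) dvd val P g" using g(2) by (simp add: cong_0_iff)
    moreover have "coeff (D \<chi>) P = val P g - k q * int (ram P q)"
      using k PR(1) by (simp add: lookup_minus lookup_divisor_of[OF gc])
    ultimately have "int (ram P q) dvd coeff (D \<chi>) P" by simp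
    moreover have "0 \<le> coeff (D \<chi>) P" using M by (simp add: effective_def)
    ultimately show ?thesis using lt zdvd_not_zless[of "coeff (D \<chi>) P" "int (ram P q)"] by linarith
  qed
  show ?thesis
  proof (rule cocycle_divisor_eq[OF n SI_pow_nonzero[OF f rank1_carrier[OF c]]])
    show "min_eff (frag_cmul (int n) (D \<chi>))"
      unfolding minimal_effective_iff
    proof (intro conjI ballI impI)
      show "frag_cmul (int n) (D \<chi>) \<in> carrier (Div K R)" using M by (simp add: Div_iff)
      show "effective (frag_cmul (int n) (D \<chi>))" using M by (simp add: effective_def)
      show "coeff (frag_cmul (int n) (D \<chi>)) P = 0" if "P \<in> Ht1_ge2 K R A" for P
        using M that by simp
      fix q assume q: "q \<in> Ht1 K A" "over q \<noteq> {}"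
      then obtain P where P: "P \<in> over q" "coeff (D \<chi>) P < int (ram P q)" using M by blast
      have "coeff (frag_cmul (int n) (D \<chi>)) P < int (ram P q)"
        using z[OF q(1) P] P(2) by simp
      then show "\<exists>P\<in>over q. coeff (frag_cmul (int n) (D \<chi>)) P < int (ram P q)"
        using P(1) by blast
    qed
    show "effective (divisor (f [^] n) - frag_cmul (int n) (D \<chi>))"
      unfolding dv using P(3)[OF f] unfolding effective_def lookup_frag_cmul by simp
    show "divisor (f [^] n) - frag_cmul (int n) (D \<chi>) \<in> E_star"
      unfolding dv by (rule Estar_cmul[OF P(2)[OF f]])
  qed
qed

lemma ext_F:
  assumes s: "\<sigma> \<in> carrier G" and y: "y \<in> F"
  shows "ext \<sigma> y = y"
proof -
  obtain a b where ab: "a \<in> A" "b \<in> A - {\<zero>}" "y = a \<otimes> inv b" using y by (auto simp: fractions_def)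
  have "a \<in> R" "b \<in> Rx" "\<phi> \<sigma> a = a" "\<phi> \<sigma> b = b" using ab s by (auto simp: fixed_ring_def)
  then show ?thesis using ext_fraction[OF s, of a b] ab(3) by simp
qed

lemma cocycle_F:
  assumes y: "y \<in> Fx" shows "cocycle y = \<one>\<^bsub>Z\<^esub>"
proof -
  have "ext \<sigma> y \<otimes> inv y = \<one>" if "\<sigma> \<in> carrier G" for \<sigma>
    using ext_F[OF that, of y] y F_carrier[of y] by auto
  then show ?thesis unfolding cocycle_def Z1_one by (intro restrict_ext) blast
qed

lemma SI_F_mult:
  assumes h: "h \<in> SI \<psi> - {\<zero>}" and y: "y \<in> Fx" and hy: "h \<otimes> y \<in> R" and psi: "\<psi> \<in> carrier Z"
  shows "h \<otimes> y \<in> SI \<psi>"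
proof -
  interpret Z: comm_group Z by (rule Z1_group)
  have hc: "h \<in> Rx" "h \<in> nz" using SI_nonzero_R[OF h] by blast+
  have yc: "y \<in> nz" using y F_carrier by auto
  have "cocycle h = \<psi>" using SI_iff_cocycle[OF hc(1) psi] h by blast
  then have "cocycle (h \<otimes> y) = \<psi>" using cocycle_mult[OF hc(2) yc] cocycle_F[OF y] psi by simp
  then show ?thesis using SI_iff_cocycle[OF _ psi, of "h \<otimes> y"] hy nonzero_mult_closed[OF hc(2) yc] by blast
qed

lemma cocycle_divisor_free:
  assumes psi: "\<psi> \<in> Z_rk1" and h: "h \<in> SI \<psi> - {\<zero>}"
    and gen: "\<And>f. f \<in> SI \<psi> \<Longrightarrow> \<exists>a\<in>A. f = a \<otimes> h"
    and ge2: "\<And>P. P \<in> Ht1_ge2 K R A \<Longrightarrow> \<not> SI \<psi> \<subseteq> P"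
  shows "D \<psi> = divisor h"
proof (rule cocycle_divisor_eq[OF psi h])
  have hc: "h \<in> Rx" "h \<in> nz" using SI_nonzero_R[OF h] by blast+
  show "effective (divisor h - divisor h)" by (simp add: effective_def)
  show "divisor h - divisor h \<in> E_star"
    using subgroup.one_closed[OF Estar_subgroup] by simp
  show "min_eff (divisor h)"
    unfolding minimal_effective_iff
  proof (intro conjI ballI impI)
    show "divisor h \<in> carrier (Div K R)" by (rule divisor_of_Div[OF hc(2)])
    show "effective (divisor h)" using effective_divisor_of_iff[OF hc(2)] hc(1) by blast
  next
    fix P assume P: "P \<in> Ht1_ge2 K R A"
    then have PR: "P \<in> Ht1 K R" by (simp add: Ht1_ge2_iff)
    obtain f where f: "f \<in> SI \<psi>" "f \<notin> P" using ge2[OF P] by blast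
    obtain a where a: "a \<in> A" "f = a \<otimes> h" using gen[OF f(1)] by blast
    have "h \<notin> P" using Ht1_facts(4)[OF PR, of a h] a f(2) A_R by blast
    then show "coeff (divisor h) P = 0"
      using val_eq_0_iff[OF PR hc(1)] by (simp add: lookup_divisor_of[OF hc(2)])
  next
    fix q assume q: "q \<in> Ht1 K A" "over q \<noteq> {}"
    show "\<exists>P\<in>over q. coeff (divisor h) P < int (ram P q)"
    proof (rule ccontr)
      assume "\<not> ?thesis"
      then have big: "int (ram P q) \<le> val P h" if "P \<in> over q" for P
        using that lookup_divisor_of[OF hc(2), of P] by (force simp: primes_over_iff)
      obtain P0 where P0: "P0 \<in> over q" using q(2) by blast
      obtain t where t: "t \<in> Fx" "valuation K A q t = 1" using ramification(3)[OF q(1) P0] by blast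
      define x where "x = inv t"
      have x: "x \<in> Fx" unfolding x_def by (rule subfield_m_inv(1)[OF F_subfield t(1)])
      obtain s where s: "s \<in> A - q" "\<And>P. P \<in> Ht1 K R \<Longrightarrow> P \<inter> A \<noteq> q \<Longrightarrow> 0 \<le> val P (s \<otimes> x)"
        using clear_denominators[OF q(1) x] by blast
      have sn: "s \<noteq> \<zero>" using s(1) Ht1_A_facts(1)[OF q(1)] by auto
      have sK: "s \<in> Rx" "s \<in> nz" "s \<in> Fx"
        using s(1) sn A_R A_carrier A_F by auto
      have xc: "x \<in> nz" "t \<in> nz" using x t(1) F_carrier by auto
      define y where "y = s \<otimes> x"
      have yF: "y \<in> Fx"
        unfolding y_def using subringE(6)[OF subfieldE(1)[OF F_subfield], of s x] sK x nonzero_mult_closed[OF sK(2) xc(1)] by blast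
      have yc: "y \<in> nz" using yF F_carrier by auto
      have vy: "val P y = - int (ram P q)" if P: "P \<in> over q" for P
      proof -
        have PR: "P \<in> Ht1 K R" "P \<inter> A = q" using P by (auto simp: primes_over_iff)
        have "val P s = 0" using val_eq_0_iff[OF PR(1) sK(1)] s(1) PR(2) by blast
        moreover have "val P t = int (ram P q)" using ramification(2)[OF q(1) P t(1)] t(2) by simp
        ultimately show ?thesis
          unfolding y_def x_def using val_mult[OF PR(1) sK(2) xc(1)] val_inv[OF PR(1) xc(2)] by (simp add: x_def)
      qed
      have hyc: "h \<otimes> y \<in> nz" by (rule nonzero_mult_closed[OF hc(2) yc])
      have "0 \<le> val P (h \<otimes> y)" if PR: "P \<in> Ht1 K R" for P
      proof (cases "P \<inter> A = q")
        case True
        then have P: "P \<in> over q" using PR by (simp add: primes_over_iff)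
        show ?thesis using val_mult[OF PR hc(2) yc] vy[OF P] big[OF P] by simp
      next
        case False
        then show ?thesis using val_mult[OF PR hc(2) yc] val_nonneg[OF PR hc(1)] s(2)[OF PR] by (simp add: y_def)
      qed
      then have "h \<otimes> y \<in> R" using R_iff[OF hyc] by blast
      then have "h \<otimes> y \<in> SI \<psi>" by (rule SI_F_mult[OF h yF _ rank1_carrier[OF psi]])
      then obtain a where a: "a \<in> A" "h \<otimes> y = a \<otimes> h" using gen by blast
      have ac: "a \<in> carrier K" using A_carrier a(1) by blast
      have "y \<otimes> h = a \<otimes> h" using a(2) m_comm[of h y] hc yc by auto
      then have "y = a" using hc yc ac by (subst (asm) m_rcancel) auto
      then have "y \<in> Rx" using a(1) A_R yc by auto
      then have "0 \<le> val P0 y" using val_nonneg[of P0 y] P0 by (simp add: primes_over_iff)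
      then show False using vy[OF P0] ramification(1)[OF q(1) P0] by simp
    qed
  qed
qed

lemma module_iso_iff:
  assumes psi: "\<psi> \<in> carrier Z" and nz: "g \<in> SI \<psi> - {\<zero>}"
  shows "module_iso (subring_of K A) (module_in K (SI \<psi>)) (module_in K A) \<longleftrightarrow>
    (\<exists>h\<in>SI \<psi> - {\<zero>}. \<forall>f\<in>SI \<psi>. \<exists>a\<in>A. f = a \<otimes> h)"
proof
  assume "module_iso (subring_of K A) (module_in K (SI \<psi>)) (module_in K A)"
  then obtain f where f0: "f \<in> module_hom (subring_of K A) (module_in K (SI \<psi>)) (module_in K A)"
    "bij_betw f (carrier (module_in K (SI \<psi>))) (carrier (module_in K A))"
    unfolding module_iso_def by blast
  have f: "\<And>r m. r \<in> A \<Longrightarrow> m \<in> SI \<psi> \<Longrightarrow> f (r \<otimes> m) = r \<otimes> f m" "bij_betw f (SI \<psi>) A"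
    using f0 by (auto simp: module_hom_def module_in_def)
  have one: "\<one> \<in> A" by (rule subringE(3)[OF A_subring])
  obtain h where h: "h \<in> SI \<psi>" "f h = \<one>" using f(2) one unfolding bij_betw_def by (metis imageE)
  have rep: "\<exists>a\<in>A. y = a \<otimes> h" if y: "y \<in> SI \<psi>" for y
  proof -
    have a: "f y \<in> A" using f(2) y unfolding bij_betw_def by blast
    have "f (f y \<otimes> h) = f y" using f(1)[OF a h(1)] h(2) A_carrier[OF a] by simp
    then have "y = f y \<otimes> h"
      using f(2) y SI_A_mult[OF a h(1) psi] unfolding bij_betw_def by (metis inj_onD)
    then show ?thesis using a by blast
  qed
  have "h \<noteq> \<zero>"
  proof
    assume "h = \<zero>"
    then show False using rep[of g] nz A_carrier by auto
  qed
  then show "\<exists>h\<in>SI \<psi> - {\<zero>}. \<forall>f\<in>SI \<psi>. \<exists>a\<in>A. f = a \<otimes> h" using h rep by blast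
next
  assume "\<exists>h\<in>SI \<psi> - {\<zero>}. \<forall>f\<in>SI \<psi>. \<exists>a\<in>A. f = a \<otimes> h"
  then obtain h where h: "h \<in> SI \<psi> - {\<zero>}" "\<And>f. f \<in> SI \<psi> \<Longrightarrow> \<exists>a\<in>A. f = a \<otimes> h" by blast
  have hc: "h \<in> nz" "inv h \<in> carrier K" using SI_nonzero_R[OF h(1)] by auto
  let ?f = "\<lambda>y. y \<otimes> inv h"
  have f_a: "(a \<otimes> h) \<otimes> inv h = a" if "a \<in> A" for a
    using mult_eq_iff_eq_mult_inv[of a "a \<otimes> h" h] A_carrier[OF that] hc by auto
  have f_A: "?f y \<in> A" if "y \<in> SI \<psi>" for y using h(2)[OF that] f_a by auto
  have "?f \<in> module_hom (subring_of K A) (module_in K (SI \<psi>)) (module_in K A)"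
    unfolding module_hom_def module_in_def
    using f_A SI_carrier A_carrier hc(2) by (auto simp: l_distr m_assoc)
  moreover have "bij_betw ?f (SI \<psi>) A"
    unfolding bij_betw_def
  proof
    show "inj_on ?f (SI \<psi>)"
    proof (rule inj_onI)
      fix y z assume y: "y \<in> SI \<psi>" and z: "z \<in> SI \<psi>" and e: "y \<otimes> inv h = z \<otimes> inv h"
      obtain a b where "a \<in> A" "y = a \<otimes> h" "b \<in> A" "z = b \<otimes> h" using h(2)[OF y] h(2)[OF z] by blast
      then show "y = z" using e f_a by simp
    qed
    show "?f ` SI \<psi> = A"
    proof
      show "?f ` SI \<psi> \<subseteq> A" using f_A by blast
      show "A \<subseteq> ?f ` SI \<psi>"
      proof
        fix a assume a: "a \<in> A"
        have "a = ?f (a \<otimes> h)" using f_a[OF a] by simp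
        moreover have "a \<otimes> h \<in> SI \<psi>" using SI_A_mult[OF a _ psi] h(1) by blast
        ultimately show "a \<in> ?f ` SI \<psi>" by (rule image_eqI)
      qed
    qed
  qed
  ultimately show "module_iso (subring_of K A) (module_in K (SI \<psi>)) (module_in K A)"
    unfolding module_iso_def by (auto simp: module_in_def)
qed

lemma principal_normal: "principal_divisors K R \<lhd> Div K R"
proof -
  have "comm_group (Div K R)" by (simp add: Div_def abelian_free_Abelian_group)
  then show ?thesis by (rule comm_group.subgroup_imp_normal[OF _ principal_divisors_subgroup])
qed

lemma Cl_group: "group (Cl K R)"
  unfolding Cl_def by (rule normal.factorgroup_is_group[OF principal_normal])

lemma divisor_class_hom: "group_hom (Div K R) (Cl K R) (divisor_class K R)"
proof -
  have "(\<lambda>a. principal_divisors K R #>\<^bsub>Div K R\<^esub> a) \<in> hom (Div K R) (Div K R Mod principal_divisors K R)"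
    by (rule normal.r_coset_hom_Mod[OF principal_normal])
  then show ?thesis
    unfolding group_hom_def group_hom_axioms_def using Div_group Cl_group
    by (simp add: Cl_def divisor_class_def[abs_def])
qed

lemma divisor_class_pow_eq_one_iff:
  assumes E: "E \<in> carrier (Div K R)"
  shows "divisor_class K R E [^]\<^bsub>Cl K R\<^esub> (n::nat) = \<one>\<^bsub>Cl K R\<^esub> \<longleftrightarrow> frag_cmul (int n) E \<in> principal_divisors K R"
proof -
  interpret c: group_hom "Div K R" "Cl K R" "divisor_class K R" by (rule divisor_class_hom)
  have p: "E [^]\<^bsub>Div K R\<^esub> n = frag_cmul (int n) E" by (simp add: Div_def)
  have cl: "frag_cmul (int n) E \<in> carrier (Div K R)" using E by (simp add: Div_iff)
  have "divisor_class K R E [^]\<^bsub>Cl K R\<^esub> n = divisor_class K R (frag_cmul (int n) E)"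
    using c.hom_nat_pow[OF E, of n] p by simp
  moreover have "divisor_class K R (frag_cmul (int n) E) = \<one>\<^bsub>Cl K R\<^esub> \<longleftrightarrow> frag_cmul (int n) E \<in> principal_divisors K R"
    unfolding divisor_class_def Cl_def FactGroup_def
    using group.coset_join1[OF Div_group _ cl principal_divisors_subgroup]
      group.coset_join2[OF Div_group cl principal_divisors_subgroup]
      subgroup.subset[OF principal_divisors_subgroup] by auto
  ultimately show ?thesis by simp
qed

lemma H1_comm_group: "comm_group (H1 K R G \<phi>)"
  unfolding H1_def by (rule comm_group.abelian_FactGroup[OF Z1_group B1_subgroup])

lemma coh_one: "coh_cl \<one>\<^bsub>Z\<^esub> = \<one>\<^bsub>H\<^esub>"
  using group_hom.hom_one[OF coh_hom] .

lemma coh_diff_torsion: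
  assumes psi: "\<psi> \<in> carrier Z" and k: "0 < (k::nat)" and g: "g \<in> nz"
    and h: "h \<in> SI (\<psi> [^]\<^bsub>Z\<^esub> k) - {\<zero>}" and eq: "divisor h = divisor (g [^] k)"
  shows "cocycle g \<in> carrier Z"
    "coh_cl \<psi> \<otimes>\<^bsub>H\<^esub> inv\<^bsub>H\<^esub> coh_cl (cocycle g) \<in> torsion_part (H1 K R G \<phi>)"
proof -
  have hc: "h \<in> Rx" "h \<in> nz" using SI_nonzero_R[OF h] by blast+
  have gk: "g [^] k \<in> nz" by (rule nat_pow_nonzero[OF g])
  obtain u where u: "u \<in> U" "g [^] k = u \<otimes> h" using divisor_of_eq_imp_unit[OF hc(2) gk eq] .
  have uc: "u \<in> nz" using U_facts(1,2)[OF u(1)] by auto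
  have ch: "cocycle h = \<psi> [^]\<^bsub>Z\<^esub> k" using SI_iff_cocycle[OF hc(1) Z1_pow_closed[OF psi]] h by blast
  have cgk: "cocycle (g [^] k) = cocycle u \<otimes>\<^bsub>Z\<^esub> (\<psi> [^]\<^bsub>Z\<^esub> k)"
    using cocycle_mult[OF uc hc(2)] u(2) ch by simp
  interpret Z: comm_group Z by (rule Z1_group)
  have cgkZ: "cocycle (g [^] k) \<in> carrier Z" unfolding cgk using cocycle_unit[OF u(1)] psi by simp
  show cg: "cocycle g \<in> carrier Z"
  proof (rule cocycle_closed[OF g])
    fix \<sigma> assume s: "\<sigma> \<in> carrier G"
    define x where "x = ext \<sigma> g \<otimes> inv g"
    have x: "x \<in> nz"
      unfolding x_def by (rule nonzero_mult_closed[OF ext_nonzero[OF s g] nonzero_inv_closed[OF g]])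
    have "x [^] k = (cocycle g [^]\<^bsub>Z\<^esub> k) \<sigma>" using Z1_pow[OF s] s by (simp add: cocycle_def x_def)
    also have "\<dots> = cocycle (g [^] k) \<sigma>" using cocycle_nat_pow[OF g] by simp
    finally have "x [^] k \<in> U" using Z1_val[OF cgkZ s] by simp
    then have "divisor (x [^] k) = 0" using divisor_of_eq_0_iff[OF nat_pow_nonzero[OF x]] by blast
    then have "divisor x = 0" using divisor_of_nat_pow[OF x, of k] k by simp
    then show "ext \<sigma> g \<otimes> inv g \<in> U" using divisor_of_eq_0_iff[OF x] by (simp add: x_def)
  qed
  interpret H: comm_group "H1 K R G \<phi>" by (rule H1_comm_group)
  interpret c: group_hom Z "H1 K R G \<phi>" coh_cl by (rule coh_hom)
  have "coh_cl (cocycle u) = \<one>\<^bsub>H\<^esub>"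
    using coh_eq_one_iff[OF cocycle_unit[OF u(1)]] u(1) by (auto simp: B1_eq)
  then have "coh_cl (cocycle g [^]\<^bsub>Z\<^esub> k) = coh_cl (\<psi> [^]\<^bsub>Z\<^esub> k)"
    using cgk cocycle_nat_pow[OF g, of k] cocycle_unit[OF u(1)] psi by simp
  then have e: "coh_cl (cocycle g) [^]\<^bsub>H\<^esub> k = coh_cl \<psi> [^]\<^bsub>H\<^esub> k"
    using cg psi by (simp add: c.hom_nat_pow)
  have "(coh_cl \<psi> \<otimes>\<^bsub>H\<^esub> inv\<^bsub>H\<^esub> coh_cl (cocycle g)) [^]\<^bsub>H\<^esub> k
      = coh_cl \<psi> [^]\<^bsub>H\<^esub> k \<otimes>\<^bsub>H\<^esub> inv\<^bsub>H\<^esub> (coh_cl (cocycle g) [^]\<^bsub>H\<^esub> k)"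
    using c.hom_closed[OF psi] c.hom_closed[OF cg] by (simp add: H.nat_pow_distrib H.nat_pow_inv)
  also have "\<dots> = \<one>\<^bsub>H\<^esub>" unfolding e using c.hom_closed[OF psi] by simp
  finally show "coh_cl \<psi> \<otimes>\<^bsub>H\<^esub> inv\<^bsub>H\<^esub> coh_cl (cocycle g) \<in> torsion_part (H1 K R G \<phi>)"
    unfolding torsion_part_def using k c.hom_closed[OF psi] c.hom_closed[OF cg] by auto
qed

lemma coh_eq_imp_generator:
  assumes psi: "\<psi> \<in> Z_rk1" and g: "g \<in> nz" "cocycle g \<in> carrier Z"
    and Dg: "D \<psi> = divisor g" and coh: "coh_cl \<psi> = coh_cl (cocycle g)"
  shows "\<exists>h\<in>SI \<psi> - {\<zero>}. \<forall>f\<in>SI \<psi>. \<exists>a\<in>A. f = a \<otimes> h"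
proof -
  note pZ = rank1_carrier[OF psi]
  interpret Z: comm_group Z by (rule Z1_group)
  interpret H: group "H1 K R G \<phi>" by (rule H1_group)
  interpret c: group_hom Z "H1 K R G \<phi>" coh_cl by (rule coh_hom)
  have "coh_cl (\<psi> \<otimes>\<^bsub>Z\<^esub> inv\<^bsub>Z\<^esub> cocycle g) = \<one>\<^bsub>H\<^esub>"
    using pZ g(2) coh c.hom_closed[OF g(2)] by simp
  moreover have "\<psi> \<otimes>\<^bsub>Z\<^esub> inv\<^bsub>Z\<^esub> cocycle g \<in> carrier Z" using pZ g(2) by simp
  ultimately have "\<psi> \<otimes>\<^bsub>Z\<^esub> inv\<^bsub>Z\<^esub> cocycle g \<in> B" using coh_eq_one_iff by blast
  then obtain u where u: "u \<in> U" "\<psi> \<otimes>\<^bsub>Z\<^esub> inv\<^bsub>Z\<^esub> cocycle g = cocycle u" by (auto simp: B1_eq)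
  have uc: "u \<in> nz" using U_facts(1,2)[OF u(1)] by auto
  define h where "h = u \<otimes> g"
  have hc: "h \<in> nz" unfolding h_def by (rule nonzero_mult_closed[OF uc g(1)])
  have "cocycle h = (\<psi> \<otimes>\<^bsub>Z\<^esub> inv\<^bsub>Z\<^esub> cocycle g) \<otimes>\<^bsub>Z\<^esub> cocycle g"
    unfolding h_def u(2) by (rule cocycle_mult[OF uc g(1)])
  then have ch: "cocycle h = \<psi>" using pZ g(2) by (simp add: Z.m_assoc)
  have "divisor h = D \<psi>"
    unfolding h_def Dg using divisor_of_mult[OF uc g(1)] divisor_of_eq_0_iff[OF uc] u(1) by simp
  note Dh = this
  have "effective (D \<psi>)" using cocycle_divisor_props(1)[OF psi] by (simp add: minimal_effective_iff)
  then have hR: "h \<in> Rx" using effective_divisor_of_iff[OF hc] Dh hc by simp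
  then have hS: "h \<in> SI \<psi> - {\<zero>}" using SI_iff_cocycle[OF hR pZ] ch by simp
  have "\<exists>a\<in>A. f = a \<otimes> h" if f: "f \<in> SI \<psi>" for f
  proof (cases "f = \<zero>")
    case True
    then show ?thesis using subringE(2)[OF A_subring] hc by (intro bexI[of _ \<zero>]) auto
  next
    case False
    then have f': "f \<in> SI \<psi> - {\<zero>}" using f by blast
    have fc: "f \<in> Rx" "f \<in> nz" using SI_nonzero_R[OF f'] by blast+
    define a where "a = f \<otimes> inv h"
    have ac: "a \<in> nz" unfolding a_def by (rule nonzero_mult_closed[OF fc(2) nonzero_inv_closed[OF hc]])
    have fa: "f = a \<otimes> h" using mult_eq_iff_eq_mult_inv[of a f h] ac hc fc by (auto simp: a_def)
    have "divisor a = divisor f - D \<psi>"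
      using divisor_of_mult[OF ac hc] fa Dh by simp
    then have aR: "a \<in> Rx"
      using cocycle_divisor_props(3)[OF psi f'] effective_divisor_of_iff[OF ac] ac by simp
    have eq: "cocycle a \<otimes>\<^bsub>Z\<^esub> \<psi> = \<psi>"
      using cocycle_mult[OF ac hc] fa ch SI_iff_cocycle[OF fc(1) pZ] f by simp
    have e: "cocycle a \<sigma> \<otimes> \<psi> \<sigma> = \<psi> \<sigma>" if "\<sigma> \<in> carrier G" for \<sigma>
    proof -
      have "cocycle a \<sigma> \<otimes> \<psi> \<sigma> = (cocycle a \<otimes>\<^bsub>Z\<^esub> \<psi>) \<sigma>" unfolding Z1_mult using that by simp
      then show ?thesis unfolding eq .
    qed
    have "\<phi> \<sigma> a = a" if s: "\<sigma> \<in> carrier G" for \<sigma>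
    proof -
      have pu: "\<psi> \<sigma> \<in> carrier K" "\<psi> \<sigma> \<noteq> \<zero>" using U_facts(1,2)[OF Z1_val[OF pZ s]] by auto
      have ca: "cocycle a \<sigma> \<in> carrier K" using s ext_closed[OF s, of a] ac by (auto simp: cocycle_def)
      have "cocycle a \<sigma> \<otimes> \<psi> \<sigma> = \<one> \<otimes> \<psi> \<sigma>" using e[OF s] pu by simp
      then have "cocycle a \<sigma> = \<one>" using pu ca by (subst (asm) m_rcancel) auto
      then have "\<phi> \<sigma> a \<otimes> inv a = \<one>" using s ext_R[OF s, of a] aR by (simp add: cocycle_def)
      then have "\<phi> \<sigma> a = \<one> \<otimes> inv (inv a)"
        using mult_eq_iff_eq_mult_inv[of "\<phi> \<sigma> a" \<one> "inv a"] phi_carrier[OF s, of a] aR nonzero_inv_closed[OF ac] by auto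
      then show ?thesis using ac by simp
    qed
    then have "a \<in> A" using aR by (simp add: fixed_ring_def)
    then show ?thesis using fa by blast
  qed
  then show ?thesis using hS by blast
qed

end

theorem corollary3p6:
  fixes K :: "('a, 'b) ring_scheme" and R :: "'a set"
    and G :: "('g, 'c) monoid_scheme" and \<phi> :: "'g \<Rightarrow> 'a \<Rightarrow> 'a"
    and \<chi> :: "'g \<Rightarrow> 'a"
  assumes "field K"
    and "krull_domain K R"
    and "carrier K = fractions K R"
    and "group_action G R \<phi>"
    and "\<forall>\<sigma>\<in>carrier G. \<phi> \<sigma> \<in> ring_iso (subring_of K R) (subring_of K R)"
    and "\<chi> \<in> Z1_e K R G \<phi> \<inter> m_inv (Z1 K R G \<phi>) ` Z1_2 K R G \<phi>"
    and "\<forall>n::nat. 0 < n \<longrightarrow> \<chi> [^]\<^bsub>Z1 K R G \<phi>\<^esub> n \<in> Z1_rank1 K R G \<phi>"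
    and "\<exists>m::nat. 0 < m \<and> module_iso (subring_of K (fixed_ring R G \<phi>))
           (module_in K (semi_invariants K R G \<phi> (\<chi> [^]\<^bsub>Z1 K R G \<phi>\<^esub> m)))
           (module_in K (fixed_ring R G \<phi>))"
  shows "divisor_class K R (cocycle_divisor K R G \<phi> \<chi>) \<in> torsion_part (Cl K R)
    \<and> ((\<forall>i::nat. 0 < i
          \<and> cocycle_divisor K R G \<phi> (\<chi> [^]\<^bsub>Z1 K R G \<phi>\<^esub> i) \<in> principal_divisors K R
          \<longrightarrow> coh K R G \<phi> (\<chi> [^]\<^bsub>Z1 K R G \<phi>\<^esub> i) \<otimes>\<^bsub>H1 K R G \<phi>\<^esub>
                inv\<^bsub>H1 K R G \<phi>\<^esub> (coh_div K R G \<phi> (cocycle_divisor K R G \<phi> (\<chi> [^]\<^bsub>Z1 K R G \<phi>\<^esub> i)))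
              \<notin> torsion_part (H1 K R G \<phi>) - {coh K R G \<phi> \<one>\<^bsub>Z1 K R G \<phi>\<^esub>})
        \<longrightarrow> group.ord (Cl K R) (divisor_class K R (cocycle_divisor K R G \<phi> \<chi>))
              = (LEAST q::nat. 0 < q \<and> module_iso (subring_of K (fixed_ring R G \<phi>))
                  (module_in K (semi_invariants K R G \<phi> (\<chi> [^]\<^bsub>Z1 K R G \<phi>\<^esub> q)))
                  (module_in K (fixed_ring R G \<phi>))))"
proof -
  interpret krull_action K R G \<phi>
    using assms(1-5) unfolding krull_action_def krull_action_axioms_def krull_field_def krull_field_axioms_def by blast
  interpret Z: comm_group Z by (rule Z1_group)
  interpret Cl: group "Cl K R" by (rule Cl_group)
  interpret H: comm_group "H1 K R G \<phi>" by (rule H1_comm_group)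
  interpret c: group_hom Z "H1 K R G \<phi>" coh_cl by (rule coh_hom)
  have e: "\<chi> \<in> Z1_e K R G \<phi>" using assms(6) by blast
  have cZ: "\<chi> \<in> carrier Z" using e by (simp add: Z1_e_def Z1_nonzero_def)
  have rk: "\<chi> [^]\<^bsub>Z\<^esub> n \<in> Z1_rank1 K R G \<phi>" if "0 < n" for n :: nat using assms(7) that by blast
  have c1: "\<chi> \<in> Z1_rank1 K R G \<phi>" using rk[of 1] cZ by simp
  have ge2: "\<not> SI (\<chi> [^]\<^bsub>Z\<^esub> n) \<subseteq> P" if P: "P \<in> Ht1_ge2 K R A" for P and n :: nat
  proof -
    obtain \<psi> where psi: "\<psi> \<in> Z1_2 K R G \<phi>" "\<chi> = inv\<^bsub>Z\<^esub> \<psi>" using assms(6) by blast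
    then have "\<not> SI \<chi> \<subseteq> P" using P by (simp add: Z1_2_def)
    then obtain f where f: "f \<in> SI \<chi>" "f \<notin> P" by blast
    have PR: "P \<in> Ht1 K R" using P by (simp add: Ht1_ge2_iff)
    have f': "f \<in> SI \<chi> - {\<zero>\<^bsub>K\<^esub>}" using f Ht1_facts(1)[OF PR] by blast
    have fc: "f \<in> R - {\<zero>\<^bsub>K\<^esub>}" "f \<in> carrier K - {\<zero>\<^bsub>K\<^esub>}" using SI_nonzero_R[OF f'] by blast+
    have fn: "f [^]\<^bsub>K\<^esub> n \<in> SI (\<chi> [^]\<^bsub>Z\<^esub> n) - {\<zero>\<^bsub>K\<^esub>}" by (rule SI_pow_nonzero[OF f' cZ])
    have fnR: "f [^]\<^bsub>K\<^esub> n \<in> R - {\<zero>\<^bsub>K\<^esub>}" using SI_nonzero_R[OF fn] by blast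
    have "val P f = 0" using val_eq_0_iff[OF PR fc(1)] f(2) by blast
    then have "val P (f [^]\<^bsub>K\<^esub> n) = 0" using val_nat_pow[OF PR fc(2)] by simp
    then have "f [^]\<^bsub>K\<^esub> n \<notin> P" using val_eq_0_iff[OF PR fnR] by blast
    then show ?thesis using fn by blast
  qed
  let ?iso = "\<lambda>q::nat. module_iso (subring_of K A) (module_in K (SI (\<chi> [^]\<^bsub>Z\<^esub> q))) (module_in K A)"
  have iso_iff: "?iso q \<longleftrightarrow> (\<exists>h\<in>SI (\<chi> [^]\<^bsub>Z\<^esub> q) - {\<zero>\<^bsub>K\<^esub>}. \<forall>f\<in>SI (\<chi> [^]\<^bsub>Z\<^esub> q). \<exists>a\<in>A. f = a \<otimes>\<^bsub>K\<^esub> h)" if q: "0 < q" for q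
  proof -
    obtain g where g: "g \<in> SI (\<chi> [^]\<^bsub>Z\<^esub> q) - {\<zero>\<^bsub>K\<^esub>}" using rank1_nonzero[OF rk[OF q]] .
    show ?thesis by (rule module_iso_iff[OF Z1_pow_closed[OF cZ] g])
  qed
  have Dn: "D (\<chi> [^]\<^bsub>Z\<^esub> n) = frag_cmul (int n) (D \<chi>)" if "0 < n" for n :: nat
    by (rule cocycle_divisor_pow[OF c1 e rk[OF that]])
  have DD: "D \<chi> \<in> carrier (Div K R)" using cocycle_divisor_props(1)[OF c1] by (simp add: minimal_effective_iff)
  define q0 where "q0 = (LEAST q::nat. 0 < q \<and> ?iso q)"
  have q0: "0 < q0 \<and> ?iso q0" unfolding q0_def by (rule LeastI_ex[OF assms(8)])
  have q0_le: "q0 \<le> q" if "0 < q" "?iso q" for q unfolding q0_def using that by (intro Least_le) blast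
  obtain h where h: "h \<in> SI (\<chi> [^]\<^bsub>Z\<^esub> q0) - {\<zero>\<^bsub>K\<^esub>}" "\<And>f. f \<in> SI (\<chi> [^]\<^bsub>Z\<^esub> q0) \<Longrightarrow> \<exists>a\<in>A. f = a \<otimes>\<^bsub>K\<^esub> h"
    using iso_iff[of q0] q0 by blast
  have hc: "h \<in> carrier K - {\<zero>\<^bsub>K\<^esub>}" using SI_nonzero_R[OF h(1)] by blast
  have q0r: "0 < q0" using q0 by blast
  have "D (\<chi> [^]\<^bsub>Z\<^esub> q0) = divisor h"
    by (rule cocycle_divisor_free[OF rk[OF q0r] h ge2])
  then have Dh: "frag_cmul (int q0) (D \<chi>) = divisor h" using Dn[OF q0r] by simp
  then have pr: "frag_cmul (int q0) (D \<chi>) \<in> principal_divisors K R" using hc unfolding principal_divisors_def by blast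
  let ?c = "divisor_class K R (D \<chi>)"
  have cc: "?c \<in> carrier (Cl K R)" using group_hom.hom_closed[OF divisor_class_hom DD] .
  have cq0: "?c [^]\<^bsub>Cl K R\<^esub> q0 = \<one>\<^bsub>Cl K R\<^esub>" using divisor_class_pow_eq_one_iff[OF DD] pr by blast
  have tor: "?c \<in> torsion_part (Cl K R)" unfolding torsion_part_def using cc cq0 q0r by blast
  have "Cl.ord ?c = q0"
    if hyp: "\<forall>i::nat. 0 < i \<and> D (\<chi> [^]\<^bsub>Z\<^esub> i) \<in> principal_divisors K R \<longrightarrow>
      coh_cl (\<chi> [^]\<^bsub>Z\<^esub> i) \<otimes>\<^bsub>H1 K R G \<phi>\<^esub> inv\<^bsub>H1 K R G \<phi>\<^esub> (coh_div K R G \<phi> (D (\<chi> [^]\<^bsub>Z\<^esub> i)))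
        \<notin> torsion_part (H1 K R G \<phi>) - {coh_cl \<one>\<^bsub>Z\<^esub>}"
  proof -
    define n where "n = Cl.ord ?c"
    have "n dvd q0" using Cl.pow_eq_id[OF cc] cq0 by (simp add: n_def)
    then obtain k where k: "q0 = n * k" by (rule dvdE)
    have n: "0 < n" "0 < k" using k q0r by auto
    have "frag_cmul (int n) (D \<chi>) \<in> principal_divisors K R"
      using divisor_class_pow_eq_one_iff[OF DD] Cl.pow_ord_eq_1[OF cc] by (simp add: n_def)
    then obtain g where g: "g \<in> carrier K - {\<zero>\<^bsub>K\<^esub>}" "D (\<chi> [^]\<^bsub>Z\<^esub> n) = divisor g"
      using Dn[OF n(1)] unfolding principal_divisors_def by auto
    have "divisor (g [^]\<^bsub>K\<^esub> k) = frag_cmul (int k) (frag_cmul (int n) (D \<chi>))"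
      using divisor_of_nat_pow[OF g(1)] g(2) Dn[OF n(1)] by simp
    also have "\<dots> = divisor h" unfolding Dh[symmetric] k by (simp add: mult.commute)
    finally have hgk: "divisor h = divisor (g [^]\<^bsub>K\<^esub> k)" by simp
    have hk: "h \<in> SI ((\<chi> [^]\<^bsub>Z\<^esub> n) [^]\<^bsub>Z\<^esub> k) - {\<zero>\<^bsub>K\<^esub>}" using h(1) k cZ by (simp add: Z.nat_pow_pow)
    note ct = coh_diff_torsion[OF Z1_pow_closed[OF cZ] n(2) g(1) hk hgk]
    have cd: "coh_div K R G \<phi> (D (\<chi> [^]\<^bsub>Z\<^esub> n)) = coh_cl (cocycle g)"
      unfolding g(2) by (rule coh_div_eq[OF g(1) ct(1)])
    have "D (\<chi> [^]\<^bsub>Z\<^esub> n) \<in> principal_divisors K R" using g unfolding principal_divisors_def by blast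
    then have "coh_cl (\<chi> [^]\<^bsub>Z\<^esub> n) \<otimes>\<^bsub>H1 K R G \<phi>\<^esub> inv\<^bsub>H1 K R G \<phi>\<^esub> coh_cl (cocycle g) = \<one>\<^bsub>H1 K R G \<phi>\<^esub>"
      using hyp n(1) ct(2) unfolding cd[symmetric] coh_one by blast
    then have "coh_cl (\<chi> [^]\<^bsub>Z\<^esub> n) = coh_cl (cocycle g)"
      using c.hom_closed[OF Z1_pow_closed[OF cZ]] c.hom_closed[OF ct(1)]
      by (metis H.inv_closed H.inv_equality H.inv_inv)
    then have "?iso n"
      using iso_iff[OF n(1)] coh_eq_imp_generator[OF rk[OF n(1)] g(1) ct(1) g(2)] by blast
    then have "q0 \<le> n" using q0_le n(1) by blast
    moreover have "n \<le> q0" using k n by simp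
    ultimately show ?thesis by (simp add: n_def)
  qed
  then show ?thesis using tor unfolding q0_def by blast
qed

end
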